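(* Let $N$ be a Poisson point process on $[0,1]\times[0,\infty)$ with Lebesgue intensity, and let $b:[0,1)\to[0,\infty)$ be nondecreasing and continuous with $b(1-)=\infty$. Let $\tau$ be the stopping time that stops at the first record $(t,Z_t)$ with $Z_t\le b(t)$. Then the success probability of $\tau$ (the probability that the record at which $\tau$ stops is the last record, i.e. its mark is the overall minimal mark on $[0,1]$) equals $$\mathcal P(b)=\int_0^1 e^{-t b(t)}\,b(t)\,J\bigl((1-t)b(t)\bigr)\,\mathrm dt+\int_0^1 e^{-t b(t)}\,t\,D\bigl((1-t)b(t)\bigr)\,\mathrm db(t),$$ where $$J(z)=\frac{1-e^{-z}}{z},\qquad D(z)=e^{-z}\int_0^z\frac{e^s-1}{s}\,\mathrm ds .$$ In particular, for the hyperbolic boundary $b(t)=\beta/(1-t)$ with $\beta>0$, $$\mathcal P(b)=D(\beta)+\bigl(J(\beta)-D(\beta)\bigr)\,\beta e^{\beta}\int_\beta^\infty\frac{e^{-z}}{z}\,\mathrm dz .$$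
   Context: A point $(t,x)$ of $N$ is read as a mark $x$ arriving at time $t$. The running minimum $Z_t$ is the lowest mark among arrivals on $[0,t]$. An atom $(t,x)$ of $N$ is a record if there are no other atoms of $N$ in $[0,t]\times[0,x]$; it is the last record if in addition there are no other atoms in $[t,1]\times[0,x]$. If there is no record $(t,Z_t)$ with $Z_t\le b(t)$, then no choice is made, which counts as failure. The integral with respect to $\mathrm db(t)$ is a Lebesgue–Stieltjes integral over $t\in(0,1)$. *)

theory Defs
  imports "HOL-Probability.Probability"
begin

text \<open>
  A point process is represented by its random set of atoms, locally finite for every outcome.
  This is no restriction for a diffuse intensity such as Lebesgue measure, where a Poisson
  process has almost surely no multiple atoms. The Poisson probabilities are written out since
  \<^const>\<open>poisson_pmf\<close> excludes the rate 0.
\<close>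

definition point_process :: "'w measure \<Rightarrow> 'a::metric_space measure \<Rightarrow> ('w \<Rightarrow> 'a set) \<Rightarrow> bool" where
  "point_process M \<mu> N \<longleftrightarrow>
     (\<forall>\<omega>\<in>space M. N \<omega> \<subseteq> space \<mu> \<and> (\<forall>K. bounded K \<longrightarrow> finite (N \<omega> \<inter> K)))"

definition poisson_point_process ::
    "'w measure \<Rightarrow> 'a::metric_space measure \<Rightarrow> ('w \<Rightarrow> 'a set) \<Rightarrow> bool" where
  "poisson_point_process M \<mu> N \<longleftrightarrow>
     prob_space M \<and> point_process M \<mu> N \<and>
     (\<forall>B\<in>sets \<mu>. emeasure \<mu> B < \<infinity> \<longrightarrow>
        (\<lambda>\<omega>. card (N \<omega> \<inter> B)) \<in> measurable M (count_space UNIV) \<and>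
        (AE \<omega> in M. finite (N \<omega> \<inter> B)) \<and>
        (\<forall>k. measure M {\<omega>\<in>space M. card (N \<omega> \<inter> B) = k} =
             measure \<mu> B ^ k / fact k * exp (- measure \<mu> B))) \<and>
     (\<forall>n (B :: nat \<Rightarrow> 'a set).
        (\<forall>i<n. B i \<in> sets \<mu> \<and> emeasure \<mu> (B i) < \<infinity>) \<and> disjoint_family_on B {..<n} \<longrightarrow>
        prob_space.indep_vars M (\<lambda>_. count_space UNIV) (\<lambda>i \<omega>. card (N \<omega> \<inter> B i)) {..<n})"

definition lebesgue_strip :: "(real \<times> real) measure" where
  "lebesgue_strip = restrict_space lborel ({0..1} \<times> {0..})"


text \<open>If there is no arrival on \<open>[0,t]\<close>, then \<open>running_min S t\<close> is an unspecified number; this has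
  no effect below, since \<open>(t, running_min S t)\<close> is then not an atom and hence not a record.\<close>

definition running_min :: "(real \<times> real) set \<Rightarrow> real \<Rightarrow> real" where
  "running_min S t = Inf {x. \<exists>s\<in>{0..t}. (s, x) \<in> S}"

definition is_record :: "(real \<times> real) set \<Rightarrow> real \<Rightarrow> real \<Rightarrow> bool" where
  "is_record S t x \<longleftrightarrow> (t, x) \<in> S \<and> S \<inter> ({0..t} \<times> {0..x}) \<subseteq> {(t, x)}"

definition is_last_record :: "(real \<times> real) set \<Rightarrow> real \<Rightarrow> real \<Rightarrow> bool" where
  "is_last_record S t x \<longleftrightarrow> is_record S t x \<and> S \<inter> ({t..1} \<times> {0..x}) \<subseteq> {(t, x)}"

definition acceptable :: "(real \<Rightarrow> real) \<Rightarrow> (real \<times> real) set \<Rightarrow> real \<Rightarrow> bool" where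
  "acceptable b S t \<longleftrightarrow>
     t \<in> {0..<1} \<and> is_record S t (running_min S t) \<and> running_min S t \<le> b t"

text \<open>The event that \<open>\<tau> = t\<close>; there is at most one such \<open>t\<close>, and none if no choice is made.\<close>

definition stops_at :: "(real \<Rightarrow> real) \<Rightarrow> (real \<times> real) set \<Rightarrow> real \<Rightarrow> bool" where
  "stops_at b S t \<longleftrightarrow> acceptable b S t \<and> (\<forall>s<t. \<not> acceptable b S s)"

definition success_probability ::
    "'w measure \<Rightarrow> ('w \<Rightarrow> (real \<times> real) set) \<Rightarrow> (real \<Rightarrow> real) \<Rightarrow> real" where
  "success_probability M N b =
     measure M {\<omega>\<in>space M. \<exists>t. stops_at b (N \<omega>) t \<and>
                               is_last_record (N \<omega>) t (running_min (N \<omega>) t)}"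


definition J :: "real \<Rightarrow> real" where
  "J z = (if z = 0 then 1 else (1 - exp (- z)) / z)"

definition D :: "real \<Rightarrow> real" where
  "D z = exp (- z) * (LINT s:{0..z}|lborel. (exp s - 1) / s)"


text \<open>The Lebesgue-Stieltjes measure of a function on \<open>(0,1)\<close>. The library's
  \<^const>\<open>interval_measure\<close> does not apply to a function that is unbounded at \<open>1\<close>; the definition
  is the same construction carried out on the open unit interval.\<close>

definition stieltjes_measure :: "(real \<Rightarrow> real) \<Rightarrow> real measure" where
  "stieltjes_measure F =
     extend_measure {0<..<1} {(s, t). 0 < s \<and> s \<le> t \<and> t < 1}
       (\<lambda>(s, t). {s<..t}) (\<lambda>(s, t). ennreal (F t - F s))"

lemma space_stieltjes_measure [simp]: "space (stieltjes_measure F) = {0<..<1}"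
  unfolding stieltjes_measure_def by (rule space_extend_measure) auto

lemma sets_stieltjes_measure:
  "sets (stieltjes_measure F) = sigma_sets {0<..<1} {{s<..t} |s t. 0 < s \<and> s \<le> t \<and> t < 1}"
proof -
  have "(\<lambda>(s::real, t). {s<..t}) ` {(s, t). 0 < s \<and> s \<le> t \<and> t < 1} =
        {{s<..t} |s t. 0 < s \<and> s \<le> t \<and> t < 1}"
    by auto
  then show ?thesis
    unfolding stieltjes_measure_def by (subst sets_extend_measure) auto
qed

lemma emeasure_stieltjes_measure_Ioc:
  assumes mono: "mono_on {0<..<1} F" and cont: "continuous_on {0<..<1} F"
    and st: "0 < s" "s \<le> t" "t < 1"
  shows "emeasure (stieltjes_measure F) {s<..t} = ennreal (F t - F s)"
proof -
  define \<phi> :: "real \<Rightarrow> real" where "\<phi> x = 1 / (1 + exp (- x))" for x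
  define \<psi> :: "real \<Rightarrow> real" where "\<psi> y = ln (y / (1 - y))" for y
  have \<phi>_range: "\<phi> x \<in> {0<..<1}" for x
    by (auto simp: \<phi>_def field_simps add_pos_pos)
  have \<phi>_less: "\<phi> x < \<phi> y \<longleftrightarrow> x < y" for x y
    by (auto simp: \<phi>_def field_simps add_pos_pos)
  have \<phi>_\<psi>: "\<phi> (\<psi> y) = y" if "0 < y" "y < 1" for y
    using that by (simp add: \<phi>_def \<psi>_def exp_minus field_simps)
  have \<phi>_cont: "continuous_on UNIV \<phi>"
  proof -
    have "1 + exp (- x) \<noteq> 0" for x :: real
      using exp_gt_zero[of "-x"] by linarith
    then show ?thesis
      unfolding \<phi>_def by (intro continuous_intros) auto
  qed
  have [measurable]: "\<phi> \<in> borel_measurable borel"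
    by (rule borel_measurable_continuous_onI[OF \<phi>_cont])
  define W where "W = distr (interval_measure (F \<circ> \<phi>)) borel \<phi>"
  have "continuous_on UNIV (F \<circ> \<phi>)"
    using \<phi>_range by (intro continuous_on_compose \<phi>_cont continuous_on_subset[OF cont]) auto
  then have rc: "continuous (at_right a) (F \<circ> \<phi>)" for a
    using continuous_on_eq_continuous_at continuous_at_imp_continuous_at_within open_UNIV by blast
  have mn: "(F \<circ> \<phi>) x \<le> (F \<circ> \<phi>) y" if "x \<le> y" for x y
    using mono \<phi>_range that \<phi>_less[of y x] unfolding comp_def by (intro mono_onD[OF mono]) auto
  have W: "emeasure W {u<..v} = ennreal (F v - F u)" if uv: "0 < u" "u \<le> v" "v < 1" for u v
  proof -
    have pre: "\<phi> -` {u<..v} = {\<psi> u<..\<psi> v}"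
    proof -
      have "u < \<phi> x \<longleftrightarrow> \<psi> u < x" "\<phi> x \<le> v \<longleftrightarrow> x \<le> \<psi> v" for x
        using \<phi>_less[of "\<psi> u" x] \<phi>_less[of "\<psi> v" x] \<phi>_\<psi>[of u] \<phi>_\<psi>[of v] uv by auto
      then show ?thesis by auto
    qed
    have le: "\<psi> u \<le> \<psi> v"
      using \<phi>_less[of "\<psi> v" "\<psi> u"] \<phi>_\<psi>[of u] \<phi>_\<psi>[of v] uv by auto
    have "emeasure W {u<..v} = emeasure (interval_measure (F \<circ> \<phi>)) {\<psi> u<..\<psi> v}"
      unfolding W_def by (subst emeasure_distr) (simp_all add: pre)
    also have "\<dots> = ennreal ((F \<circ> \<phi>) (\<psi> v) - (F \<circ> \<phi>) (\<psi> u))"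
      by (rule emeasure_interval_measure_Ioc[OF le mn rc])
    finally show ?thesis using uv by (simp add: \<phi>_\<psi>)
  qed
  have sub: "sets (stieltjes_measure F) \<subseteq> sets W"
  proof -
    have "A \<in> sets borel" if "A \<in> sigma_sets {0<..<1} {{s<..t} |s t. 0 < s \<and> s \<le> t \<and> t < 1}"
      for A :: "real set"
      using that by induction auto
    then show ?thesis by (auto simp: sets_stieltjes_measure W_def)
  qed
  show ?thesis
  proof (rule emeasure_extend_measure_Pair[OF stieltjes_measure_def, where \<mu>' = "emeasure W"])
    show "emeasure W {u<..v} = ennreal (F v - F u)" if "0 < u \<and> u \<le> v \<and> v < 1" for u v
      using W that by blast
    show "{u<..v} \<in> Pow {0<..<1}" if "0 < u \<and> u \<le> v \<and> v < 1" for u v :: real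
      using that by auto
    show "positive (sets (stieltjes_measure F)) (emeasure W)"
      by (simp add: positive_def)
    show "countably_additive (sets (stieltjes_measure F)) (emeasure W)"
      using sub by (auto simp: countably_additive_def intro!: suminf_emeasure)
    show "0 < s \<and> s \<le> t \<and> t < 1"
      using st by simp
  qed
qed

end

theory Submission
  imports Defs "HOL-Real_Asymp.Real_Asymp"
begin

text \<open>
Success means that the overall lowest atom \<open>(\<tau>, x)\<close> satisfies \<open>x \<le> b \<tau>\<close> and that nothing was
accepted before \<open>\<tau>\<close>. The boundary is nondecreasing, which makes the second condition a statement
about a single atom (\<open>no_acceptable_iff\<close>): nothing is accepted up to time \<open>u\<close> if and only if the
lowest atom \<open>(\<sigma>, z)\<close> of \<open>[0, u]\<close> lies above the boundary at its own time, \<open>b \<sigma> < z\<close>. Earlier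
records have higher marks and met a lower boundary, so they were rejected as well. The level \<open>z\<close>
itself may have been overtaken by the boundary between \<open>\<sigma>\<close> and \<open>u\<close>.

For a Poisson process \<open>\<sigma>\<close> is uniform on \<open>[0, u]\<close>, and \<open>z\<close>, the lowest mark on \<open>(u, v]\<close> and the lowest
mark on \<open>(v, 1]\<close> are exponential with rates \<open>u\<close>, \<open>v - u\<close> and \<open>1 - v\<close>, all four independent
(\<open>past_future_law\<close>). Letting \<open>u\<close> and \<open>v\<close> tend to \<open>\<tau>\<close>, the time of a successful atom has density
\[ \int_0^\tau ds \int_{b(s)}^\infty dz\; e^{-\tau z} \int_0^{\min(z, b(\tau))} e^{-(1-\tau)x}\,dx \]
(\<open>success_prob_eq\<close>). The part \<open>z > b \<tau>\<close> is the integrand of the first integral of the theorem: the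
process jumps below the boundary at \<open>\<tau>\<close>. In the part \<open>b s < z \<le> b \<tau>\<close> the boundary reaches the level
\<open>z\<close> at some time \<open>t\<close> between \<open>s\<close> and \<open>\<tau>\<close>. Substituting \<open>z = b t\<close> turns \<open>dz\<close> into \<open>db t\<close>, and
integrating over \<open>s \<in> (0, t)\<close> and \<open>\<tau> \<in> [t, 1)\<close> gives the factors \<open>t\<close> and \<open>D\<close> of the second integral
(\<open>nn_integral_crossing\<close>).

The passage to a time density is made rigorous by cutting \<open>[0, 1]\<close> into \<open>n\<close> cells. The event that a
cell contains a successful atom is approximated by a condition on the past minimum, its position
and the lowest marks of the cell and of the future. For every locally finite set of atoms, not just
almost every one, some cell fulfils its condition exactly if there is a success at a positive time,
once \<open>n\<close> is large (\<open>grid_success_eventually\<close>). This yields both the measurability of the success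
event on a probability space that need not be complete and the limit of the probabilities.

For the hyperbolic boundary \<open>(1 - t) * b t\<close> is the constant \<open>\<beta>\<close>, so \<open>J \<beta>\<close> and \<open>D \<beta>\<close> leave the integrals
and the substitution \<open>z = b t\<close> reduces both of them to the exponential integral.
\<close>

section \<open>Records of a locally finite set of atoms\<close>

text \<open>
The value is \<open>\<infinity>\<close> when no atom has its time in \<open>I\<close>. Extended reals keep this case ordered correctly,
which the exact description of the success event needs.
\<close>
definition lowest :: "(real \<times> real) set \<Rightarrow> real set \<Rightarrow> ereal" where
  "lowest S I = (INF p\<in>S \<inter> (I \<times> UNIV). ereal (snd p))"

text \<open>
The time of the first atom attaining the lowest mark on \<open>[0, u]\<close>, written as an infimum of times \<open>s\<close>
so that \<open>leftmost S u \<le> q\<close> becomes a comparison of two lowest marks; if \<open>[0, u]\<close> has no atom, the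
value is \<open>0\<close>.
\<close>
definition leftmost :: "(real \<times> real) set \<Rightarrow> real \<Rightarrow> real" where
  "leftmost S u = Inf {s\<in>{0..u}. lowest S {0..s} \<le> lowest S {0..u}}"

definition atom_config :: "(real \<times> real) set \<Rightarrow> bool" where
  "atom_config S \<longleftrightarrow> S \<subseteq> {0..1} \<times> {0..} \<and> (\<forall>K. bounded K \<longrightarrow> finite (S \<inter> K))"

lemma atom_configD:
  assumes "atom_config S" "(t, x) \<in> S"
  shows "0 \<le> t" "t \<le> 1" "0 \<le> x"
  using assms by (auto simp: atom_config_def)

lemma finite_atoms_below:
  assumes "atom_config S"
  shows "finite {p\<in>S. snd p \<le> x}"
proof (rule finite_subset)
  show "{p\<in>S. snd p \<le> x} \<subseteq> S \<inter> ({0..1} \<times> {0..x})"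
    using assms by (auto simp: atom_config_def)
  show "finite (S \<inter> ({0..1} \<times> {0..x}))"
    using assms by (simp add: atom_config_def bounded_Times)
qed

lemma lowest_ge_iff: "c \<le> lowest S I \<longleftrightarrow> (\<forall>(s, x)\<in>S. s \<in> I \<longrightarrow> c \<le> ereal x)"
  by (force simp: lowest_def le_INF_iff)

lemma lowest_le: "(s, x) \<in> S \<Longrightarrow> s \<in> I \<Longrightarrow> lowest S I \<le> ereal x"
  by (force simp: lowest_def intro!: INF_lower2)

lemma lowest_empty: "S \<inter> (I \<times> UNIV) = {} \<Longrightarrow> lowest S I = \<infinity>"
  by (simp add: lowest_def top_ereal_def)

lemma lowest_Un: "lowest S (I \<union> K) = min (lowest S I) (lowest S K)"
  by (auto simp: lowest_def Int_Un_distrib Sigma_Un_distrib1 INF_union inf_min)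

text \<open>
Local finiteness leaves finitely many atoms below any given mark, so the infimum is a minimum and,
among the atoms attaining it, one comes first. Ties are not excluded, because the argument must
hold for every outcome.
\<close>
lemma lowest_attained:
  assumes S: "atom_config S" and ne: "lowest S I < \<infinity>"
  obtains s x where "(s, x) \<in> S" "s \<in> I" "lowest S I = ereal x"
    "\<And>r y. (r, y) \<in> S \<Longrightarrow> r \<in> I \<Longrightarrow> x < y \<or> (x = y \<and> s \<le> r)"
proof -
  have "S \<inter> (I \<times> UNIV) \<noteq> {}" using ne lowest_empty[of S I] by auto
  then obtain s0 x0 where 0: "(s0, x0) \<in> S" "s0 \<in> I" by auto
  define A where "A = {p\<in>S. snd p \<le> x0} \<inter> (I \<times> UNIV)"
  have A: "finite A" "(s0, x0) \<in> A" using 0 finite_atoms_below[OF S, of x0] by (auto simp: A_def)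
  define x where "x = Min (snd ` A)"
  have x_in: "x \<in> snd ` A" unfolding x_def using A by (intro Min_in) auto
  have x_le: "x \<le> snd p" if "p \<in> A" for p unfolding x_def using A that by (intro Min_le) auto
  define s where "s = Min {r. (r, x) \<in> A}"
  have fin: "finite {r. (r, x) \<in> A}"
    by (rule finite_subset[of _ "fst ` A"]) (use A in \<open>force+\<close>)
  have s_in: "(s, x) \<in> A"
    using Min_in[OF fin] x_in unfolding s_def by fastforce
  have s_le: "s \<le> r" if "(r, x) \<in> A" for r unfolding s_def using fin that by (intro Min_le) auto
  have *: "x < y \<or> (x = y \<and> s \<le> r)" if "(r, y) \<in> S" "r \<in> I" for r y
  proof (cases "y \<le> x0")
    case True
    then have "(r, y) \<in> A" using that by (auto simp: A_def)
    then show ?thesis using x_le[of "(r, y)"] s_le[of r] by fastforce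
  next
    case False then show ?thesis using x_le[OF A(2)] by auto
  qed
  moreover have "lowest S I = ereal x"
  proof (rule antisym)
    show "lowest S I \<le> ereal x" using s_in by (intro lowest_le[of s]) (auto simp: A_def)
    show "ereal x \<le> lowest S I" using * by (fastforce simp: lowest_ge_iff)
  qed
  ultimately show thesis using that[of s x] s_in by (auto simp: A_def)
qed

lemma leftmost_props:
  assumes S: "atom_config S" and u: "0 \<le> u"
  shows "leftmost S u \<in> {0..u}"
    and "q \<in> {0..u} \<Longrightarrow> leftmost S u \<le> q \<longleftrightarrow> lowest S {0..q} \<le> lowest S {0..u}"
    and "lowest S {0..u} < \<infinity> \<Longrightarrow> \<exists>x. (leftmost S u, x) \<in> S \<and> lowest S {0..u} = ereal x \<and>
       (\<forall>r y. (r, y) \<in> S \<longrightarrow> r \<le> u \<longrightarrow> x < y \<or> (x = y \<and> leftmost S u \<le> r))"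
proof -
  let ?B = "{s\<in>{0..u}. lowest S {0..s} \<le> lowest S {0..u}}"
  have "\<exists>s0\<in>{0..u}. ?B = {s0..u} \<and> (lowest S {0..u} < \<infinity> \<longrightarrow> (\<exists>x. (s0, x) \<in> S \<and> lowest S {0..u} = ereal x \<and>
       (\<forall>r y. (r, y) \<in> S \<longrightarrow> r \<le> u \<longrightarrow> x < y \<or> (x = y \<and> s0 \<le> r))))"
  proof (cases "lowest S {0..u} < \<infinity>")
    case True
    obtain s x where sx: "(s, x) \<in> S" "s \<in> {0..u}" "lowest S {0..u} = ereal x"
      "\<And>r y. (r, y) \<in> S \<Longrightarrow> r \<in> {0..u} \<Longrightarrow> x < y \<or> (x = y \<and> s \<le> r)"
      using lowest_attained[OF S True] by metis
    have "q \<in> ?B \<longleftrightarrow> q \<in> {s..u}" for q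
    proof
      assume q: "q \<in> {s..u}"
      then show "q \<in> ?B" using lowest_le[OF sx(1), of "{0..q}"] sx by auto
    next
      assume q: "q \<in> ?B"
      then have "lowest S {0..q} < \<infinity>" using True by (auto intro: le_less_trans)
      then obtain r y where ry: "(r, y) \<in> S" "r \<in> {0..q}" "lowest S {0..q} = ereal y"
        using lowest_attained[OF S] by metis
      then show "q \<in> {s..u}" using sx(4)[of r y] q sx(3) by force
    qed
    then have "?B = {s..u}" by blast
    moreover have "x < y \<or> (x = y \<and> s \<le> r)" if "(r, y) \<in> S" "r \<le> u" for r y
      using that sx(4)[of r y] atom_configD[OF S that(1)] by auto
    ultimately show ?thesis using sx by blast
  next
    case False
    then show ?thesis using u by (intro bexI[of _ 0]) auto
  qed
  then obtain s0 where s0: "s0 \<in> {0..u}" "?B = {s0..u}" "lowest S {0..u} < \<infinity> \<longrightarrow> (\<exists>x. (s0, x) \<in> S \<and> lowest S {0..u} = ereal x \<and>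
       (\<forall>r y. (r, y) \<in> S \<longrightarrow> r \<le> u \<longrightarrow> x < y \<or> (x = y \<and> s0 \<le> r)))" by blast
  have "leftmost S u = s0" unfolding leftmost_def s0(2) using s0(1) by simp
  moreover have "q \<in> ?B \<longleftrightarrow> s0 \<le> q" if "q \<in> {0..u}" for q using s0(2) that by auto
  ultimately show "leftmost S u \<in> {0..u}"
     "q \<in> {0..u} \<Longrightarrow> leftmost S u \<le> q \<longleftrightarrow> lowest S {0..q} \<le> lowest S {0..u}"
     "lowest S {0..u} < \<infinity> \<Longrightarrow> \<exists>x. (leftmost S u, x) \<in> S \<and> lowest S {0..u} = ereal x \<and>
       (\<forall>r y. (r, y) \<in> S \<longrightarrow> r \<le> u \<longrightarrow> x < y \<or> (x = y \<and> leftmost S u \<le> r))"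
    using s0 by auto
qed

lemma running_min_record:
  assumes S: "atom_config S" and "(t, x) \<in> S" and "\<And>r y. (r, y) \<in> S \<Longrightarrow> r \<le> t \<Longrightarrow> x \<le> y"
  shows "running_min S t = x"
  unfolding running_min_def
proof (rule cInf_eq_minimum)
  show "x \<in> {x. \<exists>s\<in>{0..t}. (s, x) \<in> S}" using assms atom_configD[OF S assms(2)] by auto
qed (use assms in auto)

lemma is_record_iff:
  assumes S: "atom_config S"
  shows "is_record S t x \<longleftrightarrow> (t, x) \<in> S \<and> (\<forall>r y. (r, y) \<in> S \<longrightarrow> r \<le> t \<longrightarrow> y \<le> x \<longrightarrow> (r, y) = (t, x))"
  using atom_configD[OF S] by (fastforce simp: is_record_def)

lemma running_min_of_record:
  assumes S: "atom_config S" and "is_record S t x"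
  shows "running_min S t = x"
  using assms(2) by (intro running_min_record[OF S]) (force simp: is_record_iff[OF S])+

lemma acceptable_iff:
  assumes S: "atom_config S"
  shows "acceptable b S t \<longleftrightarrow> (\<exists>x. t \<in> {0..<1} \<and> is_record S t x \<and> x \<le> b t)"
  using running_min_of_record[OF S] by (auto simp: acceptable_def)

text \<open>
If the leftmost lowest atom \<open>(\<sigma>, x)\<close> of \<open>[0, u]\<close> is rejected, so is every record before \<open>\<sigma>\<close>, as
its mark exceeds \<open>x\<close> and its boundary value is at most \<open>b \<sigma>\<close>; after \<open>\<sigma>\<close> there are no records up to
\<open>u\<close>. Conversely that atom is itself a record.
\<close>
lemma no_acceptable_iff:
  assumes S: "atom_config S" and mono: "mono_on {0..<1} b" and u: "0 \<le> u" "u < 1"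
  shows "(\<forall>s\<le>u. \<not> acceptable b S s) \<longleftrightarrow> ereal (b (leftmost S u)) < lowest S {0..u}"
proof (cases "lowest S {0..u} < \<infinity>")
  case True
  define \<sigma> where "\<sigma> = leftmost S u"
  obtain x where x: "(\<sigma>, x) \<in> S" "lowest S {0..u} = ereal x"
     "\<And>r y. (r, y) \<in> S \<Longrightarrow> r \<le> u \<Longrightarrow> x < y \<or> (x = y \<and> \<sigma> \<le> r)"
    using leftmost_props(3)[OF S u(1) True] by (auto simp: \<sigma>_def)
  have \<sigma>: "\<sigma> \<in> {0..u}" using leftmost_props(1)[OF S u(1)] by (simp add: \<sigma>_def)
  have rec: "is_record S \<sigma> x" unfolding is_record_iff[OF S] using x \<sigma> by fastforce
  show ?thesis
  proof
    assume "\<forall>s\<le>u. \<not> acceptable b S s"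
    then have "\<not> acceptable b S \<sigma>" using \<sigma> by auto
    then have "b \<sigma> < x" using rec \<sigma> u unfolding acceptable_iff[OF S] by auto
    then show "ereal (b (leftmost S u)) < lowest S {0..u}" using x(2) by (simp add: \<sigma>_def)
  next
    assume "ereal (b (leftmost S u)) < lowest S {0..u}"
    then have less: "b \<sigma> < x" using x(2) by (simp add: \<sigma>_def)
    show "\<forall>s\<le>u. \<not> acceptable b S s"
    proof (intro allI impI notI)
      fix s assume s: "s \<le> u" and "acceptable b S s"
      then obtain y where y: "s \<in> {0..<1}" "is_record S s y" "y \<le> b s" by (auto simp: acceptable_iff[OF S])
      have "(s, y) \<in> S" using y by (auto simp: is_record_iff[OF S])
      then have xy: "x \<le> y" using x(3)[of s y] s by auto
      show False
      proof (cases "s < \<sigma>")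
        case True
        then have "b s \<le> b \<sigma>" using mono_onD[OF mono, of s \<sigma>] y \<sigma> u by auto
        then show False using xy less y by auto
      next
        case False
        then have "(\<sigma>, x) = (s, y)" using y(2) x(1) xy unfolding is_record_iff[OF S] by auto
        then show False using less y by auto
      qed
    qed
  qed
next
  case False
  then have "\<not> is_record S s x" if "s \<le> u" for s x
    using lowest_le[of s x S "{0..u}"] atom_configD[OF S, of s x] that by (auto simp: is_record_def)
  then show ?thesis using False by (auto simp: acceptable_iff[OF S])
qed

definition succeeds_at :: "(real \<Rightarrow> real) \<Rightarrow> (real \<times> real) set \<Rightarrow> real \<Rightarrow> bool" where
  "succeeds_at b S t \<longleftrightarrow> (\<exists>x. 0 \<le> t \<and> t < 1 \<and> (t, x) \<in> S \<and>
     (\<forall>r y. (r, y) \<in> S \<longrightarrow> y \<le> x \<longrightarrow> (r, y) = (t, x)) \<and> x \<le> b t \<and> (\<forall>s<t. \<not> acceptable b S s))"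

text \<open>
Stopping at the last record, rephrased without reference to the running minimum: the atom is the
strict overall minimum, acceptable, and preceded by no acceptable time.
\<close>
lemma succeeds_at_iff:
  assumes S: "atom_config S"
  shows "stops_at b S t \<and> is_last_record S t (running_min S t) \<longleftrightarrow> succeeds_at b S t"
proof
  assume A: "stops_at b S t \<and> is_last_record S t (running_min S t)"
  then obtain x where x: "t \<in> {0..<1}" "is_record S t x" "x \<le> b t" "\<forall>s<t. \<not> acceptable b S s"
    by (auto simp: stops_at_def acceptable_iff[OF S])
  have last: "S \<inter> ({t..1} \<times> {0..x}) \<subseteq> {(t, x)}"
    using A running_min_of_record[OF S x(2)] by (auto simp: is_last_record_def)
  have uniq: "(r, y) = (t, x)" if "(r, y) \<in> S" "y \<le> x" for r y
  proof (cases "r \<le> t")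
    case True
    then show ?thesis using x(2) that unfolding is_record_iff[OF S] by blast
  next
    case False
    then have "(r, y) \<in> S \<inter> ({t..1} \<times> {0..x})" using that atom_configD[OF S that(1)] by simp
    then show ?thesis using last by blast
  qed
  have "(t, x) \<in> S" using x(2) by (simp add: is_record_def)
  then show "succeeds_at b S t"
    using x(1,3,4) uniq unfolding succeeds_at_def by (metis atLeastLessThan_iff)
next
  assume "succeeds_at b S t"
  then obtain x where x: "0 \<le> t" "t < 1" "(t, x) \<in> S"
     "\<And>r y. (r, y) \<in> S \<Longrightarrow> y \<le> x \<Longrightarrow> (r, y) = (t, x)" "x \<le> b t" "\<forall>s<t. \<not> acceptable b S s"
    unfolding succeeds_at_def by blast
  have rec: "is_record S t x" unfolding is_record_iff[OF S] using x(3,4) by blast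
  have "S \<inter> ({t..1} \<times> {0..x}) \<subseteq> {(t, x)}"
  proof
    fix p assume "p \<in> S \<inter> ({t..1} \<times> {0..x})"
    then show "p \<in> {(t, x)}" using x(4)[of "fst p" "snd p"] by (cases p) simp
  qed
  then have "is_last_record S t x" using rec by (simp add: is_last_record_def)
  then show "stops_at b S t \<and> is_last_record S t (running_min S t)"
    using rec x(1,2,5,6) running_min_of_record[OF S rec]
    unfolding stops_at_def acceptable_def by simp
qed

text \<open>
The approximation of the event that a successful atom arrives in \<open>(u, v]\<close>. It uses the boundary at
the right end \<open>v\<close>, so that \<open>x \<le> b t\<close> always implies \<open>x \<le> b v\<close>; conversely an atom with \<open>b t < x\<close> fails
the test as soon as \<open>v\<close> is close to \<open>t\<close>.
\<close>
definition cell_success :: "(real \<Rightarrow> real) \<Rightarrow> (real \<times> real) set \<Rightarrow> real \<Rightarrow> real \<Rightarrow> bool" where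
  "cell_success b S u v \<longleftrightarrow>
     lowest S {u<..v} < lowest S {0..u} \<and> lowest S {u<..v} < lowest S {v<..1} \<and>
     lowest S {u<..v} \<le> ereal (b v) \<and> ereal (b (leftmost S u)) < lowest S {0..u}"

lemma cell_success_location:
  assumes S: "atom_config S" and A: "cell_success b S u v" and "0 \<le> u" "u \<le> v" "v \<le> 1"
    and tx: "(t, x) \<in> S" "\<And>r y. (r, y) \<in> S \<Longrightarrow> x \<le> y"
  shows "t \<in> {u<..v}"
proof (rule ccontr)
  assume t: "t \<notin> {u<..v}"
  have "t \<in> {0..u} \<union> {v<..1}" using t atom_configD[OF S tx(1)] by auto
  then have "lowest S {u<..v} < ereal x"
    using A lowest_le[OF tx(1), of "{0..u}"] lowest_le[OF tx(1), of "{v<..1}"]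
    by (auto simp: cell_success_def)
  then obtain r y where "(r, y) \<in> S" "ereal y < ereal x"
    using lowest_attained[OF S, of "{u<..v}"] by (metis less_ereal.simps(4) less_trans ereal_infty_less(1) ereal_less_PInfty not_less_iff_gr_or_eq)
  then show False using tx(2) by force
qed

text \<open>
The acceptable times before \<open>t\<close> form a finite set, since each of them carries an atom with mark at
most \<open>b t\<close>. Hence no acceptable time lies in \<open>(u, t)\<close> once \<open>u\<close> is close to \<open>t\<close>, and the past up to \<open>u\<close>
decides as the past up to \<open>t\<close> does.
\<close>
lemma cell_success_eventually_iff:
  assumes S: "atom_config S" and mono: "mono_on {0..<1} b" and cont: "continuous_on {0..<1} b"
    and t: "0 < t" "t < 1" "(t, x) \<in> S"
    and min: "\<And>r y. (r, y) \<in> S \<Longrightarrow> y \<le> x \<Longrightarrow> (r, y) = (t, x)"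
  obtains \<delta> where "\<delta> > 0" "\<And>u v. 0 \<le> u \<Longrightarrow> u < t \<Longrightarrow> t \<le> v \<Longrightarrow> v < 1 \<Longrightarrow> v - u < \<delta> \<Longrightarrow>
     cell_success b S u v \<longleftrightarrow> succeeds_at b S t"
proof -
  let ?T = "{s. s < t \<and> acceptable b S s}"
  have "?T \<subseteq> fst ` {p\<in>S. snd p \<le> b t}"
  proof
    fix s assume "s \<in> ?T"
    then obtain y where "s < t" "0 \<le> s" "(s, y) \<in> S" "y \<le> b s"
      by (auto simp: acceptable_iff[OF S] is_record_def)
    moreover from this have "b s \<le> b t" using mono_onD[OF mono, of s t] t by auto
    ultimately show "s \<in> fst ` {p\<in>S. snd p \<le> b t}" by force
  qed
  then have finT: "finite ?T" using finite_atoms_below[OF S] by (meson finite_imageI finite_subset)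
  have "\<exists>d>0. \<forall>s\<in>?T. s < t - d"
  proof (cases "?T = {}")
    case False
    define m where "m = Max ?T"
    have m: "m \<in> ?T" "\<And>s. s \<in> ?T \<Longrightarrow> s \<le> m" using finT False Max_in Max_ge unfolding m_def by blast+
    then show ?thesis by (intro exI[of _ "(t - m) / 2"]) (auto simp: field_simps, smt (verit))
  qed (auto intro!: exI[of _ 1])
  then obtain d1 where d1: "d1 > 0" "\<And>s. s < t \<Longrightarrow> acceptable b S s \<Longrightarrow> s < t - d1" by auto
  have "\<exists>d>0. \<forall>v. t \<le> v \<longrightarrow> v < 1 \<longrightarrow> v < t + d \<longrightarrow> (x \<le> b v \<longleftrightarrow> x \<le> b t)"
  proof (cases "x \<le> b t")
    case True
    then show ?thesis using mono_onD[OF mono, of t] t by (intro exI[of _ 1]) force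
  next
    case False
    obtain d where d: "d > 0" "\<And>v. v \<in> {0..<1} \<Longrightarrow> dist v t < d \<Longrightarrow> dist (b v) (b t) < x - b t"
      using cont t False unfolding continuous_on_iff by (metis atLeastLessThan_iff diff_gt_0_iff_gt less_eq_real_def not_le)
    have "\<not> x \<le> b v" if "t \<le> v" "v < 1" "v < t + d" for v
      using d(2)[of v] that t False by (auto simp: dist_real_def)
    then show ?thesis using d(1) False by (intro exI[of _ d]) auto
  qed
  then obtain d2 where d2: "d2 > 0" "\<And>v. t \<le> v \<Longrightarrow> v < 1 \<Longrightarrow> v < t + d2 \<Longrightarrow> (x \<le> b v \<longleftrightarrow> x \<le> b t)" by auto
  show thesis
  proof (rule that[of "min d1 d2"])
    show "0 < min d1 d2" using d1 d2 by simp
    fix u v assume uv: "0 \<le> u" "u < t" "t \<le> v" "v < 1" "v - u < min d1 d2"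
    have low: "lowest S {u<..v} = ereal x"
    proof (rule antisym)
      show "lowest S {u<..v} \<le> ereal x" using t uv by (intro lowest_le[of t]) auto
      show "ereal x \<le> lowest S {u<..v}" using min by (force simp: lowest_ge_iff)
    qed
    have out: "ereal x < lowest S I" if "t \<notin> I" for I
    proof (rule ccontr)
      assume "\<not> ereal x < lowest S I"
      then have *: "lowest S I \<le> ereal x" by simp
      then have "lowest S I < \<infinity>" using le_less_trans by force
      then obtain r y where "(r, y) \<in> S" "r \<in> I" "lowest S I = ereal y" using lowest_attained[OF S] by metis
      then show False using min[of r y] * that by auto
    qed
    have "cell_success b S u v \<longleftrightarrow> x \<le> b v \<and> (\<forall>s\<le>u. \<not> acceptable b S s)"
      using out[of "{0..u}"] out[of "{v<..1}"] uv
      by (auto simp: cell_success_def low no_acceptable_iff[OF S mono])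
    also have "\<dots> \<longleftrightarrow> x \<le> b t \<and> (\<forall>s<t. \<not> acceptable b S s)"
      using d2(2)[of v] d1(2) uv by (smt (verit))
    also have "\<dots> \<longleftrightarrow> succeeds_at b S t"
    proof
      assume "succeeds_at b S t"
      then obtain y where y: "(t, y) \<in> S" "\<And>r z. (r, z) \<in> S \<Longrightarrow> z \<le> y \<Longrightarrow> (r, z) = (t, y)"
         "y \<le> b t" "\<forall>s<t. \<not> acceptable b S s" unfolding succeeds_at_def by blast
      have "y = x" using min[OF y(1)] y(2)[OF t(3)] by (metis linear prod.inject)
      then show "x \<le> b t \<and> (\<forall>s<t. \<not> acceptable b S s)" using y(3,4) by simp
    next
      assume "x \<le> b t \<and> (\<forall>s<t. \<not> acceptable b S s)"
      then show "succeeds_at b S t" using t min unfolding succeeds_at_def by (metis less_imp_le)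
    qed
    finally show "cell_success b S u v \<longleftrightarrow> succeeds_at b S t" .
  qed
qed

text \<open>
The first and the last cell are left out: the laws below need \<open>0 < u\<close>, and nothing is known about
\<open>b 1\<close>. This does no harm in the limit, as an atom with \<open>0 < t < 1\<close> avoids both cells for large \<open>n\<close>.
\<close>
definition grid_success :: "(real \<Rightarrow> real) \<Rightarrow> (real \<times> real) set \<Rightarrow> nat \<Rightarrow> bool" where
  "grid_success b S n \<longleftrightarrow> (\<exists>k. 1 \<le> k \<and> k + 1 < n \<and> cell_success b S (k / n) ((real k + 1) / n))"

text \<open>
If the overall minimum is attained at one time strictly inside the unit interval, the previous
lemma applies to the cell around it. If it is attained at two times, these fall into different
cells for large \<open>n\<close>, whereas a successful cell contains all of them. If it is attained only at time
\<open>0\<close> or \<open>1\<close>, no cell contains it.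
\<close>
lemma grid_success_eventually:
  assumes S: "atom_config S" and mono: "mono_on {0..<1} b" and cont: "continuous_on {0..<1} b"
  shows "\<forall>\<^sub>F n in sequentially. grid_success b S n \<longleftrightarrow> (\<exists>t>0. succeeds_at b S t)"
proof (cases "S = {}")
  case True
  then show ?thesis
    by (simp add: grid_success_def cell_success_def succeeds_at_def lowest_empty)
next
  case False
  then obtain r0 y0 where "(r0, y0) \<in> S" by auto
  then have "lowest S UNIV < \<infinity>"
    using lowest_le[of r0 y0 S UNIV] by (auto intro: le_less_trans)
  then obtain t x where tx: "(t, x) \<in> S" "\<And>r y. (r, y) \<in> S \<Longrightarrow> x < y \<or> (x = y \<and> t \<le> r)"
    using lowest_attained[OF S] by (metis UNIV_I)
  then have x_le: "\<And>r y. (r, y) \<in> S \<Longrightarrow> x \<le> y" by fastforce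
  have t01: "0 \<le> t" "t \<le> 1" using atom_configD[OF S tx(1)] by auto
  have cell: "t \<in> {k / n<..(real k + 1) / n}"
    if "1 \<le> k" "k + 1 < n" "cell_success b S (k / n) ((real k + 1) / n)" for k n :: nat
    using that by (intro cell_success_location[OF S that(3) _ _ _ tx(1) x_le]) (auto simp: field_simps)
  show ?thesis
  proof (cases "0 < t \<and> t < 1 \<and> (\<forall>r y. (r, y) \<in> S \<longrightarrow> y \<le> x \<longrightarrow> (r, y) = (t, x))")
    case True
    then have t: "0 < t" "t < 1" and min: "\<And>r y. (r, y) \<in> S \<Longrightarrow> y \<le> x \<Longrightarrow> (r, y) = (t, x)" by auto
    obtain \<delta> where \<delta>: "\<delta> > 0" "\<And>u v. 0 \<le> u \<Longrightarrow> u < t \<Longrightarrow> t \<le> v \<Longrightarrow> v < 1 \<Longrightarrow> v - u < \<delta> \<Longrightarrow>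
       cell_success b S u v \<longleftrightarrow> succeeds_at b S t"
      using cell_success_eventually_iff[OF S mono cont t tx(1) min] by metis
    define \<epsilon> where "\<epsilon> = min \<delta> (min t (1 - t))"
    have "\<epsilon> > 0" using \<delta> t by (simp add: \<epsilon>_def)
    have succ: "(\<exists>s>0. succeeds_at b S s) \<longleftrightarrow> succeeds_at b S t"
    proof
      assume "\<exists>s>0. succeeds_at b S s"
      then obtain s y where s: "succeeds_at b S s" "(s, y) \<in> S" "\<And>r z. (r, z) \<in> S \<Longrightarrow> z \<le> y \<Longrightarrow> (r, z) = (s, y)"
        unfolding succeeds_at_def by blast
      have "(t, x) = (s, y)" using x_le[OF s(2)] by (intro s(3) tx(1))
      then have "s = t" by simp
      then show "succeeds_at b S t" using s(1) by simp
    qed (use t in auto)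
    have "\<forall>\<^sub>F n in sequentially. 1 / real n < \<epsilon>"
      using \<open>\<epsilon> > 0\<close> by real_asymp
    then show ?thesis
      using eventually_gt_at_top[of "0::nat"]
    proof eventually_elim
      case (elim n)
      then have n: "n > 0" "1 / real n < \<delta>" "1 < t * n" "1 < (1 - t) * n"
        by (auto simp: \<epsilon>_def field_simps)
      \<comment> \<open>The cell containing t; the cells are closed on the right, hence the ceiling.\<close>
      define k where "k = nat \<lceil>t * n\<rceil> - 1"
      have k: "real k < t * n" "t * n \<le> real k + 1"
        using n by (simp_all add: k_def) linarith+
      then have "1 \<le> k" "k + 1 < n" using n by (simp_all add: algebra_simps)
      have iff: "cell_success b S (k / n) ((real k + 1) / n) \<longleftrightarrow> succeeds_at b S t"
        using k n \<open>k + 1 < n\<close> by (intro \<delta>(2)) (auto simp: field_simps)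
      have "k' = k" if k': "1 \<le> k'" "k' + 1 < n" "cell_success b S (k' / n) ((real k' + 1) / n)" for k'
      proof -
        have "t \<in> {k' / n<..(real k' + 1) / n}" by (rule cell[OF k'])
        then have "real k' < t * n" "t * n \<le> real k' + 1" using n by (auto simp: field_simps)
        then show ?thesis using k by linarith
      qed
      then have "grid_success b S n \<longleftrightarrow> cell_success b S (k / n) ((real k + 1) / n)"
        unfolding grid_success_def using \<open>1 \<le> k\<close> \<open>k + 1 < n\<close> by metis
      then show ?case using iff succ by simp
    qed
  next
    case False
    have no: "\<not> succeeds_at b S s" if "0 < s" for s
    proof
      assume "succeeds_at b S s"
      then obtain y where y: "s < 1" "(s, y) \<in> S" "\<And>r z. (r, z) \<in> S \<Longrightarrow> z \<le> y \<Longrightarrow> (r, z) = (s, y)"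
        unfolding succeeds_at_def by blast
      then have "(t, x) = (s, y)" using x_le[OF y(2)] tx(1) by blast
      then show False using False y(1,3) that tx(1) by (metis prod.inject)
    qed
    show ?thesis
    proof (cases "0 < t \<and> t < 1")
      case True
      then obtain r where r: "(r, x) \<in> S" "r \<noteq> t" using False x_le by fastforce
      have "\<forall>\<^sub>F n in sequentially. 1 / real n < \<bar>r - t\<bar>" using r by real_asymp
      then show ?thesis
      proof eventually_elim
        case (elim n)
        have "\<not> (1 \<le> k \<and> k + 1 < n \<and> cell_success b S (k / n) ((real k + 1) / n))" for k
        proof
          assume k: "1 \<le> k \<and> k + 1 < n \<and> cell_success b S (k / n) ((real k + 1) / n)"
          have "r \<in> {k / n<..(real k + 1) / n}"
            using k by (intro cell_success_location[OF S _ _ _ _ r(1) x_le]) (auto simp: field_simps)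
          then have "\<bar>r - t\<bar> \<le> (real k + 1) / n - k / n" using cell[of k n] k by auto
          then show False using elim by (simp add: diff_divide_distrib[symmetric])
        qed
        then show ?case using no by (auto simp: grid_success_def)
      qed
    next
      case F: False
      have "\<not> grid_success b S n" for n
      proof
        assume "grid_success b S n"
        then obtain k where k: "1 \<le> k" "k + 1 < n" "cell_success b S (k / n) ((real k + 1) / n)"
          by (auto simp: grid_success_def)
        have *: "0 < k / n" "(real k + 1) / n < 1" using k by (auto simp: field_simps)
        have "t \<in> {k / n<..(real k + 1) / n}" by (rule cell[OF k])
        then have "0 < t" "t < 1" using * by auto
        then show False using F by auto
      qed
      then show ?thesis using no by auto
    qed
  qed
qed

section \<open>Lowest marks of the Poisson process\<close>

lemma poisson_prob_space: "poisson_point_process M \<mu> N \<Longrightarrow> prob_space M"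
  by (simp add: poisson_point_process_def)

lemma poisson_atom_config:
  assumes "poisson_point_process M lebesgue_strip N" "\<omega> \<in> space M"
  shows "atom_config (N \<omega>)"
  using assms unfolding poisson_point_process_def point_process_def atom_config_def
  by (auto simp: lebesgue_strip_def space_restrict_space)

lemma strip_rectangle:
  fixes I :: "real set" and a :: real
  assumes [measurable]: "I \<in> sets borel" and I: "I \<subseteq> {0..1}"
  shows "I \<times> {0..<a} \<in> sets lebesgue_strip"
    and "emeasure lebesgue_strip (I \<times> {0..<a}) = ennreal (measure lborel I * max 0 a)"
proof -
  have strip: "{0..1::real} \<times> {0::real..} \<inter> space lborel \<in> sets lborel"
    by (simp add: borel_Times)
  have rect: "I \<times> {0..<a} \<in> sets (lborel :: (real \<times> real) measure)"
    by (simp add: borel_Times)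
  have sub: "I \<times> {0..<a} \<subseteq> {0..1} \<times> {0..}" using I by auto
  show "I \<times> {0..<a} \<in> sets lebesgue_strip"
    unfolding lebesgue_strip_def sets_restrict_space_iff[OF strip] using rect sub by simp
  have fin: "emeasure lborel I < \<infinity>"
    using emeasure_mono[OF I, of lborel] by (auto simp: top_unique less_top[symmetric])
  have "emeasure lebesgue_strip (I \<times> {0..<a}) = emeasure (lborel :: (real \<times> real) measure) (I \<times> {0..<a})"
    unfolding lebesgue_strip_def by (rule emeasure_restrict_space[OF strip sub])
  also have "\<dots> = emeasure lborel I * emeasure lborel {0..<a}"
    unfolding lborel_prod[symmetric] by (rule lborel.emeasure_pair_measure_Times) auto
  also have "emeasure lborel {0..<a} = ennreal (max 0 a)"
    by (cases "0 \<le> a") auto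
  also have "emeasure lborel I = ennreal (measure lborel I)"
    using fin by (intro emeasure_eq_ennreal_measure) auto
  finally show "emeasure lebesgue_strip (I \<times> {0..<a}) = ennreal (measure lborel I * max 0 a)"
    by (simp add: ennreal_mult)
qed

lemma lowest_ge_iff_card:
  assumes S: "atom_config S" and I: "I \<subseteq> {0..1}"
  shows "ereal a \<le> lowest S I \<longleftrightarrow> card (S \<inter> (I \<times> {0..<a})) = 0"
proof -
  have "bounded (I \<times> {0..<a})" using bounded_subset[OF _ I] by (intro bounded_Times) auto
  then have "finite (S \<inter> (I \<times> {0..<a}))" using S by (simp add: atom_config_def)
  then have "card (S \<inter> (I \<times> {0..<a})) = 0 \<longleftrightarrow> S \<inter> (I \<times> {0..<a}) = {}" by simp
  also have "\<dots> \<longleftrightarrow> ereal a \<le> lowest S I"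
    using atom_configD(3)[OF S] unfolding lowest_ge_iff by fastforce
  finally show ?thesis by simp
qed

text \<open>
All that is used of the Poisson process: the lowest mark on \<open>I\<close> is at least \<open>a\<close> exactly if the
rectangle \<open>I \<times> [0, a)\<close> contains no atom, and counts in disjoint rectangles are independent Poisson
variables. Nonpositive \<open>a\<close> are covered by an empty rectangle.
\<close>
lemma poisson_avoid:
  fixes I :: "nat \<Rightarrow> real set" and a :: "nat \<Rightarrow> real"
  assumes P: "poisson_point_process M lebesgue_strip N"
    and I: "\<And>i. i < n \<Longrightarrow> I i \<in> sets borel" "\<And>i. i < n \<Longrightarrow> I i \<subseteq> {0..1}"
    and disj: "disjoint_family_on I {..<n}" and n: "0 < n"
  shows "{\<omega>\<in>space M. \<forall>i<n. ereal (a i) \<le> lowest (N \<omega>) (I i)} \<in> sets M" (is "?A \<in> _")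
    and "measure M {\<omega>\<in>space M. \<forall>i<n. ereal (a i) \<le> lowest (N \<omega>) (I i)} =
         (\<Prod>i<n. exp (- (measure lborel (I i) * max 0 (a i))))"
proof -
  interpret prob_space M using P by (rule poisson_prob_space)
  define R where "R i = I i \<times> {0..<a i}" for i
  define X where "X i \<omega> = card (N \<omega> \<inter> R i)" for i \<omega>
  have R: "R i \<in> sets lebesgue_strip" "emeasure lebesgue_strip (R i) = ennreal (measure lborel (I i) * max 0 (a i))"
    if "i < n" for i using strip_rectangle[OF I(1,2)[OF that]] by (simp_all add: R_def)
  have mR: "measure lebesgue_strip (R i) = measure lborel (I i) * max 0 (a i)" if "i < n" for i
    using R(2)[OF that] by (simp add: measure_def)
  have fin: "emeasure lebesgue_strip (R i) < \<infinity>" if "i < n" for i using R(2)[OF that] by simp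
  have X: "X i \<in> measurable M (count_space UNIV)"
     "prob {\<omega>\<in>space M. X i \<omega> = 0} = exp (- (measure lborel (I i) * max 0 (a i)))" if "i < n" for i
  proof -
    have *: "X i \<in> measurable M (count_space UNIV) \<and> (\<forall>k. measure M {\<omega>\<in>space M. X i \<omega> = k} =
             measure lebesgue_strip (R i) ^ k / fact k * exp (- measure lebesgue_strip (R i)))"
      using P R(1)[OF that] fin[OF that] unfolding poisson_point_process_def X_def[abs_def] by blast
    then show "X i \<in> measurable M (count_space UNIV)" by blast
    show "prob {\<omega>\<in>space M. X i \<omega> = 0} = exp (- (measure lborel (I i) * max 0 (a i)))"
      using *[THEN conjunct2, THEN spec, of 0] by (simp add: mR[OF that])
  qed
  have "disjoint_family_on R {..<n}"
    using disj by (fastforce simp: disjoint_family_on_def R_def)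
  then have ind: "indep_vars (\<lambda>_. count_space UNIV) X {..<n}"
    using P R(1) fin unfolding poisson_point_process_def X_def[abs_def] by blast
  have ev: "{\<omega>\<in>space M. \<forall>i<n. ereal (a i) \<le> lowest (N \<omega>) (I i)} = (\<Inter>i\<in>{..<n}. X i -` {0} \<inter> space M)"
    using n lowest_ge_iff_card[OF poisson_atom_config[OF P] I(2)]
    by (auto simp: X_def R_def)
  show "?A \<in> sets M" unfolding ev using X(1) n
    by (intro sets.finite_INT) (auto intro: measurable_sets)
  have "prob ?A = (\<Prod>i<n. prob (X i -` {0} \<inter> space M))"
    unfolding ev using n by (intro indep_varsD_finite[OF ind]) auto
  also have "\<dots> = (\<Prod>i<n. exp (- (measure lborel (I i) * max 0 (a i))))"
  proof (rule prod.cong)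
    fix i assume "i \<in> {..<n}"
    moreover have "X i -` {0} \<inter> space M = {\<omega>\<in>space M. X i \<omega> = 0}" by auto
    ultimately show "prob (X i -` {0} \<inter> space M) = exp (- (measure lborel (I i) * max 0 (a i)))"
      using X(2) by simp
  qed simp
  finally show "prob ?A = (\<Prod>i<n. exp (- (measure lborel (I i) * max 0 (a i))))" .
qed

lemma poisson_avoid_single:
  assumes P: "poisson_point_process M lebesgue_strip N"
    and I: "I \<in> sets borel" "I \<subseteq> {0..1}"
  shows "{\<omega>\<in>space M. ereal a \<le> lowest (N \<omega>) I} \<in> sets M"
    and "measure M {\<omega>\<in>space M. ereal a \<le> lowest (N \<omega>) I} = exp (- (measure lborel I * max 0 a))"
  using poisson_avoid[OF P, of 1 "\<lambda>_. I" "\<lambda>_. a"] I by (simp_all add: disjoint_family_on_def)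

lemma ereal_eq_infinityI: "(\<And>n::nat. ereal (real n) \<le> x) \<Longrightarrow> x = \<infinity>"
  by (rule ereal_top) (meson ereal_less_eq(3) order_trans real_arch_simple)

lemma lowest_measurable:
  assumes P: "poisson_point_process M lebesgue_strip N"
    and I: "I \<in> sets borel" "I \<subseteq> {0..1}"
  shows "(\<lambda>\<omega>. lowest (N \<omega>) I) \<in> borel_measurable M"
proof (rule borel_measurableI_ge)
  fix y :: ereal
  show "{\<omega> \<in> space M. y \<le> lowest (N \<omega>) I} \<in> sets M"
  proof (cases y)
    case PInf
    have "{\<omega> \<in> space M. y \<le> lowest (N \<omega>) I} = (\<Inter>n::nat. {\<omega> \<in> space M. ereal (real n) \<le> lowest (N \<omega>) I})"
      unfolding PInf using ereal_eq_infinityI by auto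
    also have "\<dots> \<in> sets M" using poisson_avoid_single(1)[OF P I] by (intro sets.countable_INT) auto
    finally show ?thesis .
  qed (use poisson_avoid_single(1)[OF P I] in auto)
qed

lemma lowest_finite_AE:
  assumes P: "poisson_point_process M lebesgue_strip N"
    and I: "I \<in> sets borel" "I \<subseteq> {0..1}" and pos: "0 < measure lborel I"
  shows "AE \<omega> in M. lowest (N \<omega>) I < \<infinity>"
proof -
  interpret prob_space M using P by (rule poisson_prob_space)
  note [measurable] = lowest_measurable[OF P I]
  let ?A = "{\<omega>\<in>space M. lowest (N \<omega>) I = \<infinity>}"
  have "prob ?A \<le> exp (- (measure lborel I * real n))" for n
  proof -
    have "prob ?A \<le> prob {\<omega>\<in>space M. ereal (real n) \<le> lowest (N \<omega>) I}"
      by (intro finite_measure_mono) auto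
    then show ?thesis using poisson_avoid_single(2)[OF P I, of "real n"] by simp
  qed
  moreover have "(\<lambda>n. exp (- (measure lborel I * real n))) \<longlonglongrightarrow> 0" using pos by real_asymp
  ultimately have "prob ?A \<le> 0" by (intro LIMSEQ_le_const[of _ 0]) auto
  then have "prob ?A = 0" by (simp add: antisym)
  then have "emeasure M ?A = 0" by (simp add: emeasure_eq_measure)
  then show ?thesis by (subst AE_iff_measurable[OF _ refl]) (auto simp: not_less top_unique)
qed

lemma lowest_null_AE:
  assumes P: "poisson_point_process M lebesgue_strip N"
    and I: "I \<in> sets borel" "I \<subseteq> {0..1}" and null: "measure lborel I = 0"
  shows "AE \<omega> in M. lowest (N \<omega>) I = \<infinity>"
proof -
  interpret prob_space M using P by (rule poisson_prob_space)
  have "AE \<omega> in M. ereal (real n) \<le> lowest (N \<omega>) I" for n :: nat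
    using poisson_avoid_single[OF P I, of "real n"] null
      prob_eq_1[of "{\<omega>\<in>space M. ereal (real n) \<le> lowest (N \<omega>) I}"] by simp
  then have "AE \<omega> in M. \<forall>n. ereal (real n) \<le> lowest (N \<omega>) I" by (simp add: AE_all_countable)
  then show ?thesis
  proof eventually_elim
    case (elim \<omega>)
    then show ?case by (intro ereal_eq_infinityI) simp
  qed
qed

text \<open>
For \<open>q\<close> in \<open>[0, u]\<close> the event \<open>leftmost \<le> q\<close> compares the lowest marks of \<open>[0, q]\<close> and \<open>[0, u]\<close>.
\<close>
lemma leftmost_measurable:
  assumes P: "poisson_point_process M lebesgue_strip N" and u: "0 \<le> u" "u \<le> 1"
  shows "(\<lambda>\<omega>. leftmost (N \<omega>) u) \<in> borel_measurable M"
proof (rule borel_measurableI_le)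
  fix q
  have low: "(\<lambda>\<omega>. lowest (N \<omega>) {0..s}) \<in> borel_measurable M" if "s \<le> 1" for s
    using that by (intro lowest_measurable[OF P]) auto
  note L = leftmost_props[OF poisson_atom_config[OF P] u(1)]
  consider "q < 0" | "u \<le> q" | "q \<in> {0..u}" by fastforce
  then show "{\<omega> \<in> space M. leftmost (N \<omega>) u \<le> q} \<in> sets M"
  proof cases
    case 1
    then have "{\<omega> \<in> space M. leftmost (N \<omega>) u \<le> q} = {}" using L(1) by fastforce
    then show ?thesis by (metis sets.empty_sets)
  next
    case 2
    then have "{\<omega> \<in> space M. leftmost (N \<omega>) u \<le> q} = space M" using L(1) by fastforce
    then show ?thesis by simp
  next
    case 3
    then have "{\<omega> \<in> space M. leftmost (N \<omega>) u \<le> q} = {\<omega> \<in> space M. lowest (N \<omega>) {0..q} \<le> lowest (N \<omega>) {0..u}}"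
      using L(2) by blast
    also have "\<dots> \<in> sets M"
      using 3 u by (intro borel_measurable_le low) auto
    finally show ?thesis .
  qed
qed

lemma measure_eqI_atMost:
  fixes M N :: "'a::ordered_euclidean_space measure"
  assumes sets: "sets M = sets borel" "sets N = sets borel" and fin: "finite_measure M"
    and eq: "\<And>a. emeasure M {..a} = emeasure N {..a}"
  shows "M = N"
proof (rule measure_eqI_generator_eq[where E = "range (\<lambda>a. {..a})" and \<Omega> = UNIV and A = "\<lambda>n. {..real n *\<^sub>R One}"])
  show "Int_stable (range (\<lambda>a::'a. {..a}))"
  proof -
    have "{..a} \<inter> {..c} = {..inf a c}" for a c :: 'a by auto
    then show ?thesis by (auto simp: Int_stable_def)
  qed
  show "sets M = sigma_sets UNIV (range (\<lambda>a. {..a}))" "sets N = sigma_sets UNIV (range (\<lambda>a. {..a}))"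
    unfolding sets by (simp_all add: borel_eq_atMost)
  show "(\<Union>n. {..real n *\<^sub>R One}) = (UNIV :: 'a set)"
  proof safe
    fix x :: 'a
    obtain n where n: "norm x \<le> real n" using real_arch_simple by blast
    have "x \<le> real n *\<^sub>R One"
      unfolding eucl_le[where 'a='a]
    proof
      fix i :: 'a assume i: "i \<in> Basis"
      have "x \<bullet> i \<le> norm x" using Basis_le_norm[OF i, of x] by linarith
      then show "x \<bullet> i \<le> (real n *\<^sub>R One) \<bullet> i" using n i by simp
    qed
    then show "x \<in> (\<Union>n. {..real n *\<^sub>R One})" by auto
  qed simp
  show "emeasure M {..real i *\<^sub>R One} \<noteq> \<infinity>" for i
    using finite_measure.emeasure_finite[OF fin] by simp
qed (use eq in auto)

text \<open>
Avoidance probabilities are probabilities of upper orthants, so laws are identified by these; the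
reflection \<open>x \<mapsto> - x\<close> carries the statement for lower orthants over.
\<close>
lemma measure_eqI_atLeast:
  fixes M N :: "'a::ordered_euclidean_space measure"
  assumes sets: "sets M = sets borel" "sets N = sets borel" and fin: "finite_measure M"
    and eq: "\<And>a. emeasure M {a..} = emeasure N {a..}"
  shows "M = N"
proof -
  have [measurable]: "(uminus :: 'a \<Rightarrow> 'a) \<in> measurable borel borel"
    by (intro borel_measurable_continuous_onI continuous_intros)
  have refl: "distr (distr K borel uminus) borel uminus = K" if "sets K = sets borel" for K :: "'a measure"
  proof -
    have "distr (distr K borel uminus) borel uminus = distr K borel (\<lambda>x. x)"
      using that by (subst distr_distr) (auto simp: comp_def cong: measurable_cong_sets)
    also have "\<dots> = K" using that by (intro distr_id2) simp
    finally show ?thesis .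
  qed
  have "emeasure (distr K borel uminus) {..a} = emeasure K {-a..}" if "sets K = sets borel" for K :: "'a measure" and a
    using that sets_eq_imp_space_eq[OF that]
    by (subst emeasure_distr) (auto cong: measurable_cong_sets intro!: arg_cong[of _ _ "emeasure K"] simp: minus_le_iff)
  then have "distr M borel uminus = distr N borel uminus"
    using sets eq fin
    by (intro measure_eqI_atMost finite_measure.finite_measure_distr) (auto cong: measurable_cong_sets)
  then show ?thesis using refl sets by metis
qed

lemma atLeast_Pair: "{(a, c)..} = {a..} \<times> {c..}"
  by (auto simp: less_eq_prod_def)

section \<open>Joint law of the past minimum and the future minima\<close>

definition exp_law :: "real \<Rightarrow> real measure" where
  "exp_law l = density lborel (\<lambda>x. ennreal (exponential_density l x))"

lemma sets_exp_law [simp, measurable_cong]: "sets (exp_law l) = sets borel"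
  and space_exp_law [simp]: "space (exp_law l) = UNIV"
  by (simp_all add: exp_law_def)

lemma prob_space_exp_law: "0 < l \<Longrightarrow> prob_space (exp_law l)"
  unfolding exp_law_def by (rule prob_space_exponential_density)

lemma nn_integral_exp_law:
  assumes [measurable]: "f \<in> borel_measurable borel"
  shows "(\<integral>\<^sup>+x. f x \<partial>exp_law l) = (\<integral>\<^sup>+x. ennreal (exponential_density l x) * f x \<partial>lborel)"
  unfolding exp_law_def by (rule nn_integral_density) auto

lemma emeasure_exp_law_atLeast:
  assumes l: "0 < l"
  shows "emeasure (exp_law l) {a..} = ennreal (exp (- (l * max 0 a)))"
proof -
  have "emeasure (exp_law l) {a..} = (\<integral>\<^sup>+x. ennreal (exponential_density l x) * indicator {a..} x \<partial>lborel)"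
    unfolding exp_law_def by (rule emeasure_density) auto
  also have "\<dots> = (\<integral>\<^sup>+x. ennreal (l * exp (- (l * x))) * indicator {max 0 a..} x \<partial>lborel)"
    by (intro nn_integral_cong) (auto simp: exponential_density_def indicator_def mult.commute)
  also have "\<dots> = ennreal (0 - (- exp (- (l * max 0 a))))"
  proof (rule nn_integral_FTC_atLeast)
    show "((\<lambda>x. - exp (- (l * x))) \<longlongrightarrow> 0) at_top" using l by real_asymp
  qed (use l in \<open>auto intro!: derivative_eq_intros\<close>)
  finally show ?thesis by simp
qed

lemma emeasure_exp_law_greaterThan:
  assumes l: "0 < l"
  shows "emeasure (exp_law l) {a<..} = ennreal (exp (- (l * max 0 a)))"
proof -
  have "emeasure (exp_law l) {a<..} = (\<integral>\<^sup>+x. ennreal (exponential_density l x) * indicator {a<..} x \<partial>lborel)"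
    unfolding exp_law_def by (rule emeasure_density) auto
  also have "\<dots> = (\<integral>\<^sup>+x. ennreal (exponential_density l x) * indicator {a..} x \<partial>lborel)"
  proof (rule nn_integral_cong_AE)
    show "AE x in lborel. ennreal (exponential_density l x) * indicator {a<..} x =
        ennreal (exponential_density l x) * indicator {a..} x"
      using AE_lborel_singleton[of a] by eventually_elim (auto simp: indicator_def)
  qed
  also have "\<dots> = emeasure (exp_law l) {a..}"
    unfolding exp_law_def by (rule emeasure_density[symmetric]) auto
  finally show ?thesis using emeasure_exp_law_atLeast[OF l] by simp
qed

text \<open>
The law of minus a uniform variable on \<open>[0, l]\<close>. The sign turns \<open>leftmost \<le> q\<close> into an upper orthant,
as needed for \<open>measure_eqI_atLeast\<close>.
\<close>
definition uniform_neg :: "real \<Rightarrow> real measure" where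
  "uniform_neg l = density lborel (\<lambda>s. ennreal (indicator {-l..0} s / l))"

lemma sets_uniform_neg [simp, measurable_cong]: "sets (uniform_neg l) = sets borel"
  and space_uniform_neg [simp]: "space (uniform_neg l) = UNIV"
  by (simp_all add: uniform_neg_def)

lemma emeasure_uniform_neg_atLeast:
  assumes l: "0 < l"
  shows "emeasure (uniform_neg l) {a..} = ennreal (max 0 (min l (- a)) / l)"
proof -
  have "emeasure (uniform_neg l) {a..} = (\<integral>\<^sup>+s. ennreal (indicator {-l..0} s / l) * indicator {a..} s \<partial>lborel)"
    unfolding uniform_neg_def by (rule emeasure_density) auto
  also have "\<dots> = (\<integral>\<^sup>+s. ennreal (1 / l) * indicator {max a (- l)..0} s \<partial>lborel)"
    by (intro nn_integral_cong) (auto simp: indicator_def)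
  also have "\<dots> = ennreal (1 / l) * emeasure lborel {max a (- l)..0}"
    by (rule nn_integral_cmult_indicator) simp
  also have "emeasure lborel {max a (- l)..0} = ennreal (max 0 (min l (- a)))"
    using l by (cases "max a (- l) \<le> 0") (auto simp: max_def min_def)
  also have "ennreal (1 / l) * ennreal (max 0 (min l (- a))) = ennreal (1 / l * max 0 (min l (- a)))"
    using l by (intro ennreal_mult[symmetric]) auto
  finally show ?thesis by simp
qed

lemma sets_borel_pair4:
  "sets (borel \<Otimes>\<^sub>M (borel \<Otimes>\<^sub>M (borel \<Otimes>\<^sub>M borel))) = sets (borel :: (real \<times> real \<times> real \<times> real) measure)"
  unfolding borel_prod ..

text \<open>
Almost surely equal to \<open>lowest\<close> on intervals of positive length, and the form in which laws on a
Euclidean space can be compared.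
\<close>
definition real_lowest :: "(real \<times> real) set \<Rightarrow> real set \<Rightarrow> real" where
  "real_lowest S I = real_of_ereal (lowest S I)"

lemma real_lowest_measurable:
  assumes P: "poisson_point_process M lebesgue_strip N"
    and I: "I \<in> sets borel" "I \<subseteq> {0..1}"
  shows "(\<lambda>\<omega>. real_lowest (N \<omega>) I) \<in> borel_measurable M"
  unfolding real_lowest_def using lowest_measurable[OF P I] by measurable

lemma lowest_eq_real_lowest:
  assumes S: "atom_config S" and "lowest S I < \<infinity>"
  shows "lowest S I = ereal (real_lowest S I)" "0 \<le> real_lowest S I"
proof -
  obtain s x where "(s, x) \<in> S" "lowest S I = ereal x"
    using lowest_attained[OF assms] by metis
  then show "lowest S I = ereal (real_lowest S I)" "0 \<le> real_lowest S I"
    using atom_configD(3)[OF S] by (auto simp: real_lowest_def)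
qed

context
  fixes M :: "'w measure" and N and q u v :: real
  assumes P: "poisson_point_process M lebesgue_strip N"
    and quv: "0 < q" "q < u" "u < v" "v < 1"
begin

interpretation prob_space M using P by (rule poisson_prob_space)

lemma four_blocks_finite_AE:
  "AE \<omega> in M. lowest (N \<omega>) {0..q} < \<infinity> \<and> lowest (N \<omega>) {q<..u} < \<infinity> \<and>
     lowest (N \<omega>) {u<..v} < \<infinity> \<and> lowest (N \<omega>) {v<..1} < \<infinity>"
  using quv by (intro AE_conjI lowest_finite_AE[OF P]) auto

text \<open>
The past \<open>[0, u]\<close> is cut at an auxiliary time \<open>q\<close>, in order to find out on which side of \<open>q\<close> its
minimum lies.
\<close>
lemma four_blocks_law:
  "distr M borel (\<lambda>\<omega>. (real_lowest (N \<omega>) {0..q}, real_lowest (N \<omega>) {q<..u}, real_lowest (N \<omega>) {u<..v}, real_lowest (N \<omega>) {v<..1})) =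
   exp_law q \<Otimes>\<^sub>M (exp_law (u - q) \<Otimes>\<^sub>M (exp_law (v - u) \<Otimes>\<^sub>M exp_law (1 - v)))" (is "distr M borel ?X = ?R")
proof (rule measure_eqI_atLeast)
  have [measurable]: "(\<lambda>\<omega>. real_lowest (N \<omega>) I) \<in> borel_measurable M" if "I \<in> {{0..q}, {q<..u}, {u<..v}, {v<..1}}" for I
    using that quv by (intro real_lowest_measurable[OF P]) auto
  have X[measurable]: "?X \<in> borel_measurable M"
    unfolding borel_prod[symmetric] by (intro measurable_Pair) auto
  interpret E1: prob_space "exp_law (u - q)" using quv by (intro prob_space_exp_law) auto
  interpret E2: prob_space "exp_law (v - u)" using quv by (intro prob_space_exp_law) auto
  interpret E3: prob_space "exp_law (1 - v)" using quv by (intro prob_space_exp_law) auto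
  interpret E23: pair_prob_space "exp_law (v - u)" "exp_law (1 - v)" ..
  interpret E123: pair_prob_space "exp_law (u - q)" "exp_law (v - u) \<Otimes>\<^sub>M exp_law (1 - v)" ..
  show "sets (distr M borel ?X) = sets borel" by simp
  show "sets ?R = sets borel"
    unfolding sets_borel_pair4[symmetric] by (intro sets_pair_measure_cong) simp_all
  show "finite_measure (distr M borel ?X)" by (intro finite_measure_distr X)
  fix p :: "real \<times> real \<times> real \<times> real"
  obtain a0 a1 a2 a3 where p: "p = (a0, a1, a2, a3)" by (metis prod_cases4)
  define I where "I = (\<lambda>i::nat. if i = 0 then {0..q} else if i = 1 then {q<..u} else if i = 2 then {u<..v} else {v<..1})"
  define a where "a = (\<lambda>i::nat. if i = 0 then a0 else if i = 1 then a1 else if i = 2 then a2 else a3)"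
  have lt4: "{..<4::nat} = {0, 1, 2, 3}" by auto
  have all4: "(\<forall>i<4. Q i) \<longleftrightarrow> Q 0 \<and> Q 1 \<and> Q 2 \<and> Q 3" for Q :: "nat \<Rightarrow> bool"
    using lt4 by (metis insertE insertI1 insertI2 lessThan_iff singletonD)
  let ?A = "{\<omega>\<in>space M. \<forall>i<4. ereal (a i) \<le> lowest (N \<omega>) (I i)}"
  have A: "?A \<in> sets M" "measure M ?A = (\<Prod>i<4. exp (- (measure lborel (I i) * max 0 (a i))))"
  proof -
    have 1: "I i \<in> sets borel" for i by (simp add: I_def)
    have 2: "I i \<subseteq> {0..1}" for i using quv by (auto simp: I_def)
    have 3: "disjoint_family_on I {..<4}"
      using quv unfolding disjoint_family_on_def lt4 by (simp add: I_def Int_def)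
    show "?A \<in> sets M" by (rule poisson_avoid(1)[OF P 1 2 3]) simp
    show "measure M ?A = (\<Prod>i<4. exp (- (measure lborel (I i) * max 0 (a i))))"
      by (rule poisson_avoid(2)[OF P 1 2 3]) simp
  qed
  have "emeasure (distr M borel ?X) {p..} = emeasure M {\<omega>\<in>space M. p \<le> ?X \<omega>}"
    by (subst emeasure_distr) (auto intro!: arg_cong[of _ _ "emeasure M"])
  also have "\<dots> = emeasure M ?A"
  proof (rule emeasure_eq_AE)
    show "AE \<omega> in M. \<omega> \<in> {\<omega>\<in>space M. p \<le> ?X \<omega>} \<longleftrightarrow> \<omega> \<in> ?A"
      using four_blocks_finite_AE
    proof (rule AE_mp, intro AE_I2 impI)
      fix \<omega> assume \<omega>: "\<omega> \<in> space M" and fin: "lowest (N \<omega>) {0..q} < \<infinity> \<and> lowest (N \<omega>) {q<..u} < \<infinity> \<and>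
        lowest (N \<omega>) {u<..v} < \<infinity> \<and> lowest (N \<omega>) {v<..1} < \<infinity>"
      note L = lowest_eq_real_lowest(1)[OF poisson_atom_config[OF P \<omega>]]
      show "\<omega> \<in> {\<omega>\<in>space M. p \<le> ?X \<omega>} \<longleftrightarrow> \<omega> \<in> ?A"
        using \<omega> fin by (simp add: p all4 a_def I_def L)
    qed
    show "{\<omega>\<in>space M. p \<le> ?X \<omega>} \<in> sets M"
      using measurable_sets[OF X, of "{p..}"] by (auto simp: vimage_def Int_def conj_commute)
  qed (rule A(1))
  also have "\<dots> = ennreal (\<Prod>i<4. exp (- (measure lborel (I i) * max 0 (a i))))"
    by (simp add: emeasure_eq_measure A(2))
  also have "\<dots> = emeasure ?R {p..}"
  proof -
    have "emeasure ?R {p..} = emeasure (exp_law q) {a0..} * (emeasure (exp_law (u - q)) {a1..} *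
        (emeasure (exp_law (v - u)) {a2..} * emeasure (exp_law (1 - v)) {a3..}))"
      unfolding p atLeast_Pair
      by (simp add: E123.P.emeasure_pair_measure_Times E23.emeasure_pair_measure_Times E3.emeasure_pair_measure_Times)
    also have "\<dots> = ennreal (\<Prod>i<4. exp (- (measure lborel (I i) * max 0 (a i))))"
      using quv by (simp add: emeasure_exp_law_atLeast lt4 I_def a_def ennreal_mult[symmetric] mult_ac)
    finally show ?thesis ..
  qed
  finally show "emeasure (distr M borel ?X) {p..} = emeasure ?R {p..}" .
qed

lemma past_split:
  assumes \<omega>: "\<omega> \<in> space M" and fin: "lowest (N \<omega>) {0..q} < \<infinity>" "lowest (N \<omega>) {q<..u} < \<infinity>"
  shows "lowest (N \<omega>) {0..u} = ereal (min (real_lowest (N \<omega>) {0..q}) (real_lowest (N \<omega>) {q<..u}))"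
    "real_lowest (N \<omega>) {0..u} = min (real_lowest (N \<omega>) {0..q}) (real_lowest (N \<omega>) {q<..u})"
    "leftmost (N \<omega>) u \<le> q \<longleftrightarrow> real_lowest (N \<omega>) {0..q} \<le> real_lowest (N \<omega>) {q<..u}"
proof -
  note S = poisson_atom_config[OF P \<omega>]
  have "{0..u} = {0..q} \<union> {q<..u}" using quv by auto
  then show *: "lowest (N \<omega>) {0..u} = ereal (min (real_lowest (N \<omega>) {0..q}) (real_lowest (N \<omega>) {q<..u}))"
    using lowest_eq_real_lowest(1)[OF S fin(1)] lowest_eq_real_lowest(1)[OF S fin(2)] by (simp add: lowest_Un)
  show "real_lowest (N \<omega>) {0..u} = min (real_lowest (N \<omega>) {0..q}) (real_lowest (N \<omega>) {q<..u})"
    by (simp add: real_lowest_def[of _ "{0..u}"] * min_def)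
  have "leftmost (N \<omega>) u \<le> q \<longleftrightarrow> lowest (N \<omega>) {0..q} \<le> lowest (N \<omega>) {0..u}"
    using quv by (intro leftmost_props(2)[OF S]) auto
  also have "\<dots> \<longleftrightarrow> real_lowest (N \<omega>) {0..q} \<le> real_lowest (N \<omega>) {q<..u}"
    using lowest_eq_real_lowest(1)[OF S fin(1)] * by simp
  finally show "leftmost (N \<omega>) u \<le> q \<longleftrightarrow> real_lowest (N \<omega>) {0..q} \<le> real_lowest (N \<omega>) {q<..u}" .
qed

lemma four_blocks_emeasure:
  assumes B: "{(m0, m1, m2, m3). B m0 m1 m2 m3} \<in> sets borel"
    and Q: "\<And>\<omega>. \<omega> \<in> space M \<Longrightarrow> lowest (N \<omega>) {0..q} < \<infinity> \<Longrightarrow> lowest (N \<omega>) {q<..u} < \<infinity> \<Longrightarrow>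
      Q \<omega> \<longleftrightarrow> B (real_lowest (N \<omega>) {0..q}) (real_lowest (N \<omega>) {q<..u}) (real_lowest (N \<omega>) {u<..v}) (real_lowest (N \<omega>) {v<..1})"
    and Qm: "{\<omega>\<in>space M. Q \<omega>} \<in> sets M"
  shows "emeasure M {\<omega>\<in>space M. Q \<omega>} =
    emeasure (exp_law q \<Otimes>\<^sub>M (exp_law (u - q) \<Otimes>\<^sub>M (exp_law (v - u) \<Otimes>\<^sub>M exp_law (1 - v)))) {(m0, m1, m2, m3). B m0 m1 m2 m3}"
proof -
  let ?X = "\<lambda>\<omega>. (real_lowest (N \<omega>) {0..q}, real_lowest (N \<omega>) {q<..u}, real_lowest (N \<omega>) {u<..v}, real_lowest (N \<omega>) {v<..1})"
  let ?B = "{(m0, m1, m2, m3). B m0 m1 m2 m3}"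
  have "(\<lambda>\<omega>. real_lowest (N \<omega>) I) \<in> borel_measurable M" if "I \<in> {{0..q}, {q<..u}, {u<..v}, {v<..1}}" for I
    using that quv by (intro real_lowest_measurable[OF P]) auto
  then have X: "?X \<in> borel_measurable M"
    unfolding borel_prod[symmetric] by (intro measurable_Pair) auto
  have "emeasure M {\<omega>\<in>space M. Q \<omega>} = emeasure M (?X -` ?B \<inter> space M)"
  proof (rule emeasure_eq_AE)
    show "AE \<omega> in M. \<omega> \<in> {\<omega>\<in>space M. Q \<omega>} \<longleftrightarrow> \<omega> \<in> ?X -` ?B \<inter> space M"
      by (rule AE_mp[OF four_blocks_finite_AE], intro AE_I2 impI) (simp add: Q)
  qed (use Qm measurable_sets[OF X B] in auto)
  also have "\<dots> = emeasure (distr M borel ?X) ?B"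
    using X B by (simp add: emeasure_distr)
  finally show ?thesis unfolding four_blocks_law .
qed

lemma past_future_measurable:
  "{\<omega>\<in>space M. leftmost (N \<omega>) u \<le> r \<and> z \<le> real_lowest (N \<omega>) {0..u} \<and>
     x \<le> real_lowest (N \<omega>) {u<..v} \<and> y \<le> real_lowest (N \<omega>) {v<..1}} \<in> sets M"
proof -
  have [measurable]: "(\<lambda>\<omega>. real_lowest (N \<omega>) I) \<in> borel_measurable M" if "I \<in> {{0..u}, {u<..v}, {v<..1}}" for I
    using that quv by (intro real_lowest_measurable[OF P]) auto
  have [measurable]: "(\<lambda>\<omega>. leftmost (N \<omega>) u) \<in> borel_measurable M"
    using quv by (intro leftmost_measurable[OF P]) auto
  show ?thesis by measurable
qed

text \<open>
With \<open>m\<^sub>0\<close> and \<open>m\<^sub>1\<close> the lowest marks of \<open>[0, q]\<close> and \<open>(q, u]\<close>, the event is \<open>z \<le> m\<^sub>0 \<le> m\<^sub>1\<close> together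
with the conditions on the future. Integrating \<open>q e\<^bsup>- q m\<^esup> e\<^bsup>- (u - q) m\<^esup>\<close> over \<open>m \<ge> z\<close> gives \<open>q / u\<close>
times an exponential tail of rate \<open>u\<close>: the position of the minimum is uniform and independent of
its size.
\<close>
lemma leftmost_le_prob:
  "emeasure M {\<omega>\<in>space M. leftmost (N \<omega>) u \<le> q \<and> z \<le> real_lowest (N \<omega>) {0..u} \<and>
     x \<le> real_lowest (N \<omega>) {u<..v} \<and> y \<le> real_lowest (N \<omega>) {v<..1}} =
   ennreal (q / u) * (emeasure (exp_law u) {z..} * (emeasure (exp_law (v - u)) {x..} * emeasure (exp_law (1 - v)) {y..}))"
proof -
  interpret E1: prob_space "exp_law (u - q)" using quv by (intro prob_space_exp_law) auto
  interpret E2: prob_space "exp_law (v - u)" using quv by (intro prob_space_exp_law) auto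
  interpret E3: prob_space "exp_law (1 - v)" using quv by (intro prob_space_exp_law) auto
  interpret E23: pair_prob_space "exp_law (v - u)" "exp_law (1 - v)" ..
  interpret E123: pair_prob_space "exp_law (u - q)" "exp_law (v - u) \<Otimes>\<^sub>M exp_law (1 - v)" ..
  let ?R = "exp_law q \<Otimes>\<^sub>M (exp_law (u - q) \<Otimes>\<^sub>M (exp_law (v - u) \<Otimes>\<^sub>M exp_law (1 - v)))"
  let ?B = "{(m0, m1, m2, m3). m0 \<le> m1 \<and> z \<le> m0 \<and> x \<le> m2 \<and> y \<le> (m3::real)}"
  let ?c = "emeasure (exp_law (v - u)) {x..} * emeasure (exp_law (1 - v)) {y..}"
  have B: "?B \<in> sets ?R"
  proof -
    have "{p\<in>space ?R. fst p \<le> fst (snd p) \<and> z \<le> fst p \<and> x \<le> fst (snd (snd p)) \<and> y \<le> snd (snd (snd p))} \<in> sets ?R"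
      by measurable
    then show ?thesis by (simp add: space_pair_measure split_beta')
  qed
  moreover have "sets ?R = sets borel" using sets_borel_pair4 by (simp cong: sets_pair_measure_cong)
  ultimately have B': "?B \<in> sets borel" by simp
  have "emeasure M {\<omega>\<in>space M. leftmost (N \<omega>) u \<le> q \<and> z \<le> real_lowest (N \<omega>) {0..u} \<and>
     x \<le> real_lowest (N \<omega>) {u<..v} \<and> y \<le> real_lowest (N \<omega>) {v<..1}} = emeasure ?R ?B"
    by (rule four_blocks_emeasure[OF B' _ past_future_measurable]) (auto simp: past_split)
  also have "\<dots> = (\<integral>\<^sup>+m. emeasure (exp_law (u - q) \<Otimes>\<^sub>M (exp_law (v - u) \<Otimes>\<^sub>M exp_law (1 - v))) (Pair m -` ?B) \<partial>exp_law q)"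
    by (rule E123.P.emeasure_pair_measure_alt[OF B])
  also have "\<dots> = (\<integral>\<^sup>+m. ennreal (exp (- ((u - q) * max 0 m))) * ?c * indicator {z..} m \<partial>exp_law q)"
  proof (rule nn_integral_cong)
    fix m
    have "Pair m -` ?B = (if z \<le> m then {m..} \<times> ({x..} \<times> {y..}) else {})" by auto
    then show "emeasure (exp_law (u - q) \<Otimes>\<^sub>M (exp_law (v - u) \<Otimes>\<^sub>M exp_law (1 - v))) (Pair m -` ?B) =
       ennreal (exp (- ((u - q) * max 0 m))) * ?c * indicator {z..} m"
      using quv by (simp add: E23.P.emeasure_pair_measure_Times E23.emeasure_pair_measure_Times E3.emeasure_pair_measure_Times
        emeasure_exp_law_atLeast indicator_def)
  qed
  also have "\<dots> = (\<integral>\<^sup>+m. ennreal (exponential_density q m) * (ennreal (exp (- ((u - q) * max 0 m))) * ?c * indicator {z..} m) \<partial>lborel)"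
    by (rule nn_integral_exp_law) measurable
  also have "\<dots> = (\<integral>\<^sup>+m. (ennreal (q / u) * ?c) * (ennreal (exponential_density u m) * indicator {z..} m) \<partial>lborel)"
  proof (rule nn_integral_cong)
    fix m
    have "exponential_density q m * exp (- ((u - q) * max 0 m)) = q / u * exponential_density u m"
      using quv by (auto simp: exponential_density_def exp_add[symmetric] algebra_simps)
    then have e: "ennreal (exponential_density q m) * ennreal (exp (- ((u - q) * max 0 m))) =
        ennreal (q / u) * ennreal (exponential_density u m)"
      using quv by (simp add: ennreal_mult[symmetric] exponential_density_nonneg)
    have "ennreal (exponential_density q m) * (ennreal (exp (- ((u - q) * max 0 m))) * ?c * indicator {z..} m) =
       (ennreal (exponential_density q m) * ennreal (exp (- ((u - q) * max 0 m)))) * (?c * indicator {z..} m)"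
      by (simp only: mult.assoc)
    also have "\<dots> = (ennreal (q / u) * ?c) * (ennreal (exponential_density u m) * indicator {z..} m)"
      unfolding e by (simp only: mult_ac)
    finally show "ennreal (exponential_density q m) * (ennreal (exp (- ((u - q) * max 0 m))) * ?c * indicator {z..} m) =
       (ennreal (q / u) * ?c) * (ennreal (exponential_density u m) * indicator {z..} m)" .
  qed
  also have "\<dots> = (ennreal (q / u) * ?c) * (\<integral>\<^sup>+m. ennreal (exponential_density u m) * indicator {z..} m \<partial>lborel)"
    by (rule nn_integral_cmult) measurable
  also have "(\<integral>\<^sup>+m. ennreal (exponential_density u m) * indicator {z..} m \<partial>lborel) = emeasure (exp_law u) {z..}"
    unfolding exp_law_def by (rule emeasure_density[symmetric]) auto
  finally show ?thesis by (simp add: mult_ac)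
qed

text \<open>
The same for \<open>leftmost \<le> u\<close>, which always holds; the auxiliary cut at \<open>q\<close> disappears from the result.
\<close>
lemma past_prob:
  "emeasure M {\<omega>\<in>space M. leftmost (N \<omega>) u \<le> u \<and> z \<le> real_lowest (N \<omega>) {0..u} \<and>
     x \<le> real_lowest (N \<omega>) {u<..v} \<and> y \<le> real_lowest (N \<omega>) {v<..1}} =
   emeasure (exp_law u) {z..} * (emeasure (exp_law (v - u)) {x..} * emeasure (exp_law (1 - v)) {y..})"
proof -
  interpret E1: prob_space "exp_law (u - q)" using quv by (intro prob_space_exp_law) auto
  interpret E2: prob_space "exp_law (v - u)" using quv by (intro prob_space_exp_law) auto
  interpret E3: prob_space "exp_law (1 - v)" using quv by (intro prob_space_exp_law) auto
  interpret E23: pair_prob_space "exp_law (v - u)" "exp_law (1 - v)" ..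
  interpret E123: pair_prob_space "exp_law (u - q)" "exp_law (v - u) \<Otimes>\<^sub>M exp_law (1 - v)" ..
  let ?R = "exp_law q \<Otimes>\<^sub>M (exp_law (u - q) \<Otimes>\<^sub>M (exp_law (v - u) \<Otimes>\<^sub>M exp_law (1 - v)))"
  let ?B = "{(m0, m1, m2, m3). z \<le> m0 \<and> z \<le> m1 \<and> x \<le> m2 \<and> y \<le> (m3::real)}"
  have B: "?B = {z..} \<times> ({z..} \<times> ({x..} \<times> {y..}))" by auto
  have "?B = {(z, z, x, y)..}" unfolding B atLeast_Pair ..
  then have B': "?B \<in> sets borel" by simp
  have l: "leftmost (N \<omega>) u \<le> u" if "\<omega> \<in> space M" for \<omega>
    using leftmost_props(1)[OF poisson_atom_config[OF P that], of u] quv by simp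
  have "emeasure M {\<omega>\<in>space M. leftmost (N \<omega>) u \<le> u \<and> z \<le> real_lowest (N \<omega>) {0..u} \<and>
     x \<le> real_lowest (N \<omega>) {u<..v} \<and> y \<le> real_lowest (N \<omega>) {v<..1}} = emeasure ?R ?B"
    by (rule four_blocks_emeasure[OF B' _ past_future_measurable]) (auto simp: past_split l)
  also have "\<dots> = (emeasure (exp_law q) {z..} * emeasure (exp_law (u - q)) {z..}) *
       (emeasure (exp_law (v - u)) {x..} * emeasure (exp_law (1 - v)) {y..})"
    unfolding B
    by (simp add: E123.P.emeasure_pair_measure_Times E23.P.emeasure_pair_measure_Times E23.emeasure_pair_measure_Times E3.emeasure_pair_measure_Times mult.assoc)
  also have "emeasure (exp_law q) {z..} * emeasure (exp_law (u - q)) {z..} = emeasure (exp_law u) {z..}"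
    using quv by (simp add: emeasure_exp_law_atLeast ennreal_mult[symmetric] exp_add[symmetric] algebra_simps)
  finally show ?thesis .
qed

end

lemma past_future_law:
  assumes P: "poisson_point_process M lebesgue_strip N" and uv: "0 < u" "u < v" "v < 1"
  shows "distr M borel (\<lambda>\<omega>. (- leftmost (N \<omega>) u, real_lowest (N \<omega>) {0..u}, real_lowest (N \<omega>) {u<..v}, real_lowest (N \<omega>) {v<..1})) =
    uniform_neg u \<Otimes>\<^sub>M (exp_law u \<Otimes>\<^sub>M (exp_law (v - u) \<Otimes>\<^sub>M exp_law (1 - v)))" (is "distr M borel ?X = ?R")
proof (rule measure_eqI_atLeast)
  interpret prob_space M using P by (rule poisson_prob_space)
  have [measurable]: "(\<lambda>\<omega>. real_lowest (N \<omega>) I) \<in> borel_measurable M" if "I \<in> {{0..u}, {u<..v}, {v<..1}}" for I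
    using that uv by (intro real_lowest_measurable[OF P]) auto
  have [measurable]: "(\<lambda>\<omega>. leftmost (N \<omega>) u) \<in> borel_measurable M"
    using uv by (intro leftmost_measurable[OF P]) auto
  have X[measurable]: "?X \<in> borel_measurable M"
    unfolding borel_prod[symmetric] by (intro measurable_Pair) auto
  interpret E1: prob_space "exp_law u" using uv by (intro prob_space_exp_law) auto
  interpret E2: prob_space "exp_law (v - u)" using uv by (intro prob_space_exp_law) auto
  interpret E3: prob_space "exp_law (1 - v)" using uv by (intro prob_space_exp_law) auto
  interpret E23: pair_prob_space "exp_law (v - u)" "exp_law (1 - v)" ..
  interpret E123: pair_prob_space "exp_law u" "exp_law (v - u) \<Otimes>\<^sub>M exp_law (1 - v)" ..
  show "sets (distr M borel ?X) = sets borel" by simp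
  show "sets ?R = sets borel"
    unfolding sets_borel_pair4[symmetric] by (intro sets_pair_measure_cong) simp_all
  show "finite_measure (distr M borel ?X)" by (intro finite_measure_distr X)
  fix p :: "real \<times> real \<times> real \<times> real"
  obtain a z x y where p: "p = (a, z, x, y)" by (metis prod_cases4)
  let ?E = "\<lambda>r. {\<omega>\<in>space M. leftmost (N \<omega>) u \<le> r \<and> z \<le> real_lowest (N \<omega>) {0..u} \<and>
     x \<le> real_lowest (N \<omega>) {u<..v} \<and> y \<le> real_lowest (N \<omega>) {v<..1}}"
  let ?c = "emeasure (exp_law u) {z..} * (emeasure (exp_law (v - u)) {x..} * emeasure (exp_law (1 - v)) {y..})"
  have l: "0 \<le> leftmost (N \<omega>) u" "leftmost (N \<omega>) u \<le> u" if "\<omega> \<in> space M" for \<omega>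
    using leftmost_props(1)[OF poisson_atom_config[OF P that], of u] uv by simp_all
  have "emeasure (distr M borel ?X) {p..} = emeasure M (?E (- a))"
    by (subst emeasure_distr) (auto simp: p le_minus_iff intro!: arg_cong[of _ _ "emeasure M"])
  also have "\<dots> = ennreal (max 0 (min u (- a)) / u) * ?c"
  proof -
    \<comment> \<open>The case a = 0 asks for an atom of lowest mark at time 0, which almost surely does not exist.\<close>
    consider "0 < a" | "a = 0" | "0 < - a" "- a < u" | "u \<le> - a" by linarith
    then show ?thesis
    proof cases
      case 1
      then have "?E (- a) = {}" using l(1) by force
      then show ?thesis using 1 by (metis (no_types, lifting) emeasure_empty ennreal_0 less_le_not_le max.absorb1 min.coboundedI2 mult_zero_left neg_le_0_iff_le div_0 order_less_imp_le)
    next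
      case 2
      have "AE \<omega> in M. lowest (N \<omega>) {0..u} < \<infinity>"
        using uv by (intro lowest_finite_AE[OF P]) auto
      moreover have "AE \<omega> in M. lowest (N \<omega>) {0..0} = \<infinity>"
        by (intro lowest_null_AE[OF P]) auto
      ultimately have "AE \<omega> in M. \<not> leftmost (N \<omega>) u \<le> 0"
      proof (rule AE_mp[OF AE_conjI], intro AE_I2 impI)
        fix \<omega> assume \<omega>: "\<omega> \<in> space M" "lowest (N \<omega>) {0..u} < \<infinity> \<and> lowest (N \<omega>) {0..0} = \<infinity>"
        then show "\<not> leftmost (N \<omega>) u \<le> 0"
          using leftmost_props(2)[OF poisson_atom_config[OF P \<omega>(1)], of u 0] uv by auto
      qed
      then have "AE \<omega> in M. \<not> (leftmost (N \<omega>) u \<le> - a \<and> z \<le> real_lowest (N \<omega>) {0..u} \<and>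
         x \<le> real_lowest (N \<omega>) {u<..v} \<and> y \<le> real_lowest (N \<omega>) {v<..1})"
        using 2 by (auto elim: eventually_mono)
      then have "emeasure M (?E (- a)) = 0"
        by (rule AE_iff_measurable[OF _ _, THEN iffD1, rotated 2]) auto
      then show ?thesis using 2 by simp
    next
      case 3
      then show ?thesis using leftmost_le_prob[OF P 3 uv(2,3)] by simp
    next
      case 4
      have "?E (- a) = ?E u" using l 4 by force
      also have "emeasure M (?E u) = ?c"
        using past_prob[OF P _ _ uv(2,3), of "u / 2"] uv by simp
      finally show ?thesis using 4 uv by simp
    qed
  qed
  also have "\<dots> = emeasure ?R {p..}"
    unfolding p atLeast_Pair
    by (simp add: E123.P.emeasure_pair_measure_Times E23.emeasure_pair_measure_Times
      E3.emeasure_pair_measure_Times E23.P.emeasure_pair_measure_Times emeasure_uniform_neg_atLeast uv)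
  finally show "emeasure (distr M borel ?X) {p..} = emeasure ?R {p..}" .
qed

section \<open>Probability of success in one cell\<close>

text \<open>
For \<open>u < 1\<close>, \<open>gap u m\<close> is the integral of \<open>e\<^bsup>- (1 - u) x\<^esup>\<close> over \<open>x\<close> from \<open>0\<close> to \<open>m\<close>: an arrival of mark
\<open>x \<le> m\<close> at time \<open>u\<close> and no lower mark afterwards. In \<open>win_kernel\<close> the past minimum is \<open>z\<close>, attained at time \<open>s\<close>.
\<close>
definition gap :: "real \<Rightarrow> real \<Rightarrow> real" where
  "gap u m = (1 - exp (- ((1 - u) * m))) / (1 - u)"

definition win_kernel :: "(real \<Rightarrow> real) \<Rightarrow> real \<Rightarrow> real \<Rightarrow> real \<Rightarrow> real \<Rightarrow> real" where
  "win_kernel b u v s z =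
     (if 0 \<le> s \<and> s \<le> u \<and> 0 \<le> z \<and> b s < z then exp (- (u * z)) * gap u (min z (b v)) else 0)"

definition win_density :: "(real \<Rightarrow> real) \<Rightarrow> real \<Rightarrow> real \<Rightarrow> ennreal" where
  "win_density b u v = (\<integral>\<^sup>+s. \<integral>\<^sup>+z. ennreal (win_kernel b u v s z) \<partial>lborel \<partial>lborel)"

lemma gap_nonneg: "u < 1 \<Longrightarrow> 0 \<le> m \<Longrightarrow> 0 \<le> gap u m"
  by (simp add: gap_def)

lemma gap_measurable [measurable (raw)]:
  assumes [measurable]: "f \<in> borel_measurable M" "g \<in> borel_measurable M"
  shows "(\<lambda>x. gap (f x) (g x)) \<in> borel_measurable M"
  unfolding gap_def by measurable

lemma win_kernel_measurable [measurable (raw)]: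
  assumes [measurable]: "b \<in> borel_measurable borel" "f \<in> borel_measurable M" "g \<in> borel_measurable M"
    "h \<in> borel_measurable M" "k \<in> borel_measurable M"
  shows "(\<lambda>x. win_kernel b (f x) (g x) (h x) (k x)) \<in> borel_measurable M"
  unfolding win_kernel_def by measurable

text \<open>
The lowest mark \<open>x\<close> of the cell, of rate \<open>w\<close>, must beat the lowest mark \<open>y\<close> of the future, of rate \<open>m\<close>:
integrate \<open>w e\<^bsup>- w x\<^esup> e\<^bsup>- m x\<^esup>\<close> over \<open>x < min z c\<close>.
\<close>
lemma race_prob:
  assumes w: "0 < w" and m: "0 < m" and zc: "0 \<le> z" "0 \<le> c"
  shows "emeasure (exp_law w \<Otimes>\<^sub>M exp_law m) {(x, y). x < z \<and> x \<le> c \<and> x < y} =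
    ennreal (w * ((1 - exp (- ((w + m) * min z c))) / (w + m)))"
proof -
  interpret E: prob_space "exp_law m" using m by (rule prob_space_exp_law)
  let ?B = "{(x, y). x < z \<and> x \<le> c \<and> x < (y::real)}"
  have B: "?B \<in> sets (exp_law w \<Otimes>\<^sub>M exp_law m)"
  proof -
    have "{p\<in>space (exp_law w \<Otimes>\<^sub>M exp_law m). fst p < z \<and> fst p \<le> c \<and> fst p < snd p} \<in> sets (exp_law w \<Otimes>\<^sub>M exp_law m)"
      by measurable
    then show ?thesis by (simp add: space_pair_measure split_beta')
  qed
  have "emeasure (exp_law w \<Otimes>\<^sub>M exp_law m) ?B = (\<integral>\<^sup>+x. emeasure (exp_law m) (Pair x -` ?B) \<partial>exp_law w)"
    by (rule E.emeasure_pair_measure_alt[OF B])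
  also have "\<dots> = (\<integral>\<^sup>+x. ennreal (exp (- (m * max 0 x))) * indicator ({..<z} \<inter> {..c}) x \<partial>exp_law w)"
  proof (rule nn_integral_cong)
    fix x
    have "Pair x -` ?B = (if x < z \<and> x \<le> c then {x<..} else {})" by auto
    then show "emeasure (exp_law m) (Pair x -` ?B) = ennreal (exp (- (m * max 0 x))) * indicator ({..<z} \<inter> {..c}) x"
      using emeasure_exp_law_greaterThan[OF m] by (auto simp: indicator_def)
  qed
  also have "\<dots> = (\<integral>\<^sup>+x. ennreal (exponential_density w x) * (ennreal (exp (- (m * max 0 x))) * indicator ({..<z} \<inter> {..c}) x) \<partial>lborel)"
    by (rule nn_integral_exp_law) measurable
  also have "\<dots> = (\<integral>\<^sup>+x. ennreal (w * exp (- ((w + m) * x))) * indicator {0..min z c} x \<partial>lborel)"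
  proof (rule nn_integral_cong_AE)
    show "AE x in lborel. ennreal (exponential_density w x) * (ennreal (exp (- (m * max 0 x))) * indicator ({..<z} \<inter> {..c}) x) =
       ennreal (w * exp (- ((w + m) * x))) * indicator {0..min z c} x"
      using AE_lborel_singleton[of z]
    proof eventually_elim
      case (elim x)
      then show ?case
        using w by (auto simp: exponential_density_def indicator_def ennreal_mult[symmetric] exp_add[symmetric] algebra_simps)
    qed
  qed
  also have "\<dots> = ennreal (- (w / (w + m) * exp (- ((w + m) * min z c))) - (- (w / (w + m) * exp (- ((w + m) * 0)))))"
  proof (rule nn_integral_FTC_Icc)
    fix x
    have "((\<lambda>x. - (w / k * exp (- (k * x)))) has_real_derivative w * exp (- (k * x))) (at x)" if "k \<noteq> 0" for k
      using that by (auto intro!: derivative_eq_intros)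
    then show "((\<lambda>x. - (w / (w + m) * exp (- ((w + m) * x)))) has_real_derivative w * exp (- ((w + m) * x))) (at x)"
      using w m by simp
  qed (use w zc in auto)
  also have "- (w / (w + m) * exp (- ((w + m) * min z c))) - (- (w / (w + m) * exp (- ((w + m) * 0)))) =
      w * ((1 - exp (- ((w + m) * min z c))) / (w + m))"
    by (simp add: diff_divide_distrib right_diff_distrib)
  finally show ?thesis .
qed

lemma cell_success_measurable:
  assumes P: "poisson_point_process M lebesgue_strip N" and uv: "0 < u" "u < v" "v < 1"
    and [measurable]: "b \<in> borel_measurable borel"
  shows "{\<omega>\<in>space M. cell_success b (N \<omega>) u v} \<in> sets M"
proof -
  have [measurable]: "(\<lambda>\<omega>. lowest (N \<omega>) I) \<in> borel_measurable M" if "I \<in> {{0..u}, {u<..v}, {v<..1}}" for I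
    using that uv by (intro lowest_measurable[OF P]) auto
  have [measurable]: "(\<lambda>\<omega>. leftmost (N \<omega>) u) \<in> borel_measurable M"
    using uv by (intro leftmost_measurable[OF P]) auto
  show ?thesis unfolding cell_success_def by measurable
qed

lemma cell_success_prob:
  assumes P: "poisson_point_process M lebesgue_strip N" and uv: "0 < u" "u < v" "v < 1"
    and b[measurable]: "b \<in> borel_measurable borel" and bv: "0 \<le> b v"
  shows "emeasure M {\<omega>\<in>space M. cell_success b (N \<omega>) u v} = ennreal (v - u) * win_density b u v"
proof -
  interpret prob_space M using P by (rule poisson_prob_space)
  interpret E1: prob_space "exp_law u" using uv by (intro prob_space_exp_law) auto
  interpret E2: prob_space "exp_law (v - u)" using uv by (intro prob_space_exp_law) auto
  interpret E3: prob_space "exp_law (1 - v)" using uv by (intro prob_space_exp_law) auto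
  interpret E23: pair_prob_space "exp_law (v - u)" "exp_law (1 - v)" ..
  interpret E123: pair_prob_space "exp_law u" "exp_law (v - u) \<Otimes>\<^sub>M exp_law (1 - v)" ..
  let ?X = "\<lambda>\<omega>. (- leftmost (N \<omega>) u, real_lowest (N \<omega>) {0..u}, real_lowest (N \<omega>) {u<..v}, real_lowest (N \<omega>) {v<..1})"
  let ?R = "uniform_neg u \<Otimes>\<^sub>M (exp_law u \<Otimes>\<^sub>M (exp_law (v - u) \<Otimes>\<^sub>M exp_law (1 - v)))"
  let ?B = "{(a, z, x, y). x < z \<and> x \<le> b v \<and> x < (y::real) \<and> b (- a) < z}"
  have [measurable]: "(\<lambda>\<omega>. real_lowest (N \<omega>) I) \<in> borel_measurable M" if "I \<in> {{0..u}, {u<..v}, {v<..1}}" for I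
    using that uv by (intro real_lowest_measurable[OF P]) auto
  have [measurable]: "(\<lambda>\<omega>. leftmost (N \<omega>) u) \<in> borel_measurable M"
    using uv by (intro leftmost_measurable[OF P]) auto
  have X[measurable]: "?X \<in> borel_measurable M"
    unfolding borel_prod[symmetric] by (intro measurable_Pair) auto
  have B: "?B \<in> sets ?R"
  proof -
    have "{p\<in>space ?R. fst (snd (snd p)) < fst (snd p) \<and> fst (snd (snd p)) \<le> b v \<and>
        fst (snd (snd p)) < snd (snd (snd p)) \<and> b (- fst p) < fst (snd p)} \<in> sets ?R"
      by measurable
    then show ?thesis by (simp add: space_pair_measure split_beta')
  qed
  moreover have "sets ?R = sets borel"
    unfolding sets_borel_pair4[symmetric] by (intro sets_pair_measure_cong) simp_all
  ultimately have B': "?B \<in> sets borel" by simp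
  have "emeasure M {\<omega>\<in>space M. cell_success b (N \<omega>) u v} = emeasure M (?X -` ?B \<inter> space M)"
  proof (rule emeasure_eq_AE)
    have "AE \<omega> in M. lowest (N \<omega>) {0..u} < \<infinity> \<and> lowest (N \<omega>) {u<..v} < \<infinity> \<and> lowest (N \<omega>) {v<..1} < \<infinity>"
      using uv by (intro AE_conjI lowest_finite_AE[OF P]) auto
    then show "AE \<omega> in M. \<omega> \<in> {\<omega>\<in>space M. cell_success b (N \<omega>) u v} \<longleftrightarrow> \<omega> \<in> ?X -` ?B \<inter> space M"
    proof (rule AE_mp, intro AE_I2 impI)
      fix \<omega> assume \<omega>: "\<omega> \<in> space M"
        and fin: "lowest (N \<omega>) {0..u} < \<infinity> \<and> lowest (N \<omega>) {u<..v} < \<infinity> \<and> lowest (N \<omega>) {v<..1} < \<infinity>"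
      note L = lowest_eq_real_lowest(1)[OF poisson_atom_config[OF P \<omega>]]
      show "\<omega> \<in> {\<omega>\<in>space M. cell_success b (N \<omega>) u v} \<longleftrightarrow> \<omega> \<in> ?X -` ?B \<inter> space M"
        using \<omega> fin by (auto simp: cell_success_def L)
    qed
  qed (use cell_success_measurable[OF P uv b] measurable_sets[OF X B'] in auto)
  also have "\<dots> = emeasure (distr M borel ?X) ?B"
    using B' by (simp add: emeasure_distr)
  also have "\<dots> = emeasure ?R ?B"
    unfolding past_future_law[OF P uv] ..
  also have "\<dots> = (\<integral>\<^sup>+a. emeasure (exp_law u \<Otimes>\<^sub>M (exp_law (v - u) \<Otimes>\<^sub>M exp_law (1 - v))) (Pair a -` ?B) \<partial>uniform_neg u)"
    by (rule E123.P.emeasure_pair_measure_alt[OF B])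
  also have "\<dots> = (\<integral>\<^sup>+a. \<integral>\<^sup>+z. emeasure (exp_law (v - u) \<Otimes>\<^sub>M exp_law (1 - v)) (Pair z -` (Pair a -` ?B)) \<partial>exp_law u \<partial>uniform_neg u)"
    by (intro nn_integral_cong E23.P.emeasure_pair_measure_alt sets_Pair1[OF B])
  also have "\<dots> = (\<integral>\<^sup>+a. \<integral>\<^sup>+z. ennreal (exponential_density u z) * (ennreal ((v - u) * gap u (min z (b v))) * indicator {b (- a)<..} z * indicator {0..} z) \<partial>lborel \<partial>uniform_neg u)"
  proof (rule nn_integral_cong)
    fix a
    have "(\<integral>\<^sup>+z. emeasure (exp_law (v - u) \<Otimes>\<^sub>M exp_law (1 - v)) (Pair z -` (Pair a -` ?B)) \<partial>exp_law u) =
       (\<integral>\<^sup>+z. ennreal (exponential_density u z) * emeasure (exp_law (v - u) \<Otimes>\<^sub>M exp_law (1 - v)) (Pair z -` (Pair a -` ?B)) \<partial>lborel)"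
    proof (rule nn_integral_exp_law)
      have "(\<lambda>z. emeasure (exp_law (v - u) \<Otimes>\<^sub>M exp_law (1 - v)) (Pair z -` (Pair a -` ?B))) \<in> borel_measurable (exp_law u)"
        by (rule E23.P.measurable_emeasure_Pair[OF sets_Pair1[OF B]])
      then show "(\<lambda>z. emeasure (exp_law (v - u) \<Otimes>\<^sub>M exp_law (1 - v)) (Pair z -` (Pair a -` ?B))) \<in> borel_measurable borel"
        by (simp cong: measurable_cong_sets)
    qed
    also have "\<dots> = (\<integral>\<^sup>+z. ennreal (exponential_density u z) * (ennreal ((v - u) * gap u (min z (b v))) * indicator {b (- a)<..} z * indicator {0..} z) \<partial>lborel)"
    proof (rule nn_integral_cong)
      fix z
      show "ennreal (exponential_density u z) * emeasure (exp_law (v - u) \<Otimes>\<^sub>M exp_law (1 - v)) (Pair z -` (Pair a -` ?B)) =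
        ennreal (exponential_density u z) * (ennreal ((v - u) * gap u (min z (b v))) * indicator {b (- a)<..} z * indicator {0..} z)"
      proof (cases "0 \<le> z")
        case True
        have "Pair z -` (Pair a -` ?B) = (if b (- a) < z then {(x, y). x < z \<and> x \<le> b v \<and> x < (y::real)} else {})"
          by auto
        then show ?thesis
          using race_prob[of "v - u" "1 - v" z "b v"] uv bv True by (simp add: gap_def)
      qed (simp add: exponential_density_def)
    qed
    finally show "(\<integral>\<^sup>+z. emeasure (exp_law (v - u) \<Otimes>\<^sub>M exp_law (1 - v)) (Pair z -` (Pair a -` ?B)) \<partial>exp_law u) =
       (\<integral>\<^sup>+z. ennreal (exponential_density u z) * (ennreal ((v - u) * gap u (min z (b v))) * indicator {b (- a)<..} z * indicator {0..} z) \<partial>lborel)" .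
  qed
  also have "\<dots> = (\<integral>\<^sup>+a. ennreal (indicator {-u..0} a / u) * (\<integral>\<^sup>+z. ennreal (exponential_density u z) * (ennreal ((v - u) * gap u (min z (b v))) * indicator {b (- a)<..} z * indicator {0..} z) \<partial>lborel) \<partial>lborel)"
    unfolding uniform_neg_def by (rule nn_integral_density) (simp_all add: indicator_def)
  also have "\<dots> = (\<integral>\<^sup>+s. ennreal (indicator {-u..0} (- s) / u) * (\<integral>\<^sup>+z. ennreal (exponential_density u z) * (ennreal ((v - u) * gap u (min z (b v))) * indicator {b s<..} z * indicator {0..} z) \<partial>lborel) \<partial>lborel)"
    by (subst nn_integral_real_affine[where c = "-1" and t = 0]) (simp_all add: indicator_def)
  also have "\<dots> = (\<integral>\<^sup>+s. \<integral>\<^sup>+z. ennreal (v - u) * ennreal (win_kernel b u v s z) \<partial>lborel \<partial>lborel)"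
  proof (rule nn_integral_cong)
    fix s
    have "ennreal (indicator {-u..0} (- s) / u) * (\<integral>\<^sup>+z. ennreal (exponential_density u z) * (ennreal ((v - u) * gap u (min z (b v))) * indicator {b s<..} z * indicator {0..} z) \<partial>lborel) =
      (\<integral>\<^sup>+z. ennreal (indicator {-u..0} (- s) / u) * (ennreal (exponential_density u z) * (ennreal ((v - u) * gap u (min z (b v))) * indicator {b s<..} z * indicator {0..} z)) \<partial>lborel)"
      by (rule nn_integral_cmult[symmetric]) measurable
    also have "\<dots> = (\<integral>\<^sup>+z. ennreal (v - u) * ennreal (win_kernel b u v s z) \<partial>lborel)"
    proof (rule nn_integral_cong)
      fix z
      have "0 \<le> gap u (min z (b v))" if "0 \<le> z" using that bv uv by (intro gap_nonneg) auto
      then show "ennreal (indicator {-u..0} (- s) / u) * (ennreal (exponential_density u z) * (ennreal ((v - u) * gap u (min z (b v))) * indicator {b s<..} z * indicator {0..} z)) =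
         ennreal (v - u) * ennreal (win_kernel b u v s z)"
        using uv by (auto simp: win_kernel_def exponential_density_def indicator_def ennreal_mult[symmetric] mult_ac)
    qed
    finally show "ennreal (indicator {-u..0} (- s) / u) * (\<integral>\<^sup>+z. ennreal (exponential_density u z) * (ennreal ((v - u) * gap u (min z (b v))) * indicator {b s<..} z * indicator {0..} z) \<partial>lborel) =
      (\<integral>\<^sup>+z. ennreal (v - u) * ennreal (win_kernel b u v s z) \<partial>lborel)" .
  qed
  also have "\<dots> = ennreal (v - u) * win_density b u v"
    unfolding win_density_def by (simp add: nn_integral_cmult)
  finally show ?thesis .
qed

text \<open>
Dropping the boundary leaves the density of the time of the overall minimum, which is \<open>1\<close>. The
bound provides the dominating function for the limit over the grid.
\<close>
lemma win_density_le_1: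
  assumes uv: "0 < u" "u < 1" and bv: "0 \<le> b v" and [measurable]: "b \<in> borel_measurable borel"
  shows "win_density b u v \<le> 1"
proof -
  have g: "gap u (min z (b v)) \<le> gap u z" "0 \<le> gap u z" if "0 \<le> z" for z
    using uv bv that by (auto simp: gap_def divide_right_mono mult_left_mono)
  let ?F = "\<lambda>z. exp (- z) / (1 - u) - exp (- (u * z)) / (u * (1 - u))"
  have "(\<integral>\<^sup>+z. ennreal (exp (- (u * z)) * gap u z) * indicator {0..} z \<partial>lborel) = ennreal (0 - ?F 0)"
  proof (rule nn_integral_FTC_atLeast)
    fix x :: real
    have "exp (- (u * x)) * gap u x = (exp (- (u * x)) - exp (- x)) / (1 - u)"
      by (simp add: gap_def right_diff_distrib exp_add[symmetric] algebra_simps)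
    moreover have "((\<lambda>z. exp (- z) / c - exp (- (u * z)) / (u * c)) has_real_derivative (exp (- (u * x)) - exp (- x)) / c) (at x)"
      if "c \<noteq> 0" for c
      using uv that by (auto intro!: derivative_eq_intros simp: diff_divide_distrib)
    ultimately show "(?F has_real_derivative exp (- (u * x)) * gap u x) (at x)"
      using uv by simp
    show "(?F \<longlongrightarrow> 0) at_top" using uv by real_asymp
  qed (use g in auto)
  also have "0 - ?F 0 = (1 - u) / (u * (1 - u))"
    using uv by (simp add: diff_divide_distrib[of 1 u])
  also have "\<dots> = 1 / u" using uv by simp
  finally have I: "(\<integral>\<^sup>+z. ennreal (exp (- (u * z)) * gap u z) * indicator {0..} z \<partial>lborel) = ennreal (1 / u)" .
  have "win_density b u v \<le> (\<integral>\<^sup>+s. \<integral>\<^sup>+z. ennreal (exp (- (u * z)) * gap u z) * indicator {0..} z * indicator {0..u} s \<partial>lborel \<partial>lborel)"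
    unfolding win_density_def
    using g by (intro nn_integral_mono) (auto simp: win_kernel_def indicator_def intro!: mult_left_mono ennreal_leI)
  also have "\<dots> = (\<integral>\<^sup>+s. ennreal (1 / u) * indicator {0..u} s \<partial>lborel)"
    by (simp add: nn_integral_multc I)
  also have "\<dots> = 1"
    using uv by (simp add: nn_integral_cmult_indicator ennreal_mult[symmetric])
  finally show ?thesis .
qed

section \<open>Passage to the limit over the grid\<close>

text \<open>
Dominated convergence in \<open>(s, z)\<close>. For \<open>u\<close> near \<open>\<tau>\<close> the kernel is at most a constant times
\<open>e\<^bsup>- \<tau> z / 2\<^esup>\<close>, and it converges except possibly on the null set \<open>s = \<tau>\<close>.
\<close>
lemma win_density_tendsto:
  fixes U V :: "nat \<Rightarrow> real"
  assumes [measurable]: "b \<in> borel_measurable borel"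
    and b0: "\<And>t. 0 \<le> t \<Longrightarrow> t < 1 \<Longrightarrow> 0 \<le> b t" and cont: "isCont b \<tau>" and \<tau>: "0 < \<tau>" "\<tau> < 1"
    and U: "U \<longlonglongrightarrow> \<tau>" and V: "V \<longlonglongrightarrow> \<tau>"
  shows "(\<lambda>n. win_density b (U n) (V n)) \<longlonglongrightarrow> win_density b \<tau> \<tau>"
proof -
  have "\<forall>\<^sub>F n in sequentially. \<tau> / 2 < U n \<and> U n < (1 + \<tau>) / 2 \<and> 0 < V n \<and> V n < 1"
    using \<tau> by (intro eventually_conj order_tendstoD[OF U] order_tendstoD[OF V]) auto
  then obtain K where K: "\<And>n. n \<ge> K \<Longrightarrow> \<tau> / 2 < U n \<and> U n < (1 + \<tau>) / 2 \<and> 0 < V n \<and> V n < 1"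
    by (auto simp: eventually_sequentially)
  define u where "u n = U (n + K)" for n
  define v where "v n = V (n + K)" for n
  have uv: "\<tau> / 2 < u n" "u n < (1 + \<tau>) / 2" "0 < v n" "v n < 1" for n
    using K[of "n + K"] by (auto simp: u_def v_def)
  have u: "u \<longlonglongrightarrow> \<tau>" and v: "v \<longlonglongrightarrow> \<tau>"
    unfolding u_def v_def using U V by (simp_all add: LIMSEQ_ignore_initial_segment)
  have prod: "win_density b p r = (\<integral>\<^sup>+x. ennreal (win_kernel b p r (fst x) (snd x)) \<partial>(lborel \<Otimes>\<^sub>M lborel))" for p r
    unfolding win_density_def by (subst lborel.nn_integral_fst[symmetric]) auto
  let ?w = "\<lambda>x::real\<times>real. ennreal (2 / (1 - \<tau>)) * (indicator {0..1} (fst x) *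
      (ennreal (exp (- (\<tau> / 2 * snd x))) * indicator {0..} (snd x)))"
  have "(\<lambda>n. \<integral>\<^sup>+x. ennreal (win_kernel b (u n) (v n) (fst x) (snd x)) \<partial>(lborel \<Otimes>\<^sub>M lborel)) \<longlonglongrightarrow>
      (\<integral>\<^sup>+x. ennreal (win_kernel b \<tau> \<tau> (fst x) (snd x)) \<partial>(lborel \<Otimes>\<^sub>M lborel))"
  proof (rule nn_integral_dominated_convergence[where w = ?w])
    show "AE x in lborel \<Otimes>\<^sub>M lborel. ennreal (win_kernel b (u j) (v j) (fst x) (snd x)) \<le> ?w x" for j
    proof (rule AE_I2)
      fix x :: "real \<times> real"
      obtain s z where x: "x = (s, z)" by fastforce
      show "ennreal (win_kernel b (u j) (v j) (fst x) (snd x)) \<le> ?w x"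
      proof (cases "0 \<le> s \<and> s \<le> u j \<and> 0 \<le> z \<and> b s < z")
        case True
        have m: "0 \<le> min z (b (v j))" using True b0[of "v j"] uv(3,4)[of j] by auto
        have "gap (u j) (min z (b (v j))) \<le> 1 / (1 - u j)"
          unfolding gap_def using uv(2)[of j] \<tau> by (intro divide_right_mono) auto
        also have "\<dots> \<le> 2 / (1 - \<tau>)" using uv(2)[of j] \<tau> by (simp add: field_simps)
        finally have g: "gap (u j) (min z (b (v j))) \<le> 2 / (1 - \<tau>)" .
        have "exp (- (u j * z)) \<le> exp (- (\<tau> / 2 * z))"
          using mult_right_mono[of "\<tau> / 2" "u j" z] uv(1)[of j] True by simp
        then have "exp (- (u j * z)) * gap (u j) (min z (b (v j))) \<le> exp (- (\<tau> / 2 * z)) * (2 / (1 - \<tau>))"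
          using g gap_nonneg[OF _ m, of "u j"] uv(2)[of j] \<tau> by (intro mult_mono) auto
        then show ?thesis
          using True uv(2)[of j] \<tau> by (auto simp: x win_kernel_def indicator_def ennreal_mult[symmetric] mult.commute intro!: ennreal_leI)
      qed (auto simp: x win_kernel_def)
    qed
    have exp_int: "(\<integral>\<^sup>+z. ennreal (exp (- (\<tau> / 2 * z))) * indicator {0..} z \<partial>lborel) = ennreal (0 - (- (2 / \<tau> * exp (- (\<tau> / 2 * 0)))))"
    proof (rule nn_integral_FTC_atLeast)
      show "((\<lambda>z. - (2 / \<tau> * exp (- (\<tau> / 2 * z)))) \<longlongrightarrow> 0) at_top" using \<tau> by real_asymp
    qed (use \<tau> in \<open>auto intro!: derivative_eq_intros\<close>)
    have "(\<integral>\<^sup>+x. ?w x \<partial>(lborel \<Otimes>\<^sub>M lborel)) = (\<integral>\<^sup>+s. \<integral>\<^sup>+z. ?w (s, z) \<partial>lborel \<partial>lborel)"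
      by (rule lborel.nn_integral_fst[symmetric]) measurable
    also have "\<dots> = (\<integral>\<^sup>+s. ennreal (2 / (1 - \<tau>)) * ennreal (2 / \<tau>) * indicator {0..1} (s :: real) \<partial>lborel)"
    proof (rule nn_integral_cong)
      fix s :: real
      have "(\<integral>\<^sup>+z. ?w (s, z) \<partial>lborel) = (\<integral>\<^sup>+z. ennreal (2 / (1 - \<tau>)) * indicator {0..1} s *
          (ennreal (exp (- (\<tau> / 2 * z))) * indicator {0..} z) \<partial>lborel)"
        by (simp only: fst_conv snd_conv mult.assoc)
      also have "\<dots> = ennreal (2 / (1 - \<tau>)) * indicator {0..1} s *
          (\<integral>\<^sup>+z. ennreal (exp (- (\<tau> / 2 * z))) * indicator {0..} z \<partial>lborel)"
        by (rule nn_integral_cmult) measurable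
      finally have "(\<integral>\<^sup>+z. ?w (s, z) \<partial>lborel) = ennreal (2 / (1 - \<tau>)) * indicator {0..1} s *
          (\<integral>\<^sup>+z. ennreal (exp (- (\<tau> / 2 * z))) * indicator {0..} z \<partial>lborel)" .
      then show "(\<integral>\<^sup>+z. ?w (s, z) \<partial>lborel) = ennreal (2 / (1 - \<tau>)) * ennreal (2 / \<tau>) * indicator {0..1} s"
        unfolding exp_int by (simp add: mult_ac)
    qed
    also have "\<dots> = ennreal (2 / (1 - \<tau>)) * ennreal (2 / \<tau>)"
      by (simp add: nn_integral_cmult_indicator)
    also have "\<dots> < \<infinity>" by (simp add: ennreal_mult_less_top)
    finally show "(\<integral>\<^sup>+x. ?w x \<partial>(lborel \<Otimes>\<^sub>M lborel)) < \<infinity>" .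
    have "AE s in lborel. AE z in (lborel :: real measure). s \<noteq> \<tau>"
      using AE_lborel_singleton[of \<tau>] by eventually_elim simp
    moreover have "{x \<in> space (lborel \<Otimes>\<^sub>M (lborel :: real measure)). fst x \<noteq> \<tau>} = (- {\<tau>}) \<times> UNIV"
      by (auto simp: space_pair_measure)
    ultimately have "AE x in lborel \<Otimes>\<^sub>M (lborel :: real measure). fst x \<noteq> \<tau>"
      by (intro lborel_pair.AE_pair_measure) simp_all
    then show "AE x in lborel \<Otimes>\<^sub>M lborel. (\<lambda>n. ennreal (win_kernel b (u n) (v n) (fst x) (snd x))) \<longlonglongrightarrow> ennreal (win_kernel b \<tau> \<tau> (fst x) (snd x))"
    proof eventually_elim
      case (elim x)
      obtain s z where x: "x = (s, z)" by fastforce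
      let ?g = "\<lambda>u v. exp (- (u * z)) * gap u (min z (b v))"
      have "\<forall>\<^sub>F n in sequentially. s \<le> u n \<longleftrightarrow> s \<le> \<tau>"
      proof (cases "s < \<tau>")
        case True
        show ?thesis using order_tendstoD(1)[OF u True] by eventually_elim (use True in auto)
      next
        case False
        then have "\<tau> < s" using elim x by auto
        show ?thesis using order_tendstoD(2)[OF u \<open>\<tau> < s\<close>] by eventually_elim (use \<open>\<tau> < s\<close> in auto)
      qed
      then have ev: "\<forall>\<^sub>F n in sequentially. (if 0 \<le> s \<and> s \<le> \<tau> \<and> 0 \<le> z \<and> b s < z then ?g (u n) (v n) else 0) =
          win_kernel b (u n) (v n) s z"
        by eventually_elim (simp add: win_kernel_def)
      have "(\<lambda>n. b (v n)) \<longlonglongrightarrow> b \<tau>" using cont v by (rule isCont_tendsto_compose)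
      then have "(\<lambda>n. ?g (u n) (v n)) \<longlonglongrightarrow> ?g \<tau> \<tau>"
        unfolding gap_def using \<tau> u by (intro tendsto_intros) auto
      then have "(\<lambda>n. if 0 \<le> s \<and> s \<le> \<tau> \<and> 0 \<le> z \<and> b s < z then ?g (u n) (v n) else 0) \<longlonglongrightarrow> win_kernel b \<tau> \<tau> s z"
        by (auto simp: win_kernel_def)
      then have "(\<lambda>n. win_kernel b (u n) (v n) s z) \<longlonglongrightarrow> win_kernel b \<tau> \<tau> s z"
        by (rule Lim_transform_eventually[OF _ ev])
      then show ?case by (simp add: x tendsto_ennrealI)
    qed
  qed auto
  then have "(\<lambda>n. win_density b (u n) (v n)) \<longlonglongrightarrow> win_density b \<tau> \<tau>" unfolding prod .
  then show ?thesis unfolding u_def v_def by (rule LIMSEQ_offset)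
qed

text \<open>
Both cells contain the time of an overall minimum.
\<close>
lemma cell_success_disjoint:
  assumes S: "atom_config S" and A: "cell_success b S u v" "cell_success b S u' v'"
    and "0 \<le> u" "u \<le> v" "v \<le> 1" "0 \<le> u'" "u' \<le> v'" "v' \<le> 1"
  shows "{u<..v} \<inter> {u'<..v'} \<noteq> {}"
proof -
  have "lowest S {u<..v} < \<infinity>" using A(1) by (auto simp: cell_success_def)
  then obtain t x where tx: "(t, x) \<in> S" "t \<in> {u<..v}" "lowest S {u<..v} = ereal x"
    using lowest_attained[OF S] by metis
  have "x \<le> y" if "(r, y) \<in> S" for r y
  proof -
    have "r \<in> {0..u} \<or> r \<in> {u<..v} \<or> r \<in> {v<..1}" using atom_configD[OF S that] by auto
    then have "ereal x \<le> ereal y"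
      using A(1) lowest_le[OF that, of "{0..u}"] lowest_le[OF that, of "{u<..v}"] lowest_le[OF that, of "{v<..1}"]
      unfolding cell_success_def tx(3) by (meson less_imp_le order_trans)
    then show ?thesis by simp
  qed
  then have "t \<in> {u'<..v'}"
    using assms by (intro cell_success_location[OF S A(2) _ _ _ tx(1)]) auto
  then show ?thesis using tx(2) by auto
qed

text \<open>
The probabilities of the cells spread uniformly over the cells, so that their sum is the integral
of a function converging pointwise to the time density.
\<close>
definition step_density :: "(real \<Rightarrow> real) \<Rightarrow> nat \<Rightarrow> real \<Rightarrow> ennreal" where
  "step_density b n \<tau> = (\<Sum>k\<in>{1..<n - 1}.
     win_density b (k / n) ((real k + 1) / n) * indicator {k / n..<(real k + 1) / n} \<tau>)"

lemma grid_success_prob: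
  assumes P: "poisson_point_process M lebesgue_strip N"
    and b[measurable]: "b \<in> borel_measurable borel" and b0: "\<And>t. 0 \<le> t \<Longrightarrow> t < 1 \<Longrightarrow> 0 \<le> b t"
  shows "{\<omega>\<in>space M. grid_success b (N \<omega>) n} \<in> sets M"
    and "emeasure M {\<omega>\<in>space M. grid_success b (N \<omega>) n} = (\<integral>\<^sup>+\<tau>. step_density b n \<tau> \<partial>lborel)"
proof -
  let ?u = "\<lambda>k::nat. real k / real n" and ?v = "\<lambda>k::nat. (real k + 1) / real n"
  let ?C = "\<lambda>k. {\<omega>\<in>space M. cell_success b (N \<omega>) (?u k) (?v k)}"
  have uv: "0 < ?u k" "?u k < ?v k" "?v k < 1" if "k \<in> {1..<n - 1}" for k
    using that by (auto simp: field_simps)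
  have grid: "{\<omega>\<in>space M. grid_success b (N \<omega>) n} = (\<Union>k\<in>{1..<n - 1}. ?C k)"
    by (auto simp: grid_success_def less_diff_conv)
  have C: "?C k \<in> sets M" if "k \<in> {1..<n - 1}" for k
    by (rule cell_success_measurable[OF P uv[OF that] b])
  show "{\<omega>\<in>space M. grid_success b (N \<omega>) n} \<in> sets M"
    unfolding grid using C by (intro sets.finite_UN) auto
  have disj: "disjoint_family_on ?C {1..<n - 1}"
    unfolding disjoint_family_on_def
  proof (intro ballI impI)
    fix k l :: nat assume kl: "k \<in> {1..<n - 1}" "l \<in> {1..<n - 1}" "k \<noteq> l"
    show "?C k \<inter> ?C l = {}"
    proof (rule ccontr)
      assume "?C k \<inter> ?C l \<noteq> {}"
      then obtain \<omega> where \<omega>: "\<omega> \<in> space M" "cell_success b (N \<omega>) (?u k) (?v k)" "cell_success b (N \<omega>) (?u l) (?v l)"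
        by blast
      have "{?u k<..?v k} \<inter> {?u l<..?v l} \<noteq> {}"
        using uv[OF kl(1)] uv[OF kl(2)]
        by (intro cell_success_disjoint[OF poisson_atom_config[OF P \<omega>(1)] \<omega>(2,3)]) auto
      then obtain t where "t \<in> {?u k<..?v k}" "t \<in> {?u l<..?v l}" by blast
      moreover have "0 < real n" using kl by auto
      ultimately have "real k < t * n" "t * n \<le> real k + 1" "real l < t * n" "t * n \<le> real l + 1"
        by (auto simp: field_simps)
      then show False using kl(3) by linarith
    qed
  qed
  have "emeasure M {\<omega>\<in>space M. grid_success b (N \<omega>) n} = (\<Sum>k\<in>{1..<n - 1}. emeasure M (?C k))"
    unfolding grid using C disj by (intro sum_emeasure[symmetric]) auto
  also have "\<dots> = (\<Sum>k\<in>{1..<n - 1}. \<integral>\<^sup>+\<tau>. win_density b (?u k) (?v k) * indicator {?u k..<?v k} \<tau> \<partial>lborel)"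
  proof (rule sum.cong)
    fix k assume k: "k \<in> {1..<n - 1}"
    have "emeasure M (?C k) = ennreal (?v k - ?u k) * win_density b (?u k) (?v k)"
      using uv[OF k] b0[of "?v k"] by (intro cell_success_prob[OF P _ _ _ b]) auto
    also have "\<dots> = (\<integral>\<^sup>+\<tau>. win_density b (?u k) (?v k) * indicator {?u k..<?v k} \<tau> \<partial>lborel)"
      using uv[OF k] by (simp add: nn_integral_cmult_indicator mult.commute)
    finally show "emeasure M (?C k) = (\<integral>\<^sup>+\<tau>. win_density b (?u k) (?v k) * indicator {?u k..<?v k} \<tau> \<partial>lborel)" .
  qed simp
  also have "\<dots> = (\<integral>\<^sup>+\<tau>. step_density b n \<tau> \<partial>lborel)"
    unfolding step_density_def by (rule nn_integral_sum[symmetric]) measurable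
  finally show "emeasure M {\<omega>\<in>space M. grid_success b (N \<omega>) n} = (\<integral>\<^sup>+\<tau>. step_density b n \<tau> \<partial>lborel)" .
qed

lemma step_density_eq:
  assumes "1 \<le> k" "k + 1 < n" "real k \<le> \<tau> * n" "\<tau> * n < real k + 1"
  shows "step_density b n \<tau> = win_density b (k / n) ((real k + 1) / n)"
proof -
  have n: "0 < real n" using assms by auto
  have iff: "\<tau> \<in> {l / n..<(real l + 1) / n} \<longleftrightarrow> l = k" for l :: nat
    using assms n by (auto simp: field_simps)
  have "step_density b n \<tau> = (\<Sum>l\<in>{1..<n - 1}. if l = k then win_density b (k / n) ((real k + 1) / n) else 0)"
    unfolding step_density_def by (intro sum.cong refl) (simp only: indicator_def iff, simp)
  then show ?thesis using assms by (simp add: less_diff_conv)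
qed

lemma step_density_outside:
  assumes "\<And>k. 1 \<le> k \<Longrightarrow> k + 1 < n \<Longrightarrow> \<not> (real k \<le> \<tau> * n \<and> \<tau> * n < real k + 1)"
  shows "step_density b n \<tau> = 0"
  unfolding step_density_def
proof (rule sum.neutral, rule ballI)
  fix k assume k: "k \<in> {1..<n - 1}"
  then have "\<tau> \<notin> {k / n..<(real k + 1) / n}" using assms[of k] by (auto simp: field_simps)
  then show "win_density b (k / n) ((real k + 1) / n) * indicator {k / n..<(real k + 1) / n} \<tau> = 0" by simp
qed

lemma step_density_le:
  assumes b[measurable]: "b \<in> borel_measurable borel" and b0: "\<And>t. 0 \<le> t \<Longrightarrow> t < 1 \<Longrightarrow> 0 \<le> b t"
  shows "step_density b n \<tau> \<le> indicator {0..1} \<tau>"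
proof (cases "\<exists>k. 1 \<le> k \<and> k + 1 < n \<and> real k \<le> \<tau> * n \<and> \<tau> * n < real k + 1")
  case True
  then obtain k where k: "1 \<le> k" "k + 1 < n" "real k \<le> \<tau> * n" "\<tau> * n < real k + 1" by blast
  have n: "0 < real n" using k by auto
  have "\<tau> \<in> {k / n..<(real k + 1) / n}" using k n by (auto simp: field_simps)
  moreover have uv: "0 < k / n" "(real k + 1) / n < 1" "k / n < 1" using k by (auto simp: field_simps)
  ultimately have "\<tau> \<in> {0..1}" by auto
  moreover have "win_density b (k / n) ((real k + 1) / n) \<le> 1"
    using uv b0[of "(real k + 1) / n"] by (intro win_density_le_1 b) auto
  ultimately show ?thesis using step_density_eq[OF k] by simp
next
  case False
  then show ?thesis by (subst step_density_outside) auto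
qed

lemma step_density_tendsto:
  assumes b[measurable]: "b \<in> borel_measurable borel" and b0: "\<And>t. 0 \<le> t \<Longrightarrow> t < 1 \<Longrightarrow> 0 \<le> b t"
    and cont: "\<And>t. 0 < t \<Longrightarrow> t < 1 \<Longrightarrow> isCont b t"
  shows "(\<lambda>n. step_density b n \<tau>) \<longlonglongrightarrow> win_density b \<tau> \<tau> * indicator {0<..<1} \<tau>"
proof (cases "0 < \<tau> \<and> \<tau> < 1")
  case True
  define k where "k n = nat \<lfloor>\<tau> * real n\<rfloor>" for n
  have k: "real (k n) \<le> \<tau> * n" "\<tau> * n < real (k n) + 1" for n
    using True by (simp_all add: k_def)
  have "\<forall>\<^sub>F n in sequentially. 1 < \<tau> * real n \<and> 1 < (1 - \<tau>) * real n"
    using True by (intro eventually_conj) real_asymp+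
  then have ev: "\<forall>\<^sub>F n in sequentially. win_density b (k n / n) ((real (k n) + 1) / n) = step_density b n \<tau>"
  proof eventually_elim
    case (elim n)
    then have "1 \<le> k n" "k n + 1 < n" using k[of n] by (simp_all add: algebra_simps)
    then show ?case using step_density_eq k by metis
  qed
  have e: "k n / n = real_of_int \<lfloor>\<tau> * real n\<rfloor> / n" for n using True by (simp add: k_def)
  have U: "(\<lambda>n. k n / n) \<longlonglongrightarrow> \<tau>" unfolding e by real_asymp
  have V: "(\<lambda>n. (real (k n) + 1) / n) \<longlonglongrightarrow> \<tau>"
    unfolding add_divide_distrib e by real_asymp
  have "(\<lambda>n. win_density b (k n / n) ((real (k n) + 1) / n)) \<longlonglongrightarrow> win_density b \<tau> \<tau>"
    using True by (intro win_density_tendsto b b0 cont U V) auto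
  then show ?thesis using True by (simp add: Lim_transform_eventually[OF _ ev])
next
  case False
  have "step_density b n \<tau> = 0" for n
  proof (rule step_density_outside, rule notI)
    fix k assume k: "1 \<le> k" "k + 1 < n" "real k \<le> \<tau> * n \<and> \<tau> * n < real k + 1"
    then have "real k + 1 < real n" "1 \<le> real k" by linarith+
    then have "0 < \<tau> * n" "\<tau> * n < n" using k(3) by linarith+
    moreover from this have "\<tau> < 1"
      using mult_right_mono[of 1 \<tau> "real n"] by (intro not_le[THEN iffD1] notI) linarith
    ultimately have "0 < \<tau>" "\<tau> < 1" by (auto simp: zero_less_mult_iff)
    then show False using False by simp
  qed
  then show ?thesis using False by (auto simp: indicator_def)
qed

text \<open>
A success at a positive time is the limit of the grid events for every outcome, hence measurable
with the limiting probability. A success at time \<open>0\<close> is not seen by the grid; it is a separate event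
of probability zero, described by two lowest marks so that its measurability is explicit.
\<close>
lemma success_prob_eq:
  assumes P: "poisson_point_process M lebesgue_strip N"
    and b[measurable]: "b \<in> borel_measurable borel" and b0: "\<And>t. 0 \<le> t \<Longrightarrow> t < 1 \<Longrightarrow> 0 \<le> b t"
    and mono: "mono_on {0..<1} b" and cont: "continuous_on {0..<1} b"
  shows "ennreal (success_probability M N b) = (\<integral>\<^sup>+\<tau>. win_density b \<tau> \<tau> * indicator {0<..<1} \<tau> \<partial>lborel)"
proof -
  interpret prob_space M using P by (rule poisson_prob_space)
  note S = poisson_atom_config[OF P]
  let ?G = "\<lambda>n. {\<omega>\<in>space M. grid_success b (N \<omega>) n}"
  let ?E = "{\<omega>\<in>space M. \<exists>t>0. succeeds_at b (N \<omega>) t}"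
  let ?Z = "{\<omega>\<in>space M. succeeds_at b (N \<omega>) 0}"
  have ev: "\<forall>\<^sub>F n in sequentially. grid_success b (N \<omega>) n \<longleftrightarrow> (\<exists>t>0. succeeds_at b (N \<omega>) t)" if "\<omega> \<in> space M" for \<omega>
    by (rule grid_success_eventually[OF S[OF that] mono cont])
  note G = grid_success_prob(1)[OF P b b0]
  have E: "?E \<in> sets M"
  proof -
    have "?E = (\<Union>K. \<Inter>n\<in>{K..}. ?G n)"
    proof (intro set_eqI iffI)
      fix \<omega> assume "\<omega> \<in> ?E"
      then have \<omega>: "\<omega> \<in> space M" "\<exists>t>0. succeeds_at b (N \<omega>) t" by simp_all
      obtain K where "\<forall>n\<ge>K. grid_success b (N \<omega>) n \<longleftrightarrow> (\<exists>t>0. succeeds_at b (N \<omega>) t)"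
        using ev[OF \<omega>(1)] unfolding eventually_sequentially by blast
      then have "\<forall>n\<ge>K. grid_success b (N \<omega>) n" using \<omega>(2) by blast
      then have "\<omega> \<in> (\<Inter>n\<in>{K..}. ?G n)" using \<omega>(1) by blast
      then show "\<omega> \<in> (\<Union>K. \<Inter>n\<in>{K..}. ?G n)" by blast
    next
      fix \<omega> assume "\<omega> \<in> (\<Union>K. \<Inter>n\<in>{K..}. ?G n)"
      then obtain K where K: "\<omega> \<in> (\<Inter>n\<in>{K..}. ?G n)" by blast
      then have \<omega>: "\<omega> \<in> space M" by blast
      obtain K' where K': "\<forall>n\<ge>K'. grid_success b (N \<omega>) n \<longleftrightarrow> (\<exists>t>0. succeeds_at b (N \<omega>) t)"
        using ev[OF \<omega>] unfolding eventually_sequentially by blast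
      have "\<omega> \<in> ?G (max K K')" using K by (rule INT_D) simp
      then have "grid_success b (N \<omega>) (max K K')" by blast
      then have "\<exists>t>0. succeeds_at b (N \<omega>) t" using K'[rule_format, of "max K K'"] by simp
      then show "\<omega> \<in> ?E" using \<omega> by blast
    qed
    also have "\<dots> \<in> sets M" using G by (intro sets.countable_UN sets.countable_INT') auto
    finally show ?thesis .
  qed
  have E0: "?Z = {\<omega>\<in>space M. lowest (N \<omega>) {0..0} \<le> ereal (b 0) \<and> lowest (N \<omega>) {0..0} < lowest (N \<omega>) {0<..1}}"
    (is "_ = ?Y")
  proof (intro Collect_cong conj_cong refl)
    fix \<omega> assume "\<omega> \<in> space M"
    note S = S[OF this]
    show "succeeds_at b (N \<omega>) 0 \<longleftrightarrow> lowest (N \<omega>) {0..0} \<le> ereal (b 0) \<and> lowest (N \<omega>) {0..0} < lowest (N \<omega>) {0<..1}"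
    proof
      assume "succeeds_at b (N \<omega>) 0"
      then obtain x where x: "(0, x) \<in> N \<omega>" "x \<le> b 0"
        and min: "\<And>r y. (r, y) \<in> N \<omega> \<Longrightarrow> y \<le> x \<Longrightarrow> (r, y) = (0, x)"
        unfolding succeeds_at_def by blast
      have le: "lowest (N \<omega>) {0..0} \<le> ereal x" by (rule lowest_le[OF x(1)]) simp
      also have "ereal x < lowest (N \<omega>) {0<..1}"
      proof (rule ccontr)
        assume "\<not> ereal x < lowest (N \<omega>) {0<..1}"
        then have *: "lowest (N \<omega>) {0<..1} \<le> ereal x" by simp
        then have "lowest (N \<omega>) {0<..1} < \<infinity>" by (auto intro: le_less_trans)
        then obtain r y where "(r, y) \<in> N \<omega>" "r \<in> {0<..1}" "lowest (N \<omega>) {0<..1} = ereal y"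
          using lowest_attained[OF S] by metis
        then show False using min[of r y] * by auto
      qed
      finally show "lowest (N \<omega>) {0..0} \<le> ereal (b 0) \<and> lowest (N \<omega>) {0..0} < lowest (N \<omega>) {0<..1}"
        using le x(2) by (auto intro: order_trans)
    next
      assume *: "lowest (N \<omega>) {0..0} \<le> ereal (b 0) \<and> lowest (N \<omega>) {0..0} < lowest (N \<omega>) {0<..1}"
      then have "lowest (N \<omega>) {0..0} < \<infinity>" by auto
      then obtain s x where "(s, x) \<in> N \<omega>" "s \<in> {0..0}" and low: "lowest (N \<omega>) {0..0} = ereal x"
        using lowest_attained[OF S] by metis
      then have x: "(0, x) \<in> N \<omega>" by simp
      have "(r, y) = (0, x)" if ry: "(r, y) \<in> N \<omega>" "y \<le> x" for r y
      proof (cases "r = 0")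
        case True
        then have "ereal x \<le> ereal y" using lowest_le[OF ry(1), of "{0..0}"] low by simp
        then show ?thesis using ry True by simp
      next
        case False
        then have "lowest (N \<omega>) {0<..1} \<le> ereal y"
          using atom_configD[OF S ry(1)] by (intro lowest_le[OF ry(1)]) auto
        also have "\<dots> \<le> ereal x" using ry(2) by simp
        finally show ?thesis using * low by (auto dest: leD)
      qed
      moreover have "\<not> acceptable b (N \<omega>) s" if "s < 0" for s
        using that by (simp add: acceptable_def)
      moreover have "x \<le> b 0" using * low by simp
      ultimately show "succeeds_at b (N \<omega>) 0"
        unfolding succeeds_at_def using x by (intro exI[of _ x] conjI) (simp, simp, blast+)
    qed
  qed
  have F0: "?Y \<in> sets M"
  proof -
    have [measurable]: "(\<lambda>\<omega>. lowest (N \<omega>) {0..0}) \<in> borel_measurable M" "(\<lambda>\<omega>. lowest (N \<omega>) {0<..1}) \<in> borel_measurable M"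
      by (intro lowest_measurable[OF P]; auto)+
    show ?thesis by measurable
  qed
  have null: "emeasure M ?Z = 0"
  proof -
    have "AE \<omega> in M. \<not> (lowest (N \<omega>) {0..0} \<le> ereal (b 0) \<and> lowest (N \<omega>) {0..0} < lowest (N \<omega>) {0<..1})"
      using lowest_null_AE[OF P, of "{0..0}"] by (auto elim: eventually_mono)
    then have "emeasure M ?Y = 0"
      by (rule AE_iff_measurable[OF F0 _, THEN iffD1, rotated]) auto
    then show ?thesis unfolding E0 .
  qed
  have "{\<omega>\<in>space M. \<exists>t. stops_at b (N \<omega>) t \<and> is_last_record (N \<omega>) t (running_min (N \<omega>) t)} = ?E \<union> ?Z"
  proof -
    have "(\<exists>t. succeeds_at b (N \<omega>) t) \<longleftrightarrow> (\<exists>t>0. succeeds_at b (N \<omega>) t) \<or> succeeds_at b (N \<omega>) 0" for \<omega>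
      by (metis less_le succeeds_at_def)
    then show ?thesis using succeeds_at_iff[OF S] by blast
  qed
  then have "ennreal (success_probability M N b) = emeasure M (?E \<union> ?Z)"
    unfolding success_probability_def by (simp add: emeasure_eq_measure)
  also have "\<dots> = emeasure M ?E"
    using E F0 null unfolding E0 by (intro emeasure_Un_null_set) auto
  finally have *: "ennreal (success_probability M N b) = emeasure M ?E" .
  have "(\<lambda>n. \<integral>\<^sup>+\<omega>. indicator (?G n) \<omega> \<partial>M) \<longlonglongrightarrow> (\<integral>\<^sup>+\<omega>. indicator ?E \<omega> \<partial>M)"
  proof (rule nn_integral_dominated_convergence[where w = "\<lambda>_. 1"])
    show "AE \<omega> in M. (\<lambda>n. indicator (?G n) \<omega> :: ennreal) \<longlonglongrightarrow> indicator ?E \<omega>"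
    proof (rule AE_I2)
      fix \<omega> assume \<omega>: "\<omega> \<in> space M"
      have "\<forall>\<^sub>F n in sequentially. indicator ?E \<omega> = (indicator (?G n) \<omega> :: ennreal)"
        using ev[OF \<omega>] by eventually_elim (use \<omega> in \<open>auto simp: indicator_def\<close>)
      then show "(\<lambda>n. indicator (?G n) \<omega> :: ennreal) \<longlonglongrightarrow> indicator ?E \<omega>"
        by (rule Lim_transform_eventually[OF tendsto_const])
    qed
  qed (use E G in \<open>auto simp: indicator_def emeasure_space_1\<close>)
  then have "(\<lambda>n. \<integral>\<^sup>+\<tau>. step_density b n \<tau> \<partial>lborel) \<longlonglongrightarrow> emeasure M ?E"
    using E G grid_success_prob(2)[OF P b b0] by simp
  moreover have "(\<lambda>n. \<integral>\<^sup>+\<tau>. step_density b n \<tau> \<partial>lborel) \<longlonglongrightarrow> (\<integral>\<^sup>+\<tau>. win_density b \<tau> \<tau> * indicator {0<..<1} \<tau> \<partial>lborel)"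
  proof (rule nn_integral_dominated_convergence[where w = "indicator {0..1}"])
    show "step_density b n \<in> borel_measurable lborel" for n
      unfolding step_density_def by measurable
    show "(\<lambda>\<tau>. win_density b \<tau> \<tau> * indicator {0<..<1} \<tau>) \<in> borel_measurable lborel"
      unfolding win_density_def by measurable
    have "isCont b t" if "0 < t" "t < 1" for t
    proof -
      have "continuous_on {0<..<1} b" by (rule continuous_on_subset[OF cont]) auto
      then show ?thesis using that by (simp add: continuous_on_eq_continuous_at)
    qed
    then show "AE \<tau> in lborel. (\<lambda>n. step_density b n \<tau>) \<longlonglongrightarrow> win_density b \<tau> \<tau> * indicator {0<..<1} \<tau>"
      by (intro AE_I2 step_density_tendsto b b0)
  qed (use step_density_le[OF b b0] in auto)
  ultimately show ?thesis using * LIMSEQ_unique by metis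
qed

section \<open>Change of variables for the Stieltjes measure\<close>

lemma sets_stieltjes_measure_eq: "sets (stieltjes_measure F) = sets (restrict_space borel {0<..<1})"
proof -
  let ?\<Omega> = "{0<..<1::real}"
  let ?G = "{{s<..t} |s t. 0 < s \<and> s \<le> t \<and> t < (1::real)}"
  have "sets (restrict_space borel ?\<Omega>) = sigma_sets ?\<Omega> ((\<inter>) ?\<Omega> ` range (\<lambda>(a, b). {a<..b}))"
    unfolding sets_restrict_space
  proof -
    have "?\<Omega> \<in> sigma_sets UNIV (range (\<lambda>(a, b). {a<..b}))"
    proof -
      have "?\<Omega> \<in> sets borel" by simp
      then show ?thesis by (subst (asm) borel_sigma_sets_Ioc) simp
    qed
    then have "(\<inter>) ?\<Omega> ` sigma_sets UNIV (range (\<lambda>(a, b). {a<..b})) = sigma_sets ?\<Omega> ((\<inter>) ?\<Omega> ` range (\<lambda>(a, b). {a<..b}))"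
      by (rule sigma_sets_Int) simp
    moreover have "sets (borel :: real measure) = sigma_sets UNIV (range (\<lambda>(a, b). {a<..b}))"
      by (subst borel_sigma_sets_Ioc) simp
    ultimately show "(\<inter>) ?\<Omega> ` sets borel = sigma_sets ?\<Omega> ((\<inter>) ?\<Omega> ` range (\<lambda>(a, b). {a<..b}))" by simp
  qed
  also have "\<dots> = sigma_sets ?\<Omega> ?G"
  proof (rule sigma_sets_eqI)
    fix A assume "A \<in> (\<inter>) ?\<Omega> ` range (\<lambda>(a, b). {a<..b})"
    then obtain a c where A: "A = ?\<Omega> \<inter> {a<..c}" by auto
    have "A = (\<Union>n::nat. {max a (1 / (real n + 2))<..max (max a (1 / (real n + 2))) (min c (1 - 1 / (real n + 2)))})"
    proof (intro set_eqI iffI)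
      fix x assume "x \<in> A"
      then have x: "0 < x" "x < 1" "a < x" "x \<le> c" by (auto simp: A)
      have "\<forall>\<^sub>F n in sequentially. 1 / (real n + 2) < x \<and> x < 1 - 1 / (real n + 2)"
        using x by (intro eventually_conj) real_asymp+
      then obtain n where "1 / (real n + 2) < x" "x < 1 - 1 / (real n + 2)"
        by (auto simp: eventually_sequentially)
      then show "x \<in> (\<Union>n::nat. {max a (1 / (real n + 2))<..max (max a (1 / (real n + 2))) (min c (1 - 1 / (real n + 2)))})"
        using x by (intro UN_I[of n]) auto
    next
      fix x assume "x \<in> (\<Union>n::nat. {max a (1 / (real n + 2))<..max (max a (1 / (real n + 2))) (min c (1 - 1 / (real n + 2)))})"
      then obtain n :: nat where "x \<in> {max a (1 / (real n + 2))<..max (max a (1 / (real n + 2))) (min c (1 - 1 / (real n + 2)))}" by blast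
      moreover have "0 < 1 / (real n + 2)" by simp
      ultimately show "x \<in> A"
        unfolding A Int_iff greaterThanLessThan_iff greaterThanAtMost_iff max_def min_def
        by (smt (verit))
    qed
    also have "\<dots> \<in> sigma_sets ?\<Omega> ?G"
    proof (rule sigma_sets.Union)
      fix n :: nat
      let ?s = "max a (1 / (real n + 2))" and ?t = "min c (1 - 1 / (real n + 2))"
      have "0 < 1 / (real n + 2)" by simp
      then have pos: "0 < ?s" "?t < 1" by (auto simp: less_max_iff_disj min_less_iff_disj)
      show "{?s<..max ?s ?t} \<in> sigma_sets ?\<Omega> ?G"
      proof (cases "?s \<le> ?t")
        case True
        then have "{?s<..max ?s ?t} \<in> ?G" using pos by (intro CollectI exI[of _ ?s] exI[of _ ?t]) auto
        then show ?thesis by (rule sigma_sets.Basic)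
      next
        case False
        then have "max ?s ?t = ?s" by (intro max_absorb1) linarith
        then have "{?s<..max ?s ?t} = {}" by (simp only: greaterThanAtMost_empty order.refl)
        then show ?thesis by (simp only: sigma_sets.Empty)
      qed
    qed
    finally show "A \<in> sigma_sets ?\<Omega> ?G" .
  next
    fix A assume "A \<in> ?G"
    then obtain s t where "A = {s<..t}" "0 < s" "s \<le> t" "t < 1" by auto
    then have "A = ?\<Omega> \<inter> (\<lambda>(a, b). {a<..b}) (s, t)" by auto
    then show "A \<in> sigma_sets ?\<Omega> ((\<inter>) ?\<Omega> ` range (\<lambda>(a, b). {a<..b}))" by blast
  qed
  finally show ?thesis unfolding sets_stieltjes_measure by simp
qed

lemma measurable_stieltjes [measurable (raw)]:
  assumes "f \<in> measurable borel K"
  shows "f \<in> measurable (stieltjes_measure F) K"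
  unfolding measurable_cong_sets[OF sets_stieltjes_measure_eq refl]
  using assms by (rule measurable_restrict_space1)

lemma sigma_finite_stieltjes:
  assumes mono: "mono_on {0<..<1} F" and cont: "continuous_on {0<..<1} F"
  shows "sigma_finite_measure (stieltjes_measure F)"
proof
  let ?A = "\<lambda>n::nat. {1 / (real n + 2)<..1 - 1 / (real n + 2)}"
  have fin: "emeasure (stieltjes_measure F) (?A n) \<noteq> \<infinity>" and sets: "?A n \<in> sets (stieltjes_measure F)" for n
  proof -
    have *: "0 < 1 / (real n + 2)" "1 / (real n + 2) \<le> 1 - 1 / (real n + 2)" "1 - 1 / (real n + 2) < 1"
      by (auto simp: field_simps)
    show "emeasure (stieltjes_measure F) (?A n) \<noteq> \<infinity>"
      unfolding emeasure_stieltjes_measure_Ioc[OF mono cont *] by simp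
    show "?A n \<in> sets (stieltjes_measure F)"
      unfolding sets_stieltjes_measure using * by (intro sigma_sets.Basic) blast
  qed
  have "\<Union> (range ?A) = {0<..<1}"
  proof (intro set_eqI iffI)
    fix x :: real assume x: "x \<in> {0<..<1}"
    have "\<forall>\<^sub>F n in sequentially. 1 / (real n + 2) < x \<and> x < 1 - 1 / (real n + 2)"
      using x by (intro eventually_conj) (simp, real_asymp)+
    then obtain n where "1 / (real n + 2) < x" "x < 1 - 1 / (real n + 2)"
      by (auto simp: eventually_sequentially)
    then show "x \<in> \<Union> (range ?A)" by (intro UN_I[of n]) auto
  next
    fix x :: real assume "x \<in> \<Union> (range ?A)"
    then obtain n where "x \<in> ?A n" by blast
    moreover have "0 < 1 / (real n + 2)" by simp
    ultimately show "x \<in> {0<..<1}"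
      unfolding greaterThanLessThan_iff greaterThanAtMost_iff by linarith
  qed
  then show "\<exists>A. countable A \<and> A \<subseteq> sets (stieltjes_measure F) \<and> \<Union> A = space (stieltjes_measure F) \<and>
      (\<forall>a\<in>A. emeasure (stieltjes_measure F) a \<noteq> \<infinity>)"
    using fin sets by (intro exI[of _ "range ?A"]) auto
qed

text \<open>
A continuous nondecreasing \<open>b\<close> maps its own Stieltjes measure to Lebesgue measure, intervals on
which \<open>b\<close> is constant being null. By the intermediate value theorem \<open>{r \<in> (s, t]. x < b r}\<close> is
\<open>(c, t]\<close>, where \<open>c\<close> is the last time at which \<open>b\<close> takes the value \<open>x\<close>, and it has measure \<open>b t - x\<close>.
\<close>
lemma stieltjes_push:
  fixes b :: "real \<Rightarrow> real" and g :: "real \<Rightarrow> ennreal"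
  assumes mono: "mono_on {0<..<1} b" and cont: "continuous_on {0<..<1} b"
    and [measurable]: "b \<in> borel_measurable borel" "g \<in> borel_measurable borel"
    and st: "0 < s" "s < t" "t < 1"
  shows "(\<integral>\<^sup>+r. g (b r) * indicator {s<..t} r \<partial>stieltjes_measure b) = (\<integral>\<^sup>+z. g z * indicator {b s<..b t} z \<partial>lborel)"
proof -
  let ?L = "stieltjes_measure b"
  let ?K = "distr (density ?L (indicator {s<..t})) borel b"
  have bst: "b s \<le> b t" using mono_onD[OF mono, of s t] st by auto
  have L: "emeasure ?L {c<..t} = ennreal (b t - b c)" if "s \<le> c" "c \<le> t" for c
    using that st by (intro emeasure_stieltjes_measure_Ioc[OF mono cont]) auto
  have "?K = density lborel (indicator {b s<..b t})"
  proof (rule measure_eqI_lessThan)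
    fix x :: real
    have "emeasure ?K {x<..} = emeasure (density ?L (indicator {s<..t})) (b -` {x<..} \<inter> {0<..<1})"
      by (subst emeasure_distr) auto
    also have "\<dots> = emeasure ?L ({s<..t} \<inter> (b -` {x<..} \<inter> {0<..<1}))"
    proof -
      have "b -` {x<..} \<inter> {0<..<1} \<in> sets ?L"
        using measurable_sets[OF measurable_stieltjes[of b borel b], of "{x<..}"] by simp
      moreover have "{s<..t} \<in> sets ?L"
        unfolding sets_stieltjes_measure using st
        by (intro sigma_sets.Basic CollectI exI[of _ s] exI[of _ t]) simp
      ultimately show ?thesis
        by (subst emeasure_density) (auto simp: indicator_inter_arith[symmetric])
    qed
    also have "{s<..t} \<inter> (b -` {x<..} \<inter> {0<..<1}) = {r\<in>{s<..t}. x < b r}"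
      using st by auto
    also have "emeasure ?L {r\<in>{s<..t}. x < b r} = emeasure lborel ({b s<..b t} \<inter> {x<..})"
    proof -
      consider "x < b s" | "b t \<le> x" | "b s \<le> x" "x < b t" by linarith
      then show ?thesis
      proof cases
        case 1
        have "x < b r" if "s < r" "r \<le> t" for r using mono_onD[OF mono, of s r] that st 1 by auto
        then have "{r\<in>{s<..t}. x < b r} = {s<..t}" by auto
        moreover have "{b s<..b t} \<inter> {x<..} = {b s<..b t}" using 1 by auto
        ultimately show ?thesis using L[of s] st bst by simp
      next
        case 2
        have "b r \<le> x" if "s < r" "r \<le> t" for r using mono_onD[OF mono, of r t] that st 2 by auto
        then have "{r\<in>{s<..t}. x < b r} = {}" by force
        moreover have "{b s<..b t} \<inter> {x<..} = {}" using 2 by auto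
        ultimately show ?thesis by (simp only: emeasure_empty)
      next
        case 3
        have cst: "continuous_on {s..t} b" using st by (intro continuous_on_subset[OF cont]) auto
        have "\<exists>c0\<ge>s. c0 \<le> t \<and> b c0 = x" using 3 st cst by (intro IVT') auto
        then have ne: "{c\<in>{s..t}. b c = x} \<noteq> {}" by auto
        have "closed {c\<in>{s..t}. b c = x}"
          using continuous_closed_preimage_constant[OF cst] by simp
        then have "compact {c\<in>{s..t}. b c = x}"
          by (rule compact_Int_closed[OF compact_Icc[of s t], THEN back_subst[of compact]]) auto
        then obtain c where c: "s \<le> c" "c \<le> t" "b c = x" "\<And>r. r \<in> {s..t} \<Longrightarrow> b r = x \<Longrightarrow> r \<le> c"
          using compact_attains_sup[OF _ ne] by auto
        have "x < b r \<longleftrightarrow> c < r" if "r \<in> {s<..t}" for r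
        proof
          assume "c < r"
          then have "x \<le> b r" "b r \<noteq> x" using mono_onD[OF mono, of c r] c(1-3) c(4)[of r] that st by auto
          then show "x < b r" by simp
        next
          assume "x < b r"
          then show "c < r" using mono_onD[OF mono, of r c] c(1-3) that st by (intro not_le[THEN iffD1] notI) auto
        qed
        then have "{r\<in>{s<..t}. x < b r} = {c<..t}" using c(1) by auto
        moreover have "{b s<..b t} \<inter> {x<..} = {x<..b t}" using 3 by auto
        ultimately show ?thesis using L[of c] c(1-3) 3 by simp
      qed
    qed
    also have "\<dots> = emeasure (density lborel (indicator {b s<..b t})) {x<..}"
      by (subst emeasure_density) (auto simp: indicator_inter_arith[symmetric])
    finally show eq: "emeasure ?K {x<..} = emeasure (density lborel (indicator {b s<..b t})) {x<..}" .
    have "emeasure (density lborel (indicator {b s<..b t})) {x<..} \<le> emeasure lborel {b s<..b t}"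
      by (subst emeasure_density) (auto simp: indicator_inter_arith[symmetric] intro!: emeasure_mono)
    also have "\<dots> < \<infinity>" using bst by simp
    finally show "emeasure ?K {x<..} < \<infinity>" unfolding eq .
  qed simp_all
  then have "(\<integral>\<^sup>+z. g z \<partial>?K) = (\<integral>\<^sup>+z. g z \<partial>density lborel (indicator {b s<..b t}))" by simp
  moreover have "(\<integral>\<^sup>+z. g z \<partial>?K) = (\<integral>\<^sup>+r. g (b r) \<partial>density ?L (indicator {s<..t}))"
    by (rule nn_integral_distr) measurable
  ultimately show ?thesis
    by (simp add: nn_integral_density mult.commute)
qed

section \<open>The two integrals of the success formula\<close>

lemma expm1_div_bounds:
  fixes s :: real
  assumes "0 \<le> s" shows "0 \<le> (exp s - 1) / s" "(exp s - 1) / s \<le> exp s"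
proof -
  show "0 \<le> (exp s - 1) / s" using assms by simp
  have "exp s * (1 - s) \<le> exp s * exp (- s)"
    using exp_ge_add_one_self[of "- s"] by (intro mult_left_mono) auto
  then have "exp s - 1 \<le> exp s * s" by (simp add: exp_minus algebra_simps)
  then show "(exp s - 1) / s \<le> exp s" using assms by (cases "s = 0") (simp_all add: divide_le_eq)
qed

lemma nn_integral_expm1:
  assumes "0 \<le> z"
  shows "(\<integral>\<^sup>+s. ennreal ((exp s - 1) / s) * indicator {0..z} s \<partial>lborel) = ennreal (exp z * D z)"
proof -
  have int: "integrable lborel (\<lambda>s. indicator {0..z} s * ((exp s - 1) / s))"
  proof (rule Bochner_Integration.integrable_bound)
    show "integrable lborel (\<lambda>s. indicator {0..z} s * exp z)"
      by (intro integrable_mult_left integrable_real_indicator) (auto simp: emeasure_lborel_Icc_eq)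
    show "AE s in lborel. norm (indicator {0..z} s * ((exp s - 1) / s)) \<le> norm (indicator {0..z} s * exp z)"
    proof (rule AE_I2)
      fix s
      show "norm (indicator {0..z} s * ((exp s - 1) / s)) \<le> norm (indicator {0..z} s * exp z)"
        using expm1_div_bounds[of s] by (auto simp: indicator_def intro: order_trans)
    qed
  qed measurable
  have "(\<integral>\<^sup>+s. ennreal ((exp s - 1) / s) * indicator {0..z} s \<partial>lborel) =
      (\<integral>\<^sup>+s. ennreal (indicator {0..z} s * ((exp s - 1) / s)) \<partial>lborel)"
    by (intro nn_integral_cong) (auto simp: indicator_def)
  also have "\<dots> = ennreal (LINT s|lborel. indicator {0..z} s * ((exp s - 1) / s))"
    using expm1_div_bounds(1) by (intro nn_integral_eq_integral int AE_I2) (auto simp: indicator_def)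
  also have "(LINT s|lborel. indicator {0..z} s * ((exp s - 1) / s)) = exp z * D z"
    by (simp add: D_def set_lebesgue_integral_def mult.assoc[symmetric] exp_minus)
  finally show ?thesis .
qed

lemma D_nonneg: "0 \<le> D z"
  unfolding D_def set_lebesgue_integral_def
  using expm1_div_bounds(1) by (intro mult_nonneg_nonneg integral_nonneg_AE AE_I2) (auto simp: indicator_def)

lemma D_measurable [measurable]: "D \<in> borel_measurable borel"
proof -
  have "D = (\<lambda>z. exp (- z) * (LINT s|lborel. (if 0 \<le> s \<and> s \<le> z then (exp s - 1) / s else 0)))"
    unfolding D_def set_lebesgue_integral_def
    by (intro ext arg_cong2[where f = "(*)"] refl Bochner_Integration.integral_cong) (auto simp: indicator_def)
  also have "\<dots> \<in> borel_measurable borel" by measurable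
  finally show ?thesis .
qed

lemma J_measurable [measurable]: "J \<in> borel_measurable borel"
  unfolding J_def by measurable

lemma gap_eq_J: "u < 1 \<Longrightarrow> gap u y = y * J ((1 - u) * y)"
  by (cases "y = 0") (simp_all add: gap_def J_def)

text \<open>
The probability that no mark below \<open>y\<close> arrives before \<open>t\<close> and that the first one to arrive afterwards
is the overall lowest mark, split by its arrival time \<open>\<tau>\<close>. The substitution \<open>r = (1 - \<tau>) * y\<close> leads
to the integral defining \<open>D\<close>.
\<close>
lemma nn_integral_future:
  assumes y: "0 \<le> y" and t: "0 < t" "t < 1"
  shows "(\<integral>\<^sup>+\<tau>. ennreal (exp (- (\<tau> * y)) * gap \<tau> y) * indicator {t..<1} \<tau> \<partial>lborel) =
     ennreal (exp (- (t * y)) * D ((1 - t) * y))"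
proof (cases "y = 0")
  case True
  have "D 0 = 0"
  proof -
    have "ennreal (exp 0 * D 0) = 0"
      unfolding nn_integral_expm1[OF order.refl, symmetric]
      by (subst nn_integral_0_iff_AE, measurable) (rule AE_I2, auto simp: indicator_def)
    then show ?thesis using D_nonneg[of 0] by (simp add: ennreal_eq_0_iff)
  qed
  then show ?thesis using True by (simp add: gap_def)
next
  case False
  then have y: "0 < y" using y by simp
  have [measurable]: "(\<lambda>\<tau>. gap \<tau> y) \<in> borel_measurable borel" by measurable
  have "(\<integral>\<^sup>+\<tau>. ennreal (exp (- (\<tau> * y)) * gap \<tau> y) * indicator {t..<1} \<tau> \<partial>lborel) =
     ennreal \<bar>- (1 / y)\<bar> * (\<integral>\<^sup>+r. ennreal (exp (- ((1 + - (1 / y) * r) * y)) * gap (1 + - (1 / y) * r) y) * indicator {t..<1} (1 + - (1 / y) * r) \<partial>lborel)"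
    using y by (intro nn_integral_real_affine) auto
  also have "\<dots> = ennreal (1 / y) * (\<integral>\<^sup>+r. ennreal (y * exp (- y)) * (ennreal ((exp r - 1) / r) * indicator {0..(1 - t) * y} r) \<partial>lborel)"
  proof (rule arg_cong2[where f = "(*)"])
    show "(\<integral>\<^sup>+r. ennreal (exp (- ((1 + - (1 / y) * r) * y)) * gap (1 + - (1 / y) * r) y) * indicator {t..<1} (1 + - (1 / y) * r) \<partial>lborel) =
      (\<integral>\<^sup>+r. ennreal (y * exp (- y)) * (ennreal ((exp r - 1) / r) * indicator {0..(1 - t) * y} r) \<partial>lborel)"
    proof (rule nn_integral_cong_AE)
      show "AE r in lborel. ennreal (exp (- ((1 + - (1 / y) * r) * y)) * gap (1 + - (1 / y) * r) y) * indicator {t..<1} (1 + - (1 / y) * r) =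
        ennreal (y * exp (- y)) * (ennreal ((exp r - 1) / r) * indicator {0..(1 - t) * y} r)"
        using AE_lborel_singleton[of 0]
      proof eventually_elim
        case (elim r)
        have in_iff: "1 + - (1 / y) * r \<in> {t..<1} \<longleftrightarrow> r \<in> {0..(1 - t) * y}"
          using y elim by (auto simp: field_simps)
        have e: "exp (- ((1 + - (1 / y) * r) * y)) * gap (1 + - (1 / y) * r) y = y * exp (- y) * ((exp r - 1) / r)"
        proof -
          have "- ((1 + - (1 / y) * r) * y) = r - y" using y by (simp add: field_simps)
          moreover have "gap (1 + - (1 / y) * r) y = y * (1 - exp (- r)) / r"
            using y by (simp add: gap_def)
          ultimately show ?thesis
            using elim by (simp add: exp_diff exp_minus field_simps)
        qed
        have ind: "indicator {t..<1} (1 + - (1 / y) * r) = (indicator {0..(1 - t) * y} r :: ennreal)"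
          unfolding indicator_def in_iff ..
        show ?case
        proof (cases "0 \<le> r")
          case True
          then have "ennreal (y * exp (- y) * ((exp r - 1) / r)) = ennreal (y * exp (- y)) * ennreal ((exp r - 1) / r)"
            using y expm1_div_bounds(1)[OF True] by (intro ennreal_mult) auto
          then show ?thesis unfolding e ind by (simp only: mult.assoc)
        next
          case False
          then show ?thesis unfolding ind by simp
        qed
      qed
    qed
  qed (use y in simp)
  also have "\<dots> = ennreal (1 / y) * (ennreal (y * exp (- y)) * ennreal (exp ((1 - t) * y) * D ((1 - t) * y)))"
    using y t by (subst nn_integral_cmult) (simp_all add: nn_integral_expm1)
  also have "\<dots> = ennreal (exp (- (t * y)) * D ((1 - t) * y))"
  proof -
    have "exp (- y) * exp ((1 - t) * y) = exp (- (t * y))"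
      by (simp add: exp_add[symmetric] algebra_simps)
    then have "1 / y * (y * exp (- y) * (exp ((1 - t) * y) * D ((1 - t) * y))) = exp (- (t * y)) * D ((1 - t) * y)"
      using y by (simp add: mult.assoc[symmetric])
    then show ?thesis
      using y D_nonneg[of "(1 - t) * y"] by (simp add: ennreal_mult[symmetric])
  qed
  finally show ?thesis .
qed

text \<open>
The cases \<open>b \<tau> < z\<close> and \<open>z \<le> b \<tau>\<close>. In the first the condition \<open>b s < z\<close> is automatic by monotonicity,
so \<open>s\<close> contributes the factor \<open>\<tau>\<close> and \<open>z\<close> the factor \<open>e\<^bsup>- \<tau> b \<tau>\<^esup> / \<tau>\<close>.
\<close>
lemma win_density_split:
  assumes mono: "mono_on {0..<1} b" and b0: "\<And>t. 0 \<le> t \<Longrightarrow> t < 1 \<Longrightarrow> 0 \<le> b t"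
    and [measurable]: "b \<in> borel_measurable borel" and \<tau>: "0 < \<tau>" "\<tau> < 1"
  shows "win_density b \<tau> \<tau> = ennreal (exp (- (\<tau> * b \<tau>)) * b \<tau> * J ((1 - \<tau>) * b \<tau>)) +
    (\<integral>\<^sup>+s. \<integral>\<^sup>+z. ennreal (exp (- (\<tau> * z)) * gap \<tau> z) * indicator {b s<..b \<tau>} z * indicator {0..\<tau>} s \<partial>lborel \<partial>lborel)"
proof -
  let ?c = "gap \<tau> (b \<tau>)"
  have c: "0 \<le> ?c" and b\<tau>: "0 \<le> b \<tau>" using \<tau> b0[of \<tau>] by (simp_all add: gap_nonneg)
  have tail: "(\<integral>\<^sup>+z. ennreal (exp (- (\<tau> * z)) * ?c) * indicator {b \<tau><..} z \<partial>lborel) = ennreal (?c / \<tau> * exp (- (\<tau> * b \<tau>)))"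
  proof -
    have "(\<integral>\<^sup>+z. ennreal (exp (- (\<tau> * z)) * ?c) * indicator {b \<tau><..} z \<partial>lborel) =
       (\<integral>\<^sup>+z. ennreal (?c / \<tau>) * (ennreal (exponential_density \<tau> z) * indicator {b \<tau><..} z) \<partial>lborel)"
      using \<tau> c b\<tau> by (intro nn_integral_cong) (auto simp: indicator_def exponential_density_def ennreal_mult[symmetric] mult_ac)
    also have "\<dots> = ennreal (?c / \<tau>) * emeasure (exp_law \<tau>) {b \<tau><..}"
      unfolding exp_law_def by (simp add: nn_integral_cmult emeasure_density)
    also have "\<dots> = ennreal (?c / \<tau> * exp (- (\<tau> * b \<tau>)))"
      using \<tau> c b\<tau> by (simp add: emeasure_exp_law_greaterThan ennreal_mult[symmetric])
    finally show ?thesis .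
  qed
  have "win_density b \<tau> \<tau> = (\<integral>\<^sup>+s. \<integral>\<^sup>+z. ennreal (exp (- (\<tau> * z)) * ?c) * indicator {b \<tau><..} z * indicator {0..\<tau>} s +
      ennreal (exp (- (\<tau> * z)) * gap \<tau> z) * indicator {b s<..b \<tau>} z * indicator {0..\<tau>} s \<partial>lborel \<partial>lborel)"
    unfolding win_density_def
  proof (intro nn_integral_cong)
    fix s z :: real
    have "0 \<le> b s \<and> b s \<le> b \<tau>" if "0 \<le> s" "s \<le> \<tau>"
      using that \<tau> b0[of s] mono_onD[OF mono, of s \<tau>] by auto
    then show "ennreal (win_kernel b \<tau> \<tau> s z) = ennreal (exp (- (\<tau> * z)) * ?c) * indicator {b \<tau><..} z * indicator {0..\<tau>} s +
      ennreal (exp (- (\<tau> * z)) * gap \<tau> z) * indicator {b s<..b \<tau>} z * indicator {0..\<tau>} s"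
      by (cases "z \<le> b \<tau>") (auto simp: win_kernel_def indicator_def min_def)
  qed
  also have "\<dots> = (\<integral>\<^sup>+s. ennreal (?c / \<tau> * exp (- (\<tau> * b \<tau>))) * indicator {0..\<tau>} s +
      (\<integral>\<^sup>+z. ennreal (exp (- (\<tau> * z)) * gap \<tau> z) * indicator {b s<..b \<tau>} z * indicator {0..\<tau>} s \<partial>lborel) \<partial>lborel)"
    by (simp add: nn_integral_add nn_integral_multc tail)
  also have "\<dots> = ennreal (?c / \<tau> * exp (- (\<tau> * b \<tau>))) * ennreal \<tau> +
      (\<integral>\<^sup>+s. \<integral>\<^sup>+z. ennreal (exp (- (\<tau> * z)) * gap \<tau> z) * indicator {b s<..b \<tau>} z * indicator {0..\<tau>} s \<partial>lborel \<partial>lborel)"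
  proof (subst nn_integral_add)
    show "(\<lambda>s. \<integral>\<^sup>+z. ennreal (exp (- (\<tau> * z)) * gap \<tau> z) * indicator {b s<..b \<tau>} z * indicator {0..\<tau>} s \<partial>lborel) \<in> borel_measurable lborel"
    proof -
      have "(\<lambda>s. \<integral>\<^sup>+z. ennreal (exp (- (\<tau> * z)) * gap \<tau> z) * (if b s < z \<and> z \<le> b \<tau> \<and> 0 \<le> s \<and> s \<le> \<tau> then 1 else 0) \<partial>lborel) \<in> borel_measurable lborel"
        by measurable
      also have "(\<lambda>s. \<integral>\<^sup>+z. ennreal (exp (- (\<tau> * z)) * gap \<tau> z) * (if b s < z \<and> z \<le> b \<tau> \<and> 0 \<le> s \<and> s \<le> \<tau> then 1 else 0) \<partial>lborel) =
         (\<lambda>s. \<integral>\<^sup>+z. ennreal (exp (- (\<tau> * z)) * gap \<tau> z) * indicator {b s<..b \<tau>} z * indicator {0..\<tau>} s \<partial>lborel)"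
        by (intro ext nn_integral_cong) (auto simp: indicator_def)
      finally show ?thesis .
    qed
  qed (use \<tau> in \<open>simp_all add: nn_integral_cmult_indicator\<close>)
  also have "ennreal (?c / \<tau> * exp (- (\<tau> * b \<tau>))) * ennreal \<tau> = ennreal (exp (- (\<tau> * b \<tau>)) * b \<tau> * J ((1 - \<tau>) * b \<tau>))"
    using \<tau> c by (simp add: ennreal_mult[symmetric] gap_eq_J[symmetric] mult_ac) (simp add: gap_eq_J mult_ac)
  finally show ?thesis .
qed

text \<open>
The substitution \<open>z = b t\<close> is made separately for each pair \<open>(s, \<tau>)\<close>, before any integration over them.
This avoids an inverse of \<open>b\<close>, which intervals of constancy would make ambiguous; the rest is
interchanging integrals of nonnegative functions.
\<close>
lemma nn_integral_crossing:
  assumes mono: "mono_on {0..<1} b" and cont: "continuous_on {0..<1} b"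
    and b0: "\<And>t. 0 \<le> t \<Longrightarrow> t < 1 \<Longrightarrow> 0 \<le> b t"
    and [measurable]: "b \<in> borel_measurable borel"
  shows "(\<integral>\<^sup>+\<tau>. (\<integral>\<^sup>+s. \<integral>\<^sup>+z. ennreal (exp (- (\<tau> * z)) * gap \<tau> z) * indicator {b s<..b \<tau>} z * indicator {0..\<tau>} s \<partial>lborel \<partial>lborel) *
      indicator {0<..<1} \<tau> \<partial>lborel) =
    (\<integral>\<^sup>+t. ennreal (exp (- (t * b t)) * t * D ((1 - t) * b t)) \<partial>stieltjes_measure b)"
proof -
  let ?L = "stieltjes_measure b"
  have mono': "mono_on {0<..<1} b" and cont': "continuous_on {0<..<1} b"
    by (auto intro: mono_on_subset[OF mono] continuous_on_subset[OF cont])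
  interpret L: sigma_finite_measure ?L by (rule sigma_finite_stieltjes[OF mono' cont'])
  interpret P: pair_sigma_finite lborel ?L ..
  have [measurable]: "fst \<in> borel_measurable (lborel \<Otimes>\<^sub>M ?L)"
    using measurable_fst[of lborel ?L] by simp
  have [measurable]: "snd \<in> borel_measurable (lborel \<Otimes>\<^sub>M ?L)"
    by (rule measurable_compose[OF measurable_snd]) (rule measurable_stieltjes, simp)
  define \<phi> where "\<phi> \<tau> t = ennreal (exp (- (\<tau> * b t)) * gap \<tau> (b t))" for \<tau> t
  define H where "H \<tau> s t = \<phi> \<tau> t * (if 0 < s \<and> s < t \<and> t \<le> \<tau> \<and> \<tau> < 1 then 1 else 0)" for \<tau> s t
  have "(\<integral>\<^sup>+s. \<integral>\<^sup>+z. ennreal (exp (- (\<tau> * z)) * gap \<tau> z) * indicator {b s<..b \<tau>} z * indicator {0..\<tau>} s \<partial>lborel \<partial>lborel) *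
      indicator {0<..<1} \<tau> = (\<integral>\<^sup>+t. \<phi> \<tau> t * indicator {t..<1} \<tau> * ennreal t \<partial>?L)" for \<tau>
  proof (cases "0 < \<tau> \<and> \<tau> < 1")
    case True
    have "(\<integral>\<^sup>+s. \<integral>\<^sup>+z. ennreal (exp (- (\<tau> * z)) * gap \<tau> z) * indicator {b s<..b \<tau>} z * indicator {0..\<tau>} s \<partial>lborel \<partial>lborel) =
      (\<integral>\<^sup>+s. \<integral>\<^sup>+t. H \<tau> s t \<partial>?L \<partial>lborel)"
    proof (rule nn_integral_cong_AE)
      show "AE s in lborel. (\<integral>\<^sup>+z. ennreal (exp (- (\<tau> * z)) * gap \<tau> z) * indicator {b s<..b \<tau>} z * indicator {0..\<tau>} s \<partial>lborel) =
        (\<integral>\<^sup>+t. H \<tau> s t \<partial>?L)"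
        using AE_lborel_singleton[of 0] AE_lborel_singleton[of \<tau>]
      proof eventually_elim
        case (elim s)
        show ?case
        proof (cases "0 < s \<and> s < \<tau>")
          case s: True
          have "(\<integral>\<^sup>+z. ennreal (exp (- (\<tau> * z)) * gap \<tau> z) * indicator {b s<..b \<tau>} z * indicator {0..\<tau>} s \<partial>lborel) =
             (\<integral>\<^sup>+t. \<phi> \<tau> t * indicator {s<..\<tau>} t \<partial>?L)"
            using stieltjes_push[OF mono' cont', of "\<lambda>z. ennreal (exp (- (\<tau> * z)) * gap \<tau> z)" s \<tau>] s True
            by (simp add: \<phi>_def)
          also have "\<dots> = (\<integral>\<^sup>+t. H \<tau> s t \<partial>?L)"
            using s True by (intro nn_integral_cong) (auto simp: H_def indicator_def)
          finally show ?thesis .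
        next
          case False
          then have "s \<notin> {0..\<tau>}" using elim by auto
          moreover have "H \<tau> s t = 0" for t using False by (auto simp: H_def)
          ultimately show ?thesis by simp
        qed
      qed
    qed
    also have "\<dots> = (\<integral>\<^sup>+t. \<integral>\<^sup>+s. H \<tau> s t \<partial>lborel \<partial>?L)"
      by (rule P.Fubini'[symmetric]) (simp add: H_def \<phi>_def split_beta')
    also have "\<dots> = (\<integral>\<^sup>+t. \<phi> \<tau> t * indicator {t..<1} \<tau> * ennreal t \<partial>?L)"
    proof (rule nn_integral_cong)
      fix t assume "t \<in> space ?L"
      then have t: "0 < t" "t < 1" by auto
      have "(\<integral>\<^sup>+s. H \<tau> s t \<partial>lborel) = (\<integral>\<^sup>+s. \<phi> \<tau> t * indicator {t..<1} \<tau> * indicator {0<..<t} s \<partial>lborel)"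
        by (intro nn_integral_cong) (auto simp: H_def indicator_def)
      also have "\<dots> = \<phi> \<tau> t * indicator {t..<1} \<tau> * ennreal t"
        using t by (simp add: nn_integral_cmult_indicator)
      finally show "(\<integral>\<^sup>+s. H \<tau> s t \<partial>lborel) = \<phi> \<tau> t * indicator {t..<1} \<tau> * ennreal t" .
    qed
    finally show ?thesis using True by simp
  next
    case False
    have "(\<integral>\<^sup>+t. \<phi> \<tau> t * indicator {t..<1} \<tau> * ennreal t \<partial>?L) = (\<integral>\<^sup>+t. 0 \<partial>?L)"
      using False by (intro nn_integral_cong) (auto simp: indicator_def)
    then show ?thesis using False by (auto simp: indicator_def)
  qed
  then have "(\<integral>\<^sup>+\<tau>. (\<integral>\<^sup>+s. \<integral>\<^sup>+z. ennreal (exp (- (\<tau> * z)) * gap \<tau> z) * indicator {b s<..b \<tau>} z * indicator {0..\<tau>} s \<partial>lborel \<partial>lborel) *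
      indicator {0<..<1} \<tau> \<partial>lborel) = (\<integral>\<^sup>+\<tau>. \<integral>\<^sup>+t. \<phi> \<tau> t * indicator {t..<1} \<tau> * ennreal t \<partial>?L \<partial>lborel)"
    by simp
  also have "\<dots> = (\<integral>\<^sup>+t. \<integral>\<^sup>+\<tau>. \<phi> \<tau> t * indicator {t..<1} \<tau> * ennreal t \<partial>lborel \<partial>?L)"
  proof (rule P.Fubini'[symmetric])
    have "(\<lambda>p. \<phi> (fst p) (snd p) * (if snd p \<le> fst p \<and> fst p < 1 then 1 else 0) * ennreal (snd p)) \<in> borel_measurable (lborel \<Otimes>\<^sub>M ?L)"
      unfolding \<phi>_def by measurable
    also have "(\<lambda>p. \<phi> (fst p) (snd p) * (if snd p \<le> fst p \<and> fst p < 1 then 1 else 0) * ennreal (snd p)) =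
        case_prod (\<lambda>\<tau> t. \<phi> \<tau> t * indicator {t..<1} \<tau> * ennreal t)"
      by (auto simp: indicator_def fun_eq_iff)
    finally show "case_prod (\<lambda>\<tau> t. \<phi> \<tau> t * indicator {t..<1} \<tau> * ennreal t) \<in> borel_measurable (lborel \<Otimes>\<^sub>M ?L)" .
  qed
  also have "\<dots> = (\<integral>\<^sup>+t. ennreal (exp (- (t * b t)) * t * D ((1 - t) * b t)) \<partial>?L)"
  proof (rule nn_integral_cong)
    fix t assume "t \<in> space ?L"
    then have t: "0 < t" "t < 1" by auto
    have "(\<integral>\<^sup>+\<tau>. \<phi> \<tau> t * indicator {t..<1} \<tau> * ennreal t \<partial>lborel) = (\<integral>\<^sup>+\<tau>. \<phi> \<tau> t * indicator {t..<1} \<tau> \<partial>lborel) * ennreal t"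
      unfolding \<phi>_def by (rule nn_integral_multc) measurable
    also have "\<dots> = ennreal (exp (- (t * b t)) * D ((1 - t) * b t)) * ennreal t"
      unfolding \<phi>_def using t b0[of t] by (subst nn_integral_future) auto
    also have "\<dots> = ennreal (exp (- (t * b t)) * t * D ((1 - t) * b t))"
      using t D_nonneg by (simp add: ennreal_mult[symmetric] mult_ac)
    finally show "(\<integral>\<^sup>+\<tau>. \<phi> \<tau> t * indicator {t..<1} \<tau> * ennreal t \<partial>lborel) = ennreal (exp (- (t * b t)) * t * D ((1 - t) * b t))" .
  qed
  finally show ?thesis .
qed

section \<open>The success formula and the hyperbolic boundary\<close>

text \<open>
Values outside \<open>(0, 1)\<close> do not enter the measure, so the boundary may be replaced by zero outside
\<open>[0, 1)\<close>, which makes it Borel measurable on the whole line.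
\<close>
lemma stieltjes_measure_cong:
  assumes "\<And>t. 0 < t \<Longrightarrow> t < 1 \<Longrightarrow> F t = G t"
  shows "stieltjes_measure F = stieltjes_measure G"
proof -
  let ?I = "{(s, t). 0 < s \<and> s \<le> t \<and> t < (1::real)}"
  have eq: "(\<lambda>(s, t). ennreal (F t - F s)) i = (\<lambda>(s, t). ennreal (G t - G s)) i" if "i \<in> ?I" for i
    using that assms by (cases i) auto
  have 1: "(\<forall>i\<in>?I. m i = (\<lambda>(s, t). ennreal (F t - F s)) i) \<longleftrightarrow> (\<forall>i\<in>?I. m i = (\<lambda>(s, t). ennreal (G t - G s)) i)" for m
    by (intro ball_cong refl) (simp only: eq)
  have 2: "(\<forall>i\<in>?I. (\<lambda>(s, t). ennreal (F t - F s)) i = 0) \<longleftrightarrow> (\<forall>i\<in>?I. (\<lambda>(s, t). ennreal (G t - G s)) i = 0)"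
    by (intro ball_cong refl) (simp only: eq)
  show ?thesis unfolding stieltjes_measure_def extend_measure_def 1 2 ..
qed

lemma success_formula_nn:
  assumes P: "poisson_point_process M lebesgue_strip N"
    and b[measurable]: "b \<in> borel_measurable borel" and b0: "\<And>t. 0 \<le> t \<Longrightarrow> t < 1 \<Longrightarrow> 0 \<le> b t"
    and mono: "mono_on {0..<1} b" and cont: "continuous_on {0..<1} b"
  shows "ennreal (success_probability M N b) =
     (\<integral>\<^sup>+t. ennreal (indicator {0<..<1} t * (exp (- t * b t) * b t * J ((1 - t) * b t))) \<partial>lborel) +
     (\<integral>\<^sup>+t. ennreal (indicator {0<..<1} t * (exp (- t * b t) * t * D ((1 - t) * b t))) \<partial>stieltjes_measure b)"
proof -
  let ?T = "\<lambda>\<tau>. \<integral>\<^sup>+s. \<integral>\<^sup>+z. ennreal (exp (- (\<tau> * z)) * gap \<tau> z) * indicator {b s<..b \<tau>} z * indicator {0..\<tau>} s \<partial>lborel \<partial>lborel"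
  have [measurable]: "?T \<in> borel_measurable borel"
  proof -
    have "(\<lambda>\<tau>. \<integral>\<^sup>+s. \<integral>\<^sup>+z. ennreal (exp (- (\<tau> * z)) * gap \<tau> z) * (if b s < z \<and> z \<le> b \<tau> \<and> 0 \<le> s \<and> s \<le> \<tau> then 1 else 0) \<partial>lborel \<partial>lborel) \<in> borel_measurable borel"
      by measurable
    also have "(\<lambda>\<tau>. \<integral>\<^sup>+s. \<integral>\<^sup>+z. ennreal (exp (- (\<tau> * z)) * gap \<tau> z) * (if b s < z \<and> z \<le> b \<tau> \<and> 0 \<le> s \<and> s \<le> \<tau> then 1 else 0) \<partial>lborel \<partial>lborel) = ?T"
      by (intro ext nn_integral_cong) (auto simp: indicator_def)
    finally show ?thesis .
  qed
  have "ennreal (success_probability M N b) = (\<integral>\<^sup>+\<tau>. win_density b \<tau> \<tau> * indicator {0<..<1} \<tau> \<partial>lborel)"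
    by (rule success_prob_eq[OF P b b0 mono cont])
  also have "\<dots> = (\<integral>\<^sup>+\<tau>. ennreal (indicator {0<..<1} \<tau> * (exp (- \<tau> * b \<tau>) * b \<tau> * J ((1 - \<tau>) * b \<tau>))) +
      ?T \<tau> * indicator {0<..<1} \<tau> \<partial>lborel)"
    using win_density_split[OF mono b0 b] by (intro nn_integral_cong) (auto simp: indicator_def)
  also have "\<dots> = (\<integral>\<^sup>+\<tau>. ennreal (indicator {0<..<1} \<tau> * (exp (- \<tau> * b \<tau>) * b \<tau> * J ((1 - \<tau>) * b \<tau>))) \<partial>lborel) +
      (\<integral>\<^sup>+\<tau>. ?T \<tau> * indicator {0<..<1} \<tau> \<partial>lborel)"
    by (rule nn_integral_add) measurable
  also have "(\<integral>\<^sup>+\<tau>. ?T \<tau> * indicator {0<..<1} \<tau> \<partial>lborel) =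
      (\<integral>\<^sup>+t. ennreal (exp (- (t * b t)) * t * D ((1 - t) * b t)) \<partial>stieltjes_measure b)"
    by (rule nn_integral_crossing[OF mono cont b0 b])
  also have "\<dots> = (\<integral>\<^sup>+t. ennreal (indicator {0<..<1} t * (exp (- t * b t) * t * D ((1 - t) * b t))) \<partial>stieltjes_measure b)"
    by (intro nn_integral_cong) auto
  finally show ?thesis .
qed

lemma J_nonneg: "0 \<le> z \<Longrightarrow> 0 \<le> J z"
  by (simp add: J_def)

lemma success_formula_borel:
  assumes P: "poisson_point_process M lebesgue_strip N"
    and b[measurable]: "b \<in> borel_measurable borel" and b0: "\<And>t. 0 \<le> t \<Longrightarrow> t < 1 \<Longrightarrow> 0 \<le> b t"
    and mono: "mono_on {0..<1} b" and cont: "continuous_on {0..<1} b"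
  shows "success_probability M N b =
     (LINT t:{0<..<1}|lborel. exp (- t * b t) * b t * J ((1 - t) * b t)) +
     (LINT t:{0<..<1}|stieltjes_measure b. exp (- t * b t) * t * D ((1 - t) * b t))" (is "_ = ?I1 + ?I2")
    and "set_integrable lborel {0<..<1} (\<lambda>t. exp (- t * b t) * b t * J ((1 - t) * b t))"
proof -
  let ?f = "\<lambda>t. indicator {0<..<1} t * (exp (- t * b t) * b t * J ((1 - t) * b t))"
  let ?g = "\<lambda>t. indicator {0<..<1} t * (exp (- t * b t) * t * D ((1 - t) * b t))"
  let ?F = "\<integral>\<^sup>+t. ennreal (?f t) \<partial>lborel" and ?G = "\<integral>\<^sup>+t. ennreal (?g t) \<partial>stieltjes_measure b"
  have eq: "ennreal (success_probability M N b) = ?F + ?G"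
    by (rule success_formula_nn[OF P b b0 mono cont])
  have "?F + ?G < \<infinity>" unfolding eq[symmetric] by simp
  then have fin: "?F < \<infinity>" "?G < \<infinity>" by (auto simp: less_top[symmetric])
  have f0: "0 \<le> ?f t" for t using b0[of t] J_nonneg by (auto simp: indicator_def)
  have g0: "0 \<le> ?g t" for t using D_nonneg by (auto simp: indicator_def)
  have I1: "?I1 = enn2real ?F"
    unfolding set_lebesgue_integral_def real_scaleR_def
    using f0 by (intro integral_eq_nn_integral AE_I2) measurable
  have I2: "?I2 = enn2real ?G"
    unfolding set_lebesgue_integral_def real_scaleR_def
    using g0 by (intro integral_eq_nn_integral AE_I2) measurable
  have "0 \<le> success_probability M N b" by (simp add: success_probability_def)
  then have "success_probability M N b = enn2real (?F + ?G)" unfolding eq[symmetric] by simp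
  also have "\<dots> = ?I1 + ?I2" unfolding I1 I2 using fin by (intro enn2real_plus) auto
  finally show "success_probability M N b = ?I1 + ?I2" .
  show "set_integrable lborel {0<..<1} (\<lambda>t. exp (- t * b t) * b t * J ((1 - t) * b t))"
    unfolding set_integrable_def real_scaleR_def
    using f0 fin(1) by (intro integrableI_nonneg AE_I2) measurable
qed

lemma success_formula:
  assumes P: "poisson_point_process M lebesgue_strip N"
    and b0: "\<forall>t\<in>{0..<1}. 0 \<le> b t" and mono: "mono_on {0..<1} b" and cont: "continuous_on {0..<1} b"
  shows "success_probability M N b =
     (LINT t:{0<..<1}|lborel. exp (- t * b t) * b t * J ((1 - t) * b t)) +
     (LINT t:{0<..<1}|stieltjes_measure b. exp (- t * b t) * t * D ((1 - t) * b t))"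
proof -
  define c where "c t = (if t \<in> {0..<1} then b t else 0)" for t
  have c: "c t = b t" if "0 \<le> t" "t < 1" for t using that by (simp add: c_def)
  have "(\<lambda>t. indicator {0..<1} t *\<^sub>R b t) \<in> borel_measurable borel"
    using cont by (intro borel_measurable_continuous_on_indicator) auto
  also have "(\<lambda>t. indicator {0..<1} t *\<^sub>R b t) = c" by (auto simp: c_def indicator_def)
  finally have 1: "c \<in> borel_measurable borel" .
  have 2: "0 \<le> c t" if "0 \<le> t" "t < 1" for t using that b0 by (simp add: c_def)
  have 3: "mono_on {0..<1} c" using mono by (auto simp: mono_on_def c_def)
  have 4: "continuous_on {0..<1} c" using cont by (rule continuous_on_cong[THEN iffD1, rotated -1]) (auto simp: c_def)
  have "acceptable b S t \<longleftrightarrow> acceptable c S t" for S t by (auto simp: acceptable_def c_def)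
  then have "success_probability M N b = success_probability M N c"
    by (simp add: success_probability_def stops_at_def)
  moreover have "stieltjes_measure b = stieltjes_measure c" by (rule stieltjes_measure_cong) (simp add: c)
  moreover have "(LINT t:{0<..<1}|L. exp (- t * b t) * b t * J ((1 - t) * b t)) =
      (LINT t:{0<..<1}|L. exp (- t * c t) * c t * J ((1 - t) * c t))"
    "(LINT t:{0<..<1}|L. exp (- t * b t) * t * D ((1 - t) * b t)) =
      (LINT t:{0<..<1}|L. exp (- t * c t) * t * D ((1 - t) * c t))" for L
    unfolding set_lebesgue_integral_def
    by (intro Bochner_Integration.integral_cong refl; auto simp: indicator_def c)+
  ultimately show ?thesis using success_formula_borel(1)[OF P 1 2 3 4] by simp
qed

lemma exp_tail_integral:
  fixes \<beta> :: real
  shows "set_integrable lborel {\<beta>..} (\<lambda>z. exp (- z))" "(LINT z:{\<beta>..}|lborel. exp (- z)) = exp (- \<beta>)"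
proof -
  have "(\<integral>\<^sup>+z. ennreal (exp (- z)) * indicator {\<beta>..} z \<partial>lborel) = ennreal (0 - (- exp (- \<beta>)))"
  proof (rule nn_integral_FTC_atLeast)
    show "((\<lambda>z::real. - exp (- z)) \<longlongrightarrow> 0) at_top" by real_asymp
  qed (auto intro!: derivative_eq_intros)
  moreover have "(\<integral>\<^sup>+z. ennreal (indicator {\<beta>..} z * exp (- z)) \<partial>lborel) =
      (\<integral>\<^sup>+z. ennreal (exp (- z)) * indicator {\<beta>..} z \<partial>lborel)"
    by (intro nn_integral_cong) (auto simp: indicator_def)
  ultimately have "(\<integral>\<^sup>+z. ennreal (indicator {\<beta>..} z * exp (- z)) \<partial>lborel) = ennreal (exp (- \<beta>))" by simp
  then have "integrable lborel (\<lambda>z. indicator {\<beta>..} z * exp (- z)) \<and> (LINT z|lborel. indicator {\<beta>..} z * exp (- z)) = exp (- \<beta>)"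
    by (subst (asm) nn_integral_eq_integrable) auto
  then show "set_integrable lborel {\<beta>..} (\<lambda>z. exp (- z))" "(LINT z:{\<beta>..}|lborel. exp (- z)) = exp (- \<beta>)"
    by (simp_all add: set_integrable_def set_lebesgue_integral_def)
qed

lemma exp_over_tail_integrable:
  fixes \<beta> :: real assumes "0 < \<beta>"
  shows "set_integrable lborel {\<beta>..} (\<lambda>z. exp (- z) / z)"
  unfolding set_integrable_def
proof (rule Bochner_Integration.integrable_bound)
  show "integrable lborel (\<lambda>z. indicator {\<beta>..} z *\<^sub>R exp (- z) * (1 / \<beta>))"
    using exp_tail_integral(1)[of \<beta>] unfolding set_integrable_def by (rule integrable_mult_left)
  show "AE z in lborel. norm (indicator {\<beta>..} z *\<^sub>R (exp (- z) / z)) \<le> norm (indicator {\<beta>..} z *\<^sub>R exp (- z) * (1 / \<beta>))"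
    using assms by (intro AE_I2) (auto simp: indicator_def intro!: divide_left_mono)
qed measurable

context
  fixes \<beta> :: real
  assumes \<beta>: "0 < \<beta>"
begin

lemma hyperbola_admissible:
  shows "(\<lambda>t. \<beta> / (1 - t)) \<in> borel_measurable borel"
    and "0 \<le> t \<Longrightarrow> t < 1 \<Longrightarrow> 0 \<le> \<beta> / (1 - t)"
    and "mono_on {0..<1} (\<lambda>t. \<beta> / (1 - t))" and "continuous_on {0..<1} (\<lambda>t. \<beta> / (1 - t))"
  using \<beta> by (auto intro!: mono_onI divide_left_mono continuous_intros)

text \<open>
The interval version \<open>stieltjes_push\<close> exhausted by \<open>(1 / (n + 3), 1 - 1 / (n + 3)]\<close>; on these intervals
\<open>b\<close> increases from near \<open>\<beta>\<close> to arbitrarily large values.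
\<close>
lemma hyperbola_push:
  assumes [measurable]: "g \<in> borel_measurable borel"
  shows "(\<integral>\<^sup>+t. g (\<beta> / (1 - t)) * indicator {0<..<1} t \<partial>stieltjes_measure (\<lambda>t. \<beta> / (1 - t))) =
    (\<integral>\<^sup>+z. g z * indicator {\<beta><..} z \<partial>lborel)"
proof -
  let ?b = "\<lambda>t. \<beta> / (1 - t)" let ?L = "stieltjes_measure ?b"
  have mono': "mono_on {0<..<1} ?b" and cont': "continuous_on {0<..<1} ?b"
    by (auto intro: mono_on_subset[OF hyperbola_admissible(3)] continuous_on_subset[OF hyperbola_admissible(4)])
  define s where "s n = 1 / (real n + 3)" for n
  have s: "0 < s n" "s n < 1 - s n" "1 - s n < 1" for n by (auto simp: s_def field_simps)
  have s_anti: "s n \<le> s m" if "m \<le> n" for m n using that by (auto simp: s_def intro!: divide_left_mono)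
  have s0: "s \<longlonglongrightarrow> 0" unfolding s_def by real_asymp
  let ?A = "\<lambda>n. {s n<..1 - s n}" and ?B = "\<lambda>n. {?b (s n)<..?b (1 - s n)}"
  have UA: "(\<Union>n. ?A n) = {0<..<1}"
  proof (intro set_eqI iffI)
    fix x :: real assume x: "x \<in> {0<..<1}"
    have "\<forall>\<^sub>F n in sequentially. s n < x \<and> s n < 1 - x"
      using x by (intro eventually_conj order_tendstoD(2)[OF s0]) auto
    then obtain n where "s n < x \<and> s n < 1 - x" by (auto simp: eventually_sequentially)
    then show "x \<in> (\<Union>n. ?A n)" by (intro UN_I[of n]) auto
  next
    fix x :: real assume "x \<in> (\<Union>n. ?A n)"
    then obtain n where "x \<in> ?A n" by blast
    then show "x \<in> {0<..<1}" using s[of n] by auto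
  qed
  have UB: "(\<Union>n. ?B n) = {\<beta><..}"
  proof (intro set_eqI iffI)
    fix z assume z: "z \<in> {\<beta><..}"
    have "(\<lambda>n. ?b (s n)) \<longlonglongrightarrow> \<beta>" unfolding s_def by real_asymp
    moreover have "filterlim (\<lambda>n. ?b (1 - s n)) at_top sequentially" unfolding s_def using \<beta> by real_asymp
    ultimately have "\<forall>\<^sub>F n in sequentially. ?b (s n) < z \<and> z \<le> ?b (1 - s n)"
      using z by (intro eventually_conj order_tendstoD(2)) (auto simp: filterlim_at_top)
    then obtain n where "?b (s n) < z \<and> z \<le> ?b (1 - s n)" by (auto simp: eventually_sequentially)
    then show "z \<in> (\<Union>n. ?B n)" by (intro UN_I[of n]) auto
  next
    fix z assume "z \<in> (\<Union>n. ?B n)"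
    then obtain n where "z \<in> ?B n" by blast
    moreover have "\<beta> < ?b (s n)" using \<beta> s[of n] by (simp add: field_simps)
    ultimately show "z \<in> {\<beta><..}" by auto
  qed
  have A: "?A n \<in> sets ?L" for n
    unfolding sets_stieltjes_measure using s[of n]
    by (intro sigma_sets.Basic CollectI exI[of _ "s n"] exI[of _ "1 - s n"]) simp
  have incA: "incseq ?A" using s_anti by (fastforce simp: incseq_def)
  have incB: "incseq ?B"
  proof (rule incseq_SucI)
    fix n
    have "?b (s (Suc n)) \<le> ?b (s n)" "?b (1 - s n) \<le> ?b (1 - s (Suc n))"
      using \<beta> s_anti[of n "Suc n"] s[of n] s[of "Suc n"] by (auto intro!: divide_left_mono)
    then show "?B n \<subseteq> ?B (Suc n)" by auto
  qed
  have gb[measurable]: "(\<lambda>t. g (?b t)) \<in> borel_measurable ?L" by measurable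
  have eq: "emeasure (density ?L (\<lambda>t. g (?b t))) (?A n) = emeasure (density lborel g) (?B n)" for n
    using stieltjes_push[OF mono' cont' _ assms s, of n] A[of n]
    by (simp add: emeasure_density)
  have "(\<integral>\<^sup>+t. g (?b t) * indicator {0<..<1} t \<partial>?L) = emeasure (density ?L (\<lambda>t. g (?b t))) (\<Union>n. ?A n)"
  proof -
    have "(\<Union>n. ?A n) \<in> sets ?L" using A by (intro sets.countable_UN) auto
    then show ?thesis by (simp add: emeasure_density UA)
  qed
  also have "\<dots> = (SUP n. emeasure (density ?L (\<lambda>t. g (?b t))) (?A n))"
    using A incA by (intro SUP_emeasure_incseq[symmetric]) auto
  also have "\<dots> = (SUP n. emeasure (density lborel g) (?B n))" unfolding eq ..
  also have "\<dots> = emeasure (density lborel g) (\<Union>n. ?B n)"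
    using incB by (intro SUP_emeasure_incseq) auto
  also have "\<dots> = (\<integral>\<^sup>+z. g z * indicator {\<beta><..} z \<partial>lborel)"
    unfolding UB by (rule emeasure_density) auto
  finally show ?thesis .
qed

lemma set_integral_open_tail:
  fixes f :: "real \<Rightarrow> real"
  assumes "set_integrable lborel {\<beta>..} f"
  shows "(LINT z:{\<beta><..}|lborel. f z) = (LINT z:{\<beta>..}|lborel. f z)"
  unfolding set_lebesgue_integral_def
proof (rule integral_cong_AE)
  show 1: "(\<lambda>z. indicator {\<beta>..} z *\<^sub>R f z) \<in> borel_measurable lborel"
    using assms unfolding set_integrable_def by (rule borel_measurable_integrable)
  have "(\<lambda>z. indicator {\<beta><..} z *\<^sub>R (indicator {\<beta>..} z *\<^sub>R f z)) \<in> borel_measurable lborel"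
    using 1 by measurable
  also have "(\<lambda>z. indicator {\<beta><..} z *\<^sub>R (indicator {\<beta>..} z *\<^sub>R f z)) = (\<lambda>z. indicator {\<beta><..} z *\<^sub>R f z)"
    by (auto simp: indicator_def)
  finally show "(\<lambda>z. indicator {\<beta><..} z *\<^sub>R f z) \<in> borel_measurable lborel" .
  show "AE z in lborel. indicator {\<beta><..} z *\<^sub>R f z = indicator {\<beta>..} z *\<^sub>R f z"
    using AE_lborel_singleton[of \<beta>] by eventually_elim (auto simp: indicator_def)
qed

text \<open>
With \<open>z = b t\<close> one has \<open>t = 1 - \<beta> / z\<close> and \<open>t * b t = z - \<beta>\<close>.
\<close>
lemma hyperbola_crossing:
  "(LINT t:{0<..<1}|stieltjes_measure (\<lambda>t. \<beta> / (1 - t)). exp (- t * (\<beta> / (1 - t))) * t * D ((1 - t) * (\<beta> / (1 - t)))) =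
   D \<beta> * (1 - \<beta> * exp \<beta> * (LINT z:{\<beta>..}|lborel. exp (- z) / z))"
proof -
  let ?L = "stieltjes_measure (\<lambda>t. \<beta> / (1 - t))"
  let ?E = "LINT z:{\<beta>..}|lborel. exp (- z) / z"
  let ?h = "\<lambda>z. D \<beta> * exp \<beta> * (exp (- z) - \<beta> * (exp (- z) / z))"
  have h0: "0 \<le> ?h z" if "\<beta> \<le> z" for z
  proof -
    have "\<beta> * (exp (- z) / z) \<le> exp (- z)" using \<beta> that by (simp add: field_simps)
    then show ?thesis using D_nonneg by simp
  qed
  have int: "set_integrable lborel {\<beta>..} ?h"
    using exp_tail_integral(1) exp_over_tail_integrable[OF \<beta>]
    by (intro set_integrable_mult_right set_integral_diff) auto
  have val: "(LINT z:{\<beta>..}|lborel. ?h z) = D \<beta> * (1 - \<beta> * exp \<beta> * ?E)"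
  proof -
    have "(LINT z:{\<beta>..}|lborel. exp (- z) - \<beta> * (exp (- z) / z)) =
        (LINT z:{\<beta>..}|lborel. exp (- z)) - (LINT z:{\<beta>..}|lborel. \<beta> * (exp (- z) / z))"
      using exp_tail_integral(1)[of \<beta>] exp_over_tail_integrable[OF \<beta>]
      by (intro set_integral_diff(2) set_integrable_mult_right) auto
    also have "\<dots> = exp (- \<beta>) - \<beta> * ?E" unfolding exp_tail_integral(2) set_integral_mult_right ..
    finally show ?thesis
      unfolding set_integral_mult_right by (simp add: right_diff_distrib exp_minus mult_ac)
  qed
  have "(LINT t:{0<..<1}|?L. exp (- t * (\<beta> / (1 - t))) * t * D ((1 - t) * (\<beta> / (1 - t)))) =
     (LINT t|?L. indicator {0<..<1} t * ?h (\<beta> / (1 - t)))"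
    unfolding set_lebesgue_integral_def
  proof (rule Bochner_Integration.integral_cong[OF refl])
    fix t assume "t \<in> space ?L"
    then have t: "0 < t" "t < 1" by auto
    have "- t * (\<beta> / (1 - t)) = \<beta> - \<beta> / (1 - t)" using t by (simp add: field_simps)
    then have "exp (- t * (\<beta> / (1 - t))) = exp \<beta> * exp (- (\<beta> / (1 - t)))"
      by (simp add: exp_add[symmetric])
    moreover have "(1 - t) * (\<beta> / (1 - t)) = \<beta>" using t by simp
    moreover have "\<beta> * (exp (- (\<beta> / (1 - t))) / (\<beta> / (1 - t))) = (1 - t) * exp (- (\<beta> / (1 - t)))"
      using t \<beta> by simp
    ultimately show "indicator {0<..<1} t *\<^sub>R (exp (- t * (\<beta> / (1 - t))) * t * D ((1 - t) * (\<beta> / (1 - t)))) =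
       indicator {0<..<1} t * ?h (\<beta> / (1 - t))"
      by (simp only:) (simp add: left_diff_distrib mult_ac)
  qed
  also have "\<dots> = enn2real (\<integral>\<^sup>+t. ennreal (indicator {0<..<1} t * ?h (\<beta> / (1 - t))) \<partial>?L)"
  proof (intro integral_eq_nn_integral AE_I2)
    fix t
    show "0 \<le> indicator {0<..<1} t * ?h (\<beta> / (1 - t))"
      using h0[of "\<beta> / (1 - t)"] \<beta> by (cases "t \<in> {0<..<1}") (auto simp: field_simps)
  qed measurable
  also have "(\<integral>\<^sup>+t. ennreal (indicator {0<..<1} t * ?h (\<beta> / (1 - t))) \<partial>?L) =
     (\<integral>\<^sup>+t. ennreal (?h (\<beta> / (1 - t))) * indicator {0<..<1} t \<partial>?L)"
    by (intro nn_integral_cong) auto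
  also have "\<dots> = (\<integral>\<^sup>+z. ennreal (?h z) * indicator {\<beta><..} z \<partial>lborel)"
    by (rule hyperbola_push[of "\<lambda>z. ennreal (?h z)"]) measurable
  also have "\<dots> = (\<integral>\<^sup>+z. ennreal (indicator {\<beta>..} z * ?h z) \<partial>lborel)"
  proof (rule nn_integral_cong_AE)
    show "AE z in lborel. ennreal (?h z) * indicator {\<beta><..} z = ennreal (indicator {\<beta>..} z * ?h z)"
      using AE_lborel_singleton[of \<beta>] by eventually_elim (auto simp: indicator_def)
  qed
  also have "enn2real \<dots> = (LINT z|lborel. indicator {\<beta>..} z * ?h z)"
  proof (rule integral_eq_nn_integral[symmetric])
    show "AE z in lborel. 0 \<le> indicator {\<beta>..} z * ?h z" using h0 by (intro AE_I2) (auto simp: indicator_def)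
  qed measurable
  also have "\<dots> = (LINT z:{\<beta>..}|lborel. ?h z)"
    by (simp only: set_lebesgue_integral_def real_scaleR_def)
  also have "\<dots> = D \<beta> * (1 - \<beta> * exp \<beta> * ?E)" by (rule val)
  finally show ?thesis .
qed

lemma hyperbola_jump:
  assumes int: "set_integrable lborel {0<..<1} (\<lambda>t. exp (- t * (\<beta> / (1 - t))) * (\<beta> / (1 - t)) * J ((1 - t) * (\<beta> / (1 - t))))"
  shows "(LINT t:{0<..<1}|lborel. exp (- t * (\<beta> / (1 - t))) * (\<beta> / (1 - t)) * J ((1 - t) * (\<beta> / (1 - t)))) =
   J \<beta> * \<beta> * exp \<beta> * (LINT z:{\<beta>..}|lborel. exp (- z) / z)"
proof -
  let ?f = "\<lambda>z. J \<beta> * \<beta> * exp \<beta> * (exp (- z) / z)"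
  let ?g = "\<lambda>t. \<beta> / (1 - t)" and ?g' = "\<lambda>t. \<beta> / (1 - t)\<^sup>2"
  have fg: "?f (?g t) * ?g' t = exp (- t * (\<beta> / (1 - t))) * (\<beta> / (1 - t)) * J ((1 - t) * (\<beta> / (1 - t)))"
    if "0 < t" "t < 1" for t
  proof -
    have "- t * (\<beta> / (1 - t)) = \<beta> - \<beta> / (1 - t)" using that by (simp add: field_simps)
    then have "exp (- t * (\<beta> / (1 - t))) = exp \<beta> * exp (- (\<beta> / (1 - t)))"
      by (simp add: exp_add[symmetric])
    then show ?thesis using that \<beta> by (simp add: power2_eq_square)
  qed
  have "(LBINT z=ereal \<beta>..\<infinity>. ?f z) = (LBINT t=ereal 0..ereal 1. ?f (?g t) * ?g' t)"
  proof (rule interval_integral_substitution_nonneg(2))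
    show "((ereal \<circ> ?g \<circ> real_of_ereal) \<longlongrightarrow> ereal \<beta>) (at_right (ereal 0))"
      unfolding ereal_tendsto_simps by real_asymp
    show "((ereal \<circ> ?g \<circ> real_of_ereal) \<longlongrightarrow> \<infinity>) (at_left (ereal 1))"
      unfolding ereal_tendsto_simps using \<beta> by real_asymp
    show "set_integrable lborel (einterval (ereal 0) (ereal 1)) (\<lambda>t. ?f (?g t) * ?g' t)"
      using int by (rule set_integrable_cong[THEN iffD1, rotated -1]) (use fg in auto)
    show "0 \<le> ?f (?g t)" if "ereal 0 < ereal t" "ereal t < ereal 1" for t
      using that \<beta> J_nonneg[of \<beta>] by (intro mult_nonneg_nonneg divide_nonneg_nonneg) auto
  qed (use \<beta> in \<open>auto intro!: derivative_eq_intros continuous_intros simp: power2_eq_square\<close>)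
  also have "(LBINT z=ereal \<beta>..\<infinity>. ?f z) = (LINT z:{\<beta><..}|lborel. ?f z)"
    by (rule interval_integral_to_infinity_eq)
  also have "\<dots> = (LINT z:{\<beta>..}|lborel. ?f z)"
    using exp_over_tail_integrable[OF \<beta>] by (intro set_integral_open_tail set_integrable_mult_right) auto
  also have "\<dots> = J \<beta> * \<beta> * exp \<beta> * (LINT z:{\<beta>..}|lborel. exp (- z) / z)"
    by (rule set_integral_mult_right)
  also have "(LBINT t=ereal 0..ereal 1. ?f (?g t) * ?g' t) = (LINT t:{0<..<1}|lborel. ?f (?g t) * ?g' t)"
    by (simp add: interval_lebesgue_integral_le_eq)
  also have "\<dots> = (LINT t:{0<..<1}|lborel. exp (- t * (\<beta> / (1 - t))) * (\<beta> / (1 - t)) * J ((1 - t) * (\<beta> / (1 - t))))"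
    by (rule set_lebesgue_integral_cong) (use fg in auto)
  finally show ?thesis ..
qed

end

theorem mainTheorem4:
  fixes M :: "'w measure" and N :: "'w \<Rightarrow> (real \<times> real) set"
  assumes "poisson_point_process M lebesgue_strip N"
  shows "(\<forall>b :: real \<Rightarrow> real.
            (\<forall>t\<in>{0..<1}. 0 \<le> b t) \<longrightarrow> mono_on {0..<1} b \<longrightarrow> continuous_on {0..<1} b \<longrightarrow>
            filterlim b at_top (at_left 1) \<longrightarrow>
            success_probability M N b =
              (LINT t:{0<..<1}|lborel. exp (- t * b t) * b t * J ((1 - t) * b t)) +
              (LINT t:{0<..<1}|stieltjes_measure b. exp (- t * b t) * t * D ((1 - t) * b t))) \<and>
         (\<forall>\<beta> :: real. \<beta> > 0 \<longrightarrow>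
            success_probability M N (\<lambda>t. \<beta> / (1 - t)) =
              D \<beta> + (J \<beta> - D \<beta>) * \<beta> * exp \<beta> * (LINT z:{\<beta>..}|lborel. exp (- z) / z))"
proof (intro conjI allI impI)
  fix b :: "real \<Rightarrow> real"
  assume "\<forall>t\<in>{0..<1}. 0 \<le> b t" "mono_on {0..<1} b" "continuous_on {0..<1} b"
  then show "success_probability M N b =
      (LINT t:{0<..<1}|lborel. exp (- t * b t) * b t * J ((1 - t) * b t)) +
      (LINT t:{0<..<1}|stieltjes_measure b. exp (- t * b t) * t * D ((1 - t) * b t))"
    by (rule success_formula[OF assms])
next
  fix \<beta> :: real assume \<beta>: "\<beta> > 0"
  note F = success_formula_borel[OF assms hyperbola_admissible[OF \<beta>]]
  have "success_probability M N (\<lambda>t. \<beta> / (1 - t)) =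
      J \<beta> * \<beta> * exp \<beta> * (LINT z:{\<beta>..}|lborel. exp (- z) / z) +
      D \<beta> * (1 - \<beta> * exp \<beta> * (LINT z:{\<beta>..}|lborel. exp (- z) / z))"
    using F(1) hyperbola_jump[OF \<beta> F(2)] hyperbola_crossing[OF \<beta>] by (simp only:)
  then show "success_probability M N (\<lambda>t. \<beta> / (1 - t)) =
      D \<beta> + (J \<beta> - D \<beta>) * \<beta> * exp \<beta> * (LINT z:{\<beta>..}|lborel. exp (- z) / z)"
    by (simp add: algebra_simps)
qed

end
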